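(* Let $\Omega\subset\mathbb{R}^n$ be an open and bounded domain. For every $u\in L^2(\Omega)$ it holds $$\partial\mathcal{J}(u)=\Big\{-\operatorname{div} q \;:\; q=g+r,\ g\in G^1_0(\Omega),\ r\in\mathcal{N}(\operatorname{div};\Omega),\ \int_\Omega -(\operatorname{div} q)\,u\,\mathrm{d}x=\mathcal{J}(u),\ |q|(\Omega)\le 1\Big\}.$$
   Context: $W^{1,\infty}_0(\Omega)=\{u\in W^{1,\infty}(\Omega): u=0\text{ on }\partial\Omega\}$ (Lipschitz functions vanishing on $\partial\Omega$). $\mathcal{J}:L^2(\Omega)\to[0,\infty]$ is $\mathcal{J}(u)=\|\nabla u\|_\infty$ if $u\in W^{1,\infty}_0(\Omega)$ and $\mathcal{J}(u)=+\infty$ otherwise. Its $L^2$-subdifferential is $\partial\mathcal{J}(u)=\{\zeta\in L^2(\Omega): \langle\zeta,v\rangle\le\mathcal{J}(v)\ \forall v\in L^2(\Omega),\ \langle\zeta,u\rangle=\mathcal{J}(u)\}$, with $\langle\cdot,\cdot\rangle$ the $L^2(\Omega)$ inner product. $G^1_0(\Omega)=\{\nabla\varphi:\varphi\in H^1_0(\Omega),\ \Delta\varphi\in L^2(\Omega)\}$. $\mathcal{M}(\Omega,\mathbb{R}^n)$ is the space of $\mathbb{R}^n$-valued finite Radon measures on $\Omega$, with total variation measure $|\mu|$. $\mathcal{N}(\operatorname{div};\Omega)=\{r\in\mathcal{M}(\Omega,\mathbb{R}^n):\operatorname{div} r=0\}$, where $\operatorname{div} r=0$ means $\int_\Omega\nabla\varphi\cdot\mathrm{d}r=0$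 for all $\varphi\in C_c^\infty(\Omega)$. The function $g$ is identified with the measure $g\,\mathrm{d}x$, so $q=g+r\in\mathcal{M}(\Omega,\mathbb{R}^n)$ and $\operatorname{div} q=\operatorname{div} g\in L^2(\Omega)$ in the distributional sense. *)

theory Defs
  imports "HOL-Analysis.Analysis" "HOL-Probability.Essential_Supremum"
begin

text \<open>
  Functions on \<open>\<Omega>\<close> are total functions whose values outside \<open>\<Omega>\<close> are irrelevant, and elements of the
  Lebesgue and Sobolev spaces are representatives rather than almost-everywhere classes. These
  spaces and the subdifferential are closed under changing a function on a null set.
\<close>

section \<open>Test functions\<close>

definition grad :: "('a::euclidean_space \<Rightarrow> real) \<Rightarrow> 'a \<Rightarrow> 'a" where
  "grad f x = (THE D. GDERIV f x :> D)"

primrec Ck :: "nat \<Rightarrow> ('a::euclidean_space \<Rightarrow> real) \<Rightarrow> bool" where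
  "Ck 0 f \<longleftrightarrow> continuous_on UNIV f"
| "Ck (Suc k) f \<longleftrightarrow>
     (\<exists>D. (\<forall>x. GDERIV f x :> D x) \<and> (\<forall>i\<in>Basis. Ck k (\<lambda>x. D x \<bullet> i)))"

text \<open>\<open>C\<^sub>c\<^sup>\<infinity>(\<Omega>)\<close>, each function being extended by zero to the whole space.\<close>

definition test_functions :: "'a::euclidean_space set \<Rightarrow> ('a \<Rightarrow> real) set" where
  "test_functions \<Omega> =
     {\<phi>. (\<forall>k. Ck k \<phi>) \<and> compact (closure {x. \<phi> x \<noteq> 0}) \<and> closure {x. \<phi> x \<noteq> 0} \<subseteq> \<Omega>}"

section \<open>Lebesgue and Sobolev spaces\<close>

definition L2 :: "'a::euclidean_space set \<Rightarrow> ('a \<Rightarrow> 'b::euclidean_space) set" where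
  "L2 \<Omega> = {f \<in> borel_measurable (lebesgue_on \<Omega>). integrable (lebesgue_on \<Omega>) (\<lambda>x. (norm (f x))\<^sup>2)}"

definition L2_inner :: "'a::euclidean_space set \<Rightarrow> ('a \<Rightarrow> real) \<Rightarrow> ('a \<Rightarrow> real) \<Rightarrow> real" where
  "L2_inner \<Omega> f h = (\<integral>x. f x * h x \<partial>lebesgue_on \<Omega>)"

definition Linf :: "'a::euclidean_space set \<Rightarrow> ('a \<Rightarrow> 'b::euclidean_space) set" where
  "Linf \<Omega> = {f \<in> borel_measurable (lebesgue_on \<Omega>). \<exists>C. AE x in lebesgue_on \<Omega>. norm (f x) \<le> C}"

definition L1_loc :: "'a::euclidean_space set \<Rightarrow> ('a \<Rightarrow> 'b::euclidean_space) set" where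
  "L1_loc \<Omega> = {f. \<forall>K. compact K \<and> K \<subseteq> \<Omega> \<longrightarrow> integrable (lebesgue_on K) f}"

definition has_weak_grad :: "'a::euclidean_space set \<Rightarrow> ('a \<Rightarrow> real) \<Rightarrow> ('a \<Rightarrow> 'a) \<Rightarrow> bool" where
  "has_weak_grad \<Omega> u p \<longleftrightarrow> u \<in> L1_loc \<Omega> \<and> p \<in> L1_loc \<Omega> \<and>
     (\<forall>\<phi>\<in>test_functions \<Omega>. \<forall>i\<in>Basis.
        (\<integral>x. u x * (grad \<phi> x \<bullet> i) \<partial>lebesgue_on \<Omega>) = - (\<integral>x. (p x \<bullet> i) * \<phi> x \<partial>lebesgue_on \<Omega>))"

definition weak_grad :: "'a::euclidean_space set \<Rightarrow> ('a \<Rightarrow> real) \<Rightarrow> 'a \<Rightarrow> 'a" where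
  "weak_grad \<Omega> u = (SOME p. has_weak_grad \<Omega> u p)"

definition has_weak_div :: "'a::euclidean_space set \<Rightarrow> ('a \<Rightarrow> 'a) \<Rightarrow> ('a \<Rightarrow> real) \<Rightarrow> bool" where
  "has_weak_div \<Omega> g f \<longleftrightarrow> g \<in> L1_loc \<Omega> \<and> f \<in> L1_loc \<Omega> \<and>
     (\<forall>\<phi>\<in>test_functions \<Omega>.
        (\<integral>x. g x \<bullet> grad \<phi> x \<partial>lebesgue_on \<Omega>) = - (\<integral>x. f x * \<phi> x \<partial>lebesgue_on \<Omega>))"

definition H1 :: "'a::euclidean_space set \<Rightarrow> ('a \<Rightarrow> real) set" where
  "H1 \<Omega> = {u \<in> L2 \<Omega>. \<exists>p\<in>L2 \<Omega>. has_weak_grad \<Omega> u p}"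

text \<open>The closure of the test functions in \<open>H\<^sup>1(\<Omega>)\<close>.\<close>

definition H1_0 :: "'a::euclidean_space set \<Rightarrow> ('a \<Rightarrow> real) set" where
  "H1_0 \<Omega> = {u \<in> H1 \<Omega>. \<exists>\<psi>. (\<forall>k. \<psi> k \<in> test_functions \<Omega>) \<and>
     (\<lambda>k::nat. \<integral>x. (\<psi> k x - u x)\<^sup>2 \<partial>lebesgue_on \<Omega>) \<longlonglongrightarrow> 0 \<and>
     (\<lambda>k. \<integral>x. (norm (grad (\<psi> k) x - weak_grad \<Omega> u x))\<^sup>2 \<partial>lebesgue_on \<Omega>) \<longlonglongrightarrow> 0}"

definition W1inf :: "'a::euclidean_space set \<Rightarrow> ('a \<Rightarrow> real) set" where
  "W1inf \<Omega> = {u \<in> Linf \<Omega>. \<exists>p\<in>Linf \<Omega>. has_weak_grad \<Omega> u p}"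

text \<open>Boundary values are those of the Lipschitz representative on the closure of \<open>\<Omega>\<close>.\<close>

definition W1inf_0 :: "'a::euclidean_space set \<Rightarrow> ('a \<Rightarrow> real) set" where
  "W1inf_0 \<Omega> = {u \<in> W1inf \<Omega>. \<exists>w C. C-lipschitz_on (closure \<Omega>) w \<and>
     (AE x in lebesgue_on \<Omega>. w x = u x) \<and> (\<forall>x\<in>frontier \<Omega>. w x = 0)}"

section \<open>The functional and its subdifferential\<close>

definition Jfun :: "'a::euclidean_space set \<Rightarrow> ('a \<Rightarrow> real) \<Rightarrow> ereal" where
  "Jfun \<Omega> u = (if u \<in> W1inf_0 \<Omega>
                then esssup (lebesgue_on \<Omega>) (\<lambda>x. ereal (norm (weak_grad \<Omega> u x))) else \<infinity>)"

definition subdiff_J :: "'a::euclidean_space set \<Rightarrow> ('a \<Rightarrow> real) \<Rightarrow> ('a \<Rightarrow> real) set" where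
  "subdiff_J \<Omega> u = {\<zeta> \<in> L2 \<Omega>.
     (\<forall>v\<in>L2 \<Omega>. ereal (L2_inner \<Omega> \<zeta> v) \<le> Jfun \<Omega> v) \<and> ereal (L2_inner \<Omega> \<zeta> u) = Jfun \<Omega> u}"

definition G1_0 :: "'a::euclidean_space set \<Rightarrow> ('a \<Rightarrow> 'a) set" where
  "G1_0 \<Omega> = {g \<in> L2 \<Omega>. \<exists>\<phi>\<in>H1_0 \<Omega>. has_weak_grad \<Omega> \<phi> g \<and> (\<exists>f\<in>L2 \<Omega>. has_weak_div \<Omega> g f)}"

section \<open>Vector-valued measures\<close>

abbreviation borel_sets_on :: "'a::euclidean_space set \<Rightarrow> 'a set set" where
  "borel_sets_on \<Omega> \<equiv> sets (restrict_space borel \<Omega>)"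

text \<open>
  A finite vector-valued Radon measure on \<open>\<Omega>\<close> is a countably additive vector-valued function on the
  Borel subsets of \<open>\<Omega>\<close>; its values on other sets are irrelevant. Vanishing on the empty set and finite
  total variation are consequences.
\<close>

definition vector_measures :: "'a::euclidean_space set \<Rightarrow> ('a set \<Rightarrow> 'a) set" where
  "vector_measures \<Omega> = {\<mu>. \<forall>A::nat \<Rightarrow> 'a set. range A \<subseteq> borel_sets_on \<Omega> \<and> disjoint_family A
     \<longrightarrow> (\<lambda>i. \<mu> (A i)) sums \<mu> (\<Union>i. A i)}"

definition total_variation ::
  "'a::euclidean_space set \<Rightarrow> ('a set \<Rightarrow> 'a) \<Rightarrow> 'a set \<Rightarrow> ennreal" where
  "total_variation \<Omega> \<mu> E =
     (SUP A\<in>{A::nat \<Rightarrow> 'a set. range A \<subseteq> borel_sets_on \<Omega> \<and> disjoint_family A \<and> (\<Union>i. A i) = E}.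
        \<Sum>i. ennreal (norm (\<mu> (A i))))"

text \<open>
  The positive part in the Jordan decomposition of a real signed measure; \<open>ennreal\<close> maps negative
  numbers to \<open>0\<close>. The negative part of \<open>\<nu>\<close> is the positive part of \<open>-\<nu>\<close>.
\<close>

definition jordan_pos :: "'a::euclidean_space set \<Rightarrow> ('a set \<Rightarrow> real) \<Rightarrow> 'a measure" where
  "jordan_pos \<Omega> \<nu> = measure_of \<Omega> (borel_sets_on \<Omega>)
     (\<lambda>A. SUP B\<in>{B \<in> borel_sets_on \<Omega>. B \<subseteq> A}. ennreal (\<nu> B))"

text \<open>\<open>\<integral>\<^sub>\<Omega> F \<cdot> d\<mu>\<close>, as the sum of the integrals of the components.\<close>

definition vector_integral ::
  "'a::euclidean_space set \<Rightarrow> ('a set \<Rightarrow> 'a) \<Rightarrow> ('a \<Rightarrow> 'a) \<Rightarrow> real" where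
  "vector_integral \<Omega> \<mu> F = (\<Sum>i\<in>Basis.
     (\<integral>x. F x \<bullet> i \<partial>jordan_pos \<Omega> (\<lambda>A. \<mu> A \<bullet> i)) - (\<integral>x. F x \<bullet> i \<partial>jordan_pos \<Omega> (\<lambda>A. - (\<mu> A \<bullet> i))))"

text \<open>The measure \<open>g dx\<close>.\<close>

definition field_measure :: "('a::euclidean_space \<Rightarrow> 'a) \<Rightarrow> 'a set \<Rightarrow> 'a" where
  "field_measure g A = (\<integral>x. g x \<partial>lebesgue_on A)"

definition has_measure_div ::
  "'a::euclidean_space set \<Rightarrow> ('a set \<Rightarrow> 'a) \<Rightarrow> ('a \<Rightarrow> real) \<Rightarrow> bool" where
  "has_measure_div \<Omega> \<mu> f \<longleftrightarrow> f \<in> L1_loc \<Omega> \<and>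
     (\<forall>\<phi>\<in>test_functions \<Omega>.
        vector_integral \<Omega> \<mu> (grad \<phi>) = - (\<integral>x. f x * \<phi> x \<partial>lebesgue_on \<Omega>))"

definition N_div :: "'a::euclidean_space set \<Rightarrow> ('a set \<Rightarrow> 'a) set" where
  "N_div \<Omega> = {r \<in> vector_measures \<Omega>. \<forall>\<phi>\<in>test_functions \<Omega>. vector_integral \<Omega> r (grad \<phi>) = 0}"

end

(* A function zeta in L^2 belongs to the subdifferential iff <zeta, v> <= J v for all v and equality
   holds at u, so everything reduces to the dual description of the unit ball of J.

   If zeta = - div q with |q|(Omega) <= 1, a function in W^{1,infinity}_0 with |grad v| <= L extends
   by zero to an L-Lipschitz function on the whole space; soft thresholding and mollification turn
   it into test functions eta with |grad eta| <= L, for which the integral of zeta eta equals that of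
   grad eta . dq and so is at most L.

   Conversely, grad phi |-> int zeta phi has norm at most 1 for the supremum norm. Pulled back along
   a continuous surjection from a Cantor space onto a cube it extends by Hahn-Banach to all continuous
   fields on the Cantor space. There indicators of clopen sets are continuous, so the extension
   directly defines finitely additive charges, which are countably additive by compactness;
   pushing them forward gives q. The gradient part g solves the Poisson problem with right-hand side
   zeta, by minimising the Dirichlet energy. *)
theory Submission
  imports Defs "HOL-Computational_Algebra.Polynomial"
begin

section \<open>Smooth functions and a bump function\<close>

text \<open>For a given q the obstacle is geometric: \<Omega> need not be convex, and a gradient
  bound L controls differences only along segments inside \<Omega>. The zero boundary values repair
  this, since wherever a segment leaves \<Omega> both end values are controlled by the distance to
  the complement. A multiplicative cutoff would enlarge the gradient; thresholding keeps the
  constant L exactly. In the converse direction the charges have no sign, so no extension theorem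
  for positive set functions applies to them directly. The norm of the functional localised to a
  clopen set is itself finitely additive, and adding it makes every charge along a unit vector
  nonnegative. The same variation dominates the vector measure in the Euclidean norm, direction by
  direction and not just by coordinates; its total mass is the norm of the functional, and this is
  where |q|(\<Omega>) \<le> 1 comes from. The splitting of q is then automatic: g is chosen with the
  divergence that q has, so q - g dx is divergence free.\<close>

lemma GDERIV_unique: "GDERIV f x :> D \<Longrightarrow> GDERIV f x :> D' \<Longrightarrow> D = D'"
  unfolding gderiv_def using has_derivative_unique[of f _ x]
  by (metis (no_types, lifting) inner_commute vector_eq_ldot)

lemma grad_eq: "GDERIV f x :> D \<Longrightarrow> grad f x = D"
  unfolding grad_def by (rule the_equality) (auto intro: GDERIV_unique)

text \<open>The existential witness in \<open>Ck\<close> is forced by uniqueness of gradients. With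
  the canonical \<open>grad\<close> in its place the inductions below speak of one named
  function.\<close>

lemma Ck_Suc_grad:
  "Ck (Suc k) f \<longleftrightarrow> (\<forall>x. GDERIV f x :> grad f x) \<and> (\<forall>i\<in>Basis. Ck k (\<lambda>x. grad f x \<bullet> i))"
proof
  assume "Ck (Suc k) f"
  then obtain D where D: "\<forall>x. GDERIV f x :> D x" "\<forall>i\<in>Basis. Ck k (\<lambda>x. D x \<bullet> i)" by auto
  have "grad f x = D x" for x using D(1) by (intro grad_eq) blast
  then have "D = grad f" by (simp add: fun_eq_iff)
  with D show "(\<forall>x. GDERIV f x :> grad f x) \<and> (\<forall>i\<in>Basis. Ck k (\<lambda>x. grad f x \<bullet> i))" by auto
qed auto

lemma GDERIV_isCont: "GDERIV f x :> D \<Longrightarrow> isCont f x"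
  unfolding gderiv_def by (rule has_derivative_continuous)

lemma Ck_SucI:
  "(\<And>x. GDERIV f x :> D x) \<Longrightarrow> (\<And>i. i \<in> Basis \<Longrightarrow> Ck k (\<lambda>x. D x \<bullet> i)) \<Longrightarrow> Ck (Suc k) f"
  by auto

declare Ck.simps(2)[simp del]

lemma Ck_continuous: "Ck k f \<Longrightarrow> continuous_on UNIV f"
  by (cases k) (auto simp: Ck_Suc_grad continuous_on_eq_continuous_within dest!: GDERIV_isCont)

lemma Ck_SucD: "Ck (Suc k) f \<Longrightarrow> Ck k f"
proof (induction k arbitrary: f)
  case 0
  then show ?case using Ck_continuous[of "Suc 0" f] by simp
next
  case (Suc k)
  then show ?case by (auto simp: Ck_Suc_grad)
qed

lemma Ck_const: "Ck k (\<lambda>x. c)"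
proof (induction k arbitrary: c)
  case (Suc k)
  show ?case by (rule Ck_SucI[where D="\<lambda>x. 0"]) (auto simp: GDERIV_const Suc)
qed simp

lemma Ck_add: "Ck k f \<Longrightarrow> Ck k g \<Longrightarrow> Ck k (\<lambda>x. f x + g x)"
proof (induction k arbitrary: f g)
  case 0 then show ?case by (auto intro: continuous_intros)
next
  case (Suc k)
  show ?case
    by (rule Ck_SucI[where D="\<lambda>x. grad f x + grad g x"])
      (use Suc in \<open>auto simp: Ck_Suc_grad inner_add_left intro!: GDERIV_add\<close>)
qed

lemma Ck_mult: "Ck k f \<Longrightarrow> Ck k g \<Longrightarrow> Ck k (\<lambda>x. f x * g x)"
proof (induction k arbitrary: f g)
  case 0 then show ?case by (auto intro: continuous_intros)
next
  case (Suc k)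
  show ?case
  proof (rule Ck_SucI[where D="\<lambda>x. f x *\<^sub>R grad g x + g x *\<^sub>R grad f x"])
    show "GDERIV (\<lambda>x. f x * g x) x :> f x *\<^sub>R grad g x + g x *\<^sub>R grad f x" for x
      using Suc.prems by (intro GDERIV_mult) (auto simp: Ck_Suc_grad)
    fix i :: 'a assume "i \<in> Basis"
    then show "Ck k (\<lambda>x. (f x *\<^sub>R grad g x + g x *\<^sub>R grad f x) \<bullet> i)"
      using Suc.prems[THEN Ck_SucD] Suc.prems
      by (auto simp: Ck_Suc_grad inner_add_left intro!: Ck_add Suc.IH)
  qed
qed

lemma Ck_cmult: "Ck k f \<Longrightarrow> Ck k (\<lambda>x. c * f x)"
  by (intro Ck_mult Ck_const)

lemma Ck_diff: "Ck k f \<Longrightarrow> Ck k g \<Longrightarrow> Ck k (\<lambda>x. f x - g x)"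
  using Ck_add[of k f "\<lambda>x. -1 * g x"] Ck_cmult[of k g "-1"] by simp

lemma Ck_prod: "finite I \<Longrightarrow> (\<And>i. i \<in> I \<Longrightarrow> Ck k (f i)) \<Longrightarrow> Ck k (\<lambda>x. \<Prod>i\<in>I. f i x)"
  by (induction I rule: finite_induct) (auto intro: Ck_const Ck_mult)

lemma Ck_exp: "Ck k f \<Longrightarrow> Ck k (\<lambda>x. exp (f x))"
proof (induction k)
  case 0 then show ?case by (auto intro: continuous_intros)
next
  case (Suc k)
  show ?case
  proof (rule Ck_SucI[where D="\<lambda>x. exp (f x) *\<^sub>R grad f x"])
    show "GDERIV (\<lambda>x. exp (f x)) x :> exp (f x) *\<^sub>R grad f x" for x
      using Suc.prems by (intro GDERIV_DERIV_compose) (auto simp: Ck_Suc_grad)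
    fix i :: 'a assume "i \<in> Basis"
    then show "Ck k (\<lambda>x. (exp (f x) *\<^sub>R grad f x) \<bullet> i)"
      using Suc.prems Suc.IH[OF Ck_SucD[OF Suc.prems]]
      by (auto simp: Ck_Suc_grad intro!: Ck_mult)
  qed
qed

text \<open>Prepares the kernel \<open>\<rho> (x - y)\<close> as a test function of y, which is how
  weak derivatives are tested inside a convolution.\<close>

lemma Ck_reflect: "Ck k f \<Longrightarrow> Ck k (\<lambda>x. f (a - x))"
  and grad_reflect: "Ck (Suc k) f \<Longrightarrow> grad (\<lambda>x. f (a - x)) x = - grad f (a - x)"
proof -
  have D: "GDERIV (\<lambda>x. f (a - x)) x :> - grad f (a - x)" if "GDERIV f (a - x) :> grad f (a - x)" for f :: "'a \<Rightarrow> real" and x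
  proof -
    have "((\<lambda>x. a - x) has_derivative (\<lambda>h. - h)) (at x)"
      by (auto intro!: derivative_eq_intros)
    from has_derivative_compose[OF this that[unfolded gderiv_def]] show ?thesis
      by (simp add: gderiv_def)
  qed
  show "Ck k f \<Longrightarrow> Ck k (\<lambda>x. f (a - x))"
  proof (induction k arbitrary: f)
    case 0
    then show ?case
      by (auto intro!: continuous_on_compose2[of UNIV f UNIV "\<lambda>x. a - x"] continuous_intros)
  next
    case (Suc k)
    show ?case
    proof (rule Ck_SucI[where D="\<lambda>x. - grad f (a - x)"])
      show "GDERIV (\<lambda>x. f (a - x)) x :> - grad f (a - x)" for x
        using Suc.prems by (intro D) (auto simp: Ck_Suc_grad)
      fix i :: 'a assume "i \<in> Basis"
      then have "Ck k (\<lambda>x. grad f (a - x) \<bullet> i)"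
        using Suc.prems Suc.IH[of "\<lambda>x. grad f x \<bullet> i"] by (auto simp: Ck_Suc_grad)
      from Ck_cmult[OF this, of "-1"] show "Ck k (\<lambda>x. - grad f (a - x) \<bullet> i)" by simp
    qed
  qed
  show "Ck (Suc k) f \<Longrightarrow> grad (\<lambda>x. f (a - x)) x = - grad f (a - x)"
    by (intro grad_eq D) (auto simp: Ck_Suc_grad)
qed

text \<open>This class of functions is closed under differentiation, whence smoothness by induction.\<close>

definition exp_bump :: "real poly \<Rightarrow> real \<Rightarrow> real" where
  "exp_bump P t = (if t > 0 then poly P (1 / t) * exp (- (1 / t)) else 0)"

lemma poly_times_exp_tendsto_0: "((\<lambda>s. poly P s * exp (- s)) \<longlongrightarrow> (0::real)) at_top"
proof -
  have "((\<lambda>s. \<Sum>i\<le>degree P. coeff P i * (s ^ i / exp s)) \<longlongrightarrow> (\<Sum>i\<le>degree P. coeff P i * (0::real))) at_top"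
    by (intro tendsto_intros tendsto_power_div_exp_0)
  then show ?thesis
    by (simp add: poly_altdef sum_distrib_right exp_minus divide_inverse mult.assoc)
qed

text \<open>With s = 1/t the derivative of P(s) exp(-s) in t is s^2 (P - P')(s) exp(-s), because
  ds/dt = - s^2; the polynomial \<open>[:0, 0, 1:]\<close> is the factor s^2.\<close>

lemma DERIV_exp_bump: "DERIV (exp_bump P) t :> exp_bump ([:0, 0, 1:] * (P - pderiv P)) t"
proof -
  let ?Q = "[:0, 0, 1:] * (P - pderiv P)"
  consider "t > 0" | "t < 0" | "t = 0" by linarith
  then show ?thesis
  proof cases
    case 1
    have "DERIV (\<lambda>t. poly P (1 / t) * exp (- (1 / t))) t :> exp_bump ?Q t"
      using 1 by (auto intro!: derivative_eq_intros DERIV_chain2[OF poly_DERIV]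
          simp: exp_bump_def field_simps power2_eq_square)
    moreover have "eventually (\<lambda>s. exp_bump P s = poly P (1 / s) * exp (- (1 / s))) (nhds t)"
      using eventually_nhds_in_open[of "{0<..}" t] 1 by (auto elim!: eventually_mono simp: exp_bump_def)
    ultimately show ?thesis by (subst DERIV_cong_ev[OF refl _ refl]) auto
  next
    case 2
    have "eventually (\<lambda>s. exp_bump P s = 0) (nhds t)"
      using eventually_nhds_in_open[of "{..<0}" t] 2 by (auto elim!: eventually_mono simp: exp_bump_def)
    then show ?thesis using 2 by (subst DERIV_cong_ev[OF refl _ refl]) (auto simp: exp_bump_def)
  next
    case 3
    \<comment> \<open>At 0 the right difference quotient is s P(s) exp(-s) with s = 1/t, whence the
      extra factor \<open>[:0,1:]\<close>; the left one is constantly 0.\<close>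
    have "((\<lambda>s. poly ([:0,1:] * P) s * exp (- s)) \<longlongrightarrow> 0) at_top"
      by (rule poly_times_exp_tendsto_0)
    then have "((\<lambda>y. poly ([:0,1:] * P) (inverse y) * exp (- inverse y)) \<longlongrightarrow> 0) (at_right (0::real))"
      by (rule filterlim_compose[OF _ filterlim_inverse_at_top_right])
    then have "((\<lambda>y. exp_bump P y / y) \<longlongrightarrow> 0) (at_right 0)"
      by (rule Lim_transform_eventually)
        (auto simp: exp_bump_def eventually_at_filter divide_inverse mult_ac)
    moreover have "((\<lambda>y. exp_bump P y / y) \<longlongrightarrow> 0) (at_left 0)"
      by (rule Lim_transform_eventually[OF tendsto_const])
        (auto simp: exp_bump_def eventually_at_filter)
    ultimately have "((\<lambda>y. exp_bump P y / y) \<longlongrightarrow> 0) (at 0)"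
      by (simp add: filterlim_at_split)
    then show ?thesis using 3 by (simp add: DERIV_def exp_bump_def)
  qed
qed

lemma Ck_exp_bump_affine: "Ck k (\<lambda>x. exp_bump P (x \<bullet> v + c))"
proof (induction k arbitrary: P)
  case 0
  have "continuous_on UNIV (exp_bump P)"
    by (intro continuous_at_imp_continuous_on ballI DERIV_isCont[OF DERIV_exp_bump])
  then have "continuous_on UNIV (\<lambda>x. exp_bump P (x \<bullet> v + c))"
    by (rule continuous_on_compose2) (auto intro!: continuous_intros)
  then show ?case by simp
next
  case (Suc k)
  let ?Q = "[:0, 0, 1:] * (P - pderiv P)"
  show ?case
  proof (rule Ck_SucI[where D="\<lambda>x. exp_bump ?Q (x \<bullet> v + c) *\<^sub>R v"])
    have "GDERIV (\<lambda>x. x \<bullet> v + c) x :> v" for x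
      unfolding gderiv_def by (auto intro!: derivative_eq_intros)
    then show "GDERIV (\<lambda>x. exp_bump P (x \<bullet> v + c)) x :> exp_bump ?Q (x \<bullet> v + c) *\<^sub>R v" for x
      by (rule GDERIV_DERIV_compose) (rule DERIV_exp_bump)
    show "Ck k (\<lambda>x. exp_bump ?Q (x \<bullet> v + c) *\<^sub>R v \<bullet> i)" for i
      using Ck_cmult[OF Suc[of ?Q], of "v \<bullet> i"] by (simp add: mult.commute)
  qed
qed

text \<open>One one-sided bump for each face of the box. The product is smooth and positive exactly
  inside the open box; normalised it is a mollifier, and exponentiated it approximates the indicator
  of the box.\<close>

definition box_bump :: "'a::euclidean_space \<Rightarrow> 'a \<Rightarrow> 'a \<Rightarrow> real" where
  "box_bump a b x = (\<Prod>i\<in>Basis. exp_bump 1 (x \<bullet> i + - (a \<bullet> i)) * exp_bump 1 (x \<bullet> (- i) + b \<bullet> i))"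

lemma Ck_box_bump: "Ck k (box_bump a b)"
  unfolding box_bump_def[abs_def] by (intro Ck_prod Ck_mult Ck_exp_bump_affine) auto

lemma box_bump_nonneg: "box_bump a b x \<ge> 0"
  unfolding box_bump_def by (intro prod_nonneg mult_nonneg_nonneg) (auto simp: exp_bump_def)

lemma box_bump_pos_iff: "box_bump a b x > 0 \<longleftrightarrow> x \<in> box a b"
proof -
  have "box_bump a b x \<noteq> 0 \<longleftrightarrow> x \<in> box a b"
    unfolding box_bump_def by (auto simp: exp_bump_def mem_box algebra_simps)
  then show ?thesis using box_bump_nonneg[of a b x] by linarith
qed

section \<open>Test functions\<close>

text \<open>Lets integrals move between \<Omega>, compact subsets and the whole space, so that
  translations and integrations by parts can be carried out without a boundary.\<close>

lemma
  fixes f :: "'a::euclidean_space \<Rightarrow> 'b::euclidean_space"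
  assumes "S \<in> sets lebesgue" "\<And>x. x \<notin> S \<Longrightarrow> f x = 0"
  shows integral_lebesgue_on_vanish: "integral\<^sup>L (lebesgue_on S) f = integral\<^sup>L lebesgue f"
    and integrable_lebesgue_on_vanish: "integrable (lebesgue_on S) f \<longleftrightarrow> integrable lebesgue f"
proof -
  have *: "(\<lambda>x. if x \<in> S then f x else 0) = f" using assms(2) by auto
  show "integral\<^sup>L (lebesgue_on S) f = integral\<^sup>L lebesgue f"
    using Lebesgue_Measure.integral_restrict_UNIV[OF assms(1), of f] by (simp add: *)
  show "integrable (lebesgue_on S) f \<longleftrightarrow> integrable lebesgue f"
    using Lebesgue_Measure.integrable_restrict_UNIV[OF assms(1), of f] by (simp add: *)
qed

lemma continuous_borel_measurable:
  fixes f :: "'a::euclidean_space \<Rightarrow> 'b::euclidean_space"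
  shows "continuous_on UNIV f \<Longrightarrow> f \<in> borel_measurable borel"
  by (rule borel_measurable_continuous_onI)

lemma integrable_continuous_vanish:
  fixes f :: "'a::euclidean_space \<Rightarrow> 'b::euclidean_space"
  assumes "continuous_on UNIV f" "bounded K" "\<And>x. x \<notin> K \<Longrightarrow> f x = 0"
  shows "integrable lebesgue f"
proof -
  have "integrable lborel (\<lambda>x. indicator (closure K) x *\<^sub>R f x)"
    using assms by (intro borel_integrable_compact) (auto intro: continuous_on_subset)
  moreover have "(\<lambda>x. indicator (closure K) x *\<^sub>R f x) = f"
    using assms(3) closure_subset by (fastforce simp: indicator_def)
  ultimately show ?thesis
    by (subst integrable_completion) (auto intro: continuous_borel_measurable assms)
qed

text \<open>The affine invariance is that of \<open>lborel\<close>; Borel measurability of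
  \<open>f\<close> carries the integrals over to the completion \<open>lebesgue\<close>.\<close>

lemma
  fixes f :: "'a::euclidean_space \<Rightarrow> 'b::euclidean_space"
  assumes [measurable]: "f \<in> borel_measurable borel"
  shows integral_lebesgue_reflect: "(\<integral>y. f (a - y) \<partial>lebesgue) = integral\<^sup>L lebesgue f"
    and integral_lebesgue_translate: "(\<integral>y. f (y + a) \<partial>lebesgue) = integral\<^sup>L lebesgue f"
    and integrable_lebesgue_reflect: "integrable lebesgue (\<lambda>y. f (a - y)) \<longleftrightarrow> integrable lebesgue f"
proof -
  have 1: "lborel = distr lborel borel (\<lambda>x. a - x)" and 2: "lborel = distr lborel borel (\<lambda>x. x + a)"
    using lborel_affine[of "-1" a] lborel_affine[of "1" a] by (simp_all add: density_1 add.commute)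
  have "integral\<^sup>L lborel f = (\<integral>y. f (a - y) \<partial>lborel)"
    by (subst 1, subst integral_distr) auto
  then show "(\<integral>y. f (a - y) \<partial>lebesgue) = integral\<^sup>L lebesgue f"
    by (simp add: integral_completion)
  have "integral\<^sup>L lborel f = (\<integral>y. f (y + a) \<partial>lborel)"
    by (subst 2, subst integral_distr) auto
  then show "(\<integral>y. f (y + a) \<partial>lebesgue) = integral\<^sup>L lebesgue f"
    by (simp add: integral_completion)
  have "integrable lborel f \<longleftrightarrow> integrable lborel (\<lambda>y. f (a - y))"
    by (subst 1, subst integrable_distr_eq) auto
  then show "integrable lebesgue (\<lambda>y. f (a - y)) \<longleftrightarrow> integrable lebesgue f"
    by (simp add: integrable_completion)
qed

section \<open>Calculus of \<open>grad\<close> for smooth functions\<close>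

lemma Ck_GDERIV: "Ck (Suc k) f \<Longrightarrow> GDERIV f x :> grad f x"
  by (simp add: Ck_Suc_grad)

lemma Ck_grad_continuous:
  assumes "Ck (Suc k) f" shows "continuous_on UNIV (grad f)"
proof -
  have "continuous_on UNIV (\<lambda>x. grad f x \<bullet> i)" if "i \<in> Basis" for i
    using assms that by (auto simp: Ck_Suc_grad intro: Ck_continuous)
  then show ?thesis by (subst continuous_on_componentwise) auto
qed

lemma grad_const: "grad (\<lambda>x. c) = (\<lambda>x. 0)"
  by (auto intro: grad_eq GDERIV_const)

lemma grad_add: "Ck (Suc k) f \<Longrightarrow> Ck (Suc k) g \<Longrightarrow> grad (\<lambda>x. f x + g x) x = grad f x + grad g x"
  by (intro grad_eq GDERIV_add Ck_GDERIV)

lemma grad_mult: "Ck (Suc k) f \<Longrightarrow> Ck (Suc k) g \<Longrightarrow>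
    grad (\<lambda>x. f x * g x) x = f x *\<^sub>R grad g x + g x *\<^sub>R grad f x"
  by (intro grad_eq GDERIV_mult Ck_GDERIV)

lemma grad_cmult: "Ck (Suc k) f \<Longrightarrow> grad (\<lambda>x. c * f x) x = c *\<^sub>R grad f x"
  using grad_mult[OF Ck_const[of "Suc k" c], of f x] by (simp add: grad_const)

lemma grad_vanish:
  assumes "closed K" "\<And>x. x \<notin> K \<Longrightarrow> f x = 0" "x \<notin> K"
  shows "grad f x = 0"
proof (rule grad_eq)
  have "eventually (\<lambda>y. y \<in> - K) (nhds x)"
    using assms by (intro eventually_nhds_in_open) auto
  then obtain S where S: "open S" "x \<in> S" "\<forall>y\<in>S. y \<in> - K" by (auto simp: eventually_nhds)
  have "GDERIV (\<lambda>_. 0) x :> 0" by (rule GDERIV_const)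
  then show "GDERIV f x :> 0" unfolding gderiv_def
    by (rule has_derivative_transform_within_open[OF _ S(1,2)]) (use assms S in auto)
qed

section \<open>Test functions: construction, supports and closure properties\<close>

lemma test_functionsI:
  assumes "\<And>k. Ck k \<phi>" "compact K" "K \<subseteq> \<Omega>" "\<And>x. x \<notin> K \<Longrightarrow> \<phi> x = 0"
  shows "\<phi> \<in> test_functions \<Omega>"
proof -
  have "closure {x. \<phi> x \<noteq> 0} \<subseteq> K"
    using assms by (intro closure_minimal) (auto intro: compact_imp_closed)
  moreover have "compact (closure {x. \<phi> x \<noteq> 0})"
    using bounded_subset[OF compact_imp_bounded[OF assms(2)] calculation] by (simp add: compact_eq_bounded_closed)
  ultimately show ?thesis using assms(1,3) unfolding test_functions_def by auto
qed

lemma test_support: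
  assumes "\<phi> \<in> test_functions \<Omega>"
  shows "\<exists>K. compact K \<and> K \<subseteq> \<Omega> \<and> (\<forall>x. x \<notin> K \<longrightarrow> \<phi> x = 0) \<and> (\<forall>x. x \<notin> K \<longrightarrow> grad \<phi> x = 0)"
proof -
  let ?K = "closure {x. \<phi> x \<noteq> 0}"
  have *: "\<phi> x = 0" if "x \<notin> ?K" for x using that closure_subset[of "{x. \<phi> x \<noteq> 0}"] by auto
  have "grad \<phi> x = 0" if "x \<notin> ?K" for x by (rule grad_vanish[OF closed_closure * that])
  moreover have "compact ?K" "?K \<subseteq> \<Omega>" using assms by (auto simp: test_functions_def)
  ultimately show ?thesis using * by blast
qed

lemma test_Ck: "\<phi> \<in> test_functions \<Omega> \<Longrightarrow> Ck k \<phi>"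
  by (simp add: test_functions_def)

lemma test_outside:
  assumes "\<phi> \<in> test_functions \<Omega>" "x \<notin> \<Omega>"
  shows "\<phi> x = 0" "grad \<phi> x = 0"
proof -
  obtain K where "K \<subseteq> \<Omega>" "\<forall>x. x \<notin> K \<longrightarrow> \<phi> x = 0" "\<forall>x. x \<notin> K \<longrightarrow> grad \<phi> x = 0"
    using test_support[OF assms(1)] by blast
  then show "\<phi> x = 0" "grad \<phi> x = 0" using assms(2) by auto
qed

lemma test_continuous:
  assumes "\<phi> \<in> test_functions \<Omega>"
  shows "continuous_on S \<phi>" "continuous_on S (grad \<phi>)"
  by (rule continuous_on_subset[OF Ck_continuous[OF test_Ck[OF assms, of 0]] subset_UNIV],
      rule continuous_on_subset[OF Ck_grad_continuous[OF test_Ck[OF assms, of "Suc 0"]] subset_UNIV])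

lemma test_add:
  assumes "\<phi> \<in> test_functions \<Omega>" "\<psi> \<in> test_functions \<Omega>"
  shows "(\<lambda>x. \<phi> x + \<psi> x) \<in> test_functions \<Omega>"
proof -
  obtain K where K: "compact K" "K \<subseteq> \<Omega>" "\<forall>x. x \<notin> K \<longrightarrow> \<phi> x = 0" "\<forall>x. x \<notin> K \<longrightarrow> grad \<phi> x = 0" using test_support[OF assms(1)] by blast
  obtain L where L: "compact L" "L \<subseteq> \<Omega>" "\<forall>x. x \<notin> L \<longrightarrow> \<psi> x = 0" "\<forall>x. x \<notin> L \<longrightarrow> grad \<psi> x = 0" using test_support[OF assms(2)] by blast
  show ?thesis
    by (rule test_functionsI[OF Ck_add[OF test_Ck[OF assms(1)] test_Ck[OF assms(2)]], of "K \<union> L"])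
      (use K L in auto)
qed

lemma test_cmult:
  assumes "\<phi> \<in> test_functions \<Omega>" shows "(\<lambda>x. c * \<phi> x) \<in> test_functions \<Omega>"
proof -
  obtain K where K: "compact K" "K \<subseteq> \<Omega>" "\<forall>x. x \<notin> K \<longrightarrow> \<phi> x = 0" "\<forall>x. x \<notin> K \<longrightarrow> grad \<phi> x = 0" using test_support[OF assms(1)] by blast
  show ?thesis
    by (rule test_functionsI[OF Ck_cmult[OF test_Ck[OF assms]] K(1,2)]) (simp add: K(3))
qed

lemma test_zero: "(\<lambda>x. 0) \<in> test_functions \<Omega>"
  by (rule test_functionsI[of _ "{}"]) (auto intro: Ck_const)

lemma test_grad_add:
  "\<phi> \<in> test_functions \<Omega> \<Longrightarrow> \<psi> \<in> test_functions \<Omega> \<Longrightarrow> grad (\<lambda>x. \<phi> x + \<psi> x) x = grad \<phi> x + grad \<psi> x"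
  by (rule grad_add[of 0]) (auto simp: test_Ck)

lemma test_grad_cmult: "\<phi> \<in> test_functions \<Omega> \<Longrightarrow> grad (\<lambda>x. c * \<phi> x) x = c *\<^sub>R grad \<phi> x"
  by (rule grad_cmult[of 0]) (auto simp: test_Ck)

lemma bounded_range_vanish:
  fixes f :: "'a::euclidean_space \<Rightarrow> 'b::euclidean_space"
  assumes "continuous_on UNIV f" "bounded K" "\<And>x. x \<notin> K \<Longrightarrow> f x = 0"
  obtains M where "M \<ge> 0" "\<And>x. norm (f x) \<le> M"
proof -
  have "compact (f ` closure K)"
    using assms by (intro compact_continuous_image) (auto intro: continuous_on_subset)
  then obtain M where M: "\<And>x. x \<in> closure K \<Longrightarrow> norm (f x) \<le> M"
    using compact_imp_bounded bounded_iff by (metis imageI)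
  have "norm (f x) \<le> max M 0" for x
  proof (cases "x \<in> closure K")
    case False
    then have "x \<notin> K" using closure_subset by blast
    then show ?thesis using assms(3) by simp
  qed (use M[of x] in auto)
  then show ?thesis using that by (metis max.cobounded2)
qed

lemma test_bounded:
  assumes "\<phi> \<in> test_functions \<Omega>"
  obtains M where "M \<ge> 0" "\<And>x. \<bar>\<phi> x\<bar> \<le> M" "\<And>x. norm (grad \<phi> x) \<le> M"
proof -
  obtain K where K: "compact K" "K \<subseteq> \<Omega>" "\<forall>x. x \<notin> K \<longrightarrow> \<phi> x = 0" "\<forall>x. x \<notin> K \<longrightarrow> grad \<phi> x = 0"
    using test_support[OF assms] by blast
  obtain M where M: "M \<ge> 0" "\<And>x. norm (\<phi> x) \<le> M"
    by (rule bounded_range_vanish[OF test_continuous(1)[OF assms] compact_imp_bounded[OF K(1)] K(3)[rule_format]]) auto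
  obtain N where N: "N \<ge> 0" "\<And>x. norm (grad \<phi> x) \<le> N"
    by (rule bounded_range_vanish[OF test_continuous(2)[OF assms] compact_imp_bounded[OF K(1)] K(4)[rule_format]]) auto
  show ?thesis
  proof (rule that)
    show "max M N \<ge> 0" using M(1) by simp
    show "\<bar>\<phi> x\<bar> \<le> max M N" for x using M(2)[of x] by (simp add: le_max_iff_disj)
    show "norm (grad \<phi> x) \<le> max M N" for x using N(2)[of x] by (simp add: le_max_iff_disj)
  qed
qed

text \<open>The mean value inequality with hypotheses on the segment only, because later the
  gradient bound is available only near points of \<Omega>, which need not be convex.\<close>

lemma norm_diff_le_grad_bound:
  assumes "\<And>x. x \<in> closed_segment a b \<Longrightarrow> GDERIV f x :> D x" "\<And>x. x \<in> closed_segment a b \<Longrightarrow> norm (D x) \<le> M"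
  shows "\<bar>f a - f b\<bar> \<le> M * norm (a - b)"
proof -
  have "norm (f a - f b) \<le> M * norm (a - b)"
  proof (rule differentiable_bound[of "closed_segment a b" f "\<lambda>x h. h \<bullet> D x"])
    fix x assume x: "x \<in> closed_segment a b"
    show "(f has_derivative (\<lambda>h. h \<bullet> D x)) (at x within closed_segment a b)"
      using assms(1)[OF x] unfolding gderiv_def by (rule has_derivative_at_withinI)
    show "onorm (\<lambda>h. h \<bullet> D x) \<le> M"
    proof (rule onorm_bound)
      show "0 \<le> M" using assms(2)[OF x] norm_ge_zero[of "D x"] by linarith
      fix h
      have "norm (h \<bullet> D x) \<le> norm h * norm (D x)" by (simp add: Cauchy_Schwarz_ineq2)
      also have "\<dots> \<le> norm h * M" by (intro mult_left_mono assms(2)[OF x]) auto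
      finally show "norm (h \<bullet> D x) \<le> M * norm h" by (simp add: mult.commute)
    qed
  qed auto
  then show ?thesis by simp
qed

text \<open>The difference quotients have integral zero because Lebesgue measure is translation invariant.\<close>

lemma integral_grad_component_0:
  assumes f: "Ck (Suc k) f" and K: "bounded K" "\<And>x. x \<notin> K \<Longrightarrow> f x = 0" and i: "i \<in> Basis"
  shows "(\<integral>x. grad f x \<bullet> i \<partial>lebesgue) = 0"
proof -
  let ?K = "closure K"
  have K': "bounded ?K" "\<And>x. x \<notin> ?K \<Longrightarrow> f x = 0" "\<And>x. x \<notin> ?K \<Longrightarrow> grad f x = 0"
    using K closure_subset[of K] by (auto intro!: grad_vanish[of ?K])
  have cf: "continuous_on UNIV f" and cg: "continuous_on UNIV (grad f)"
    using Ck_continuous[OF f] Ck_grad_continuous[OF f] .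
  obtain M where M: "M \<ge> 0" "\<And>x. norm (grad f x) \<le> M"
    using bounded_range_vanish[OF cg K'(1,3)] by blast
  obtain R where R: "\<And>x. x \<in> ?K \<Longrightarrow> norm x \<le> R"
    using K'(1) bounded_iff by blast
  define s where "s n x = (f (x + (1 / real (Suc n)) *\<^sub>R i) - f x) / (1 / real (Suc n))" for n x
  have cs: "continuous_on UNIV (s n)" for n
    unfolding s_def using cf by (auto intro!: continuous_intros continuous_on_compose2[OF cf])
  have int_f: "integrable lebesgue f"
    using integrable_continuous_vanish[OF cf K'(1,2)] by blast
  have "f \<in> borel_measurable borel" by (rule continuous_borel_measurable[OF cf])
  have trans: "integrable lebesgue (\<lambda>x. f (x + c))" for c
  proof (rule integrable_continuous_vanish)
    show "continuous_on UNIV (\<lambda>x. f (x + c))" by (auto intro!: continuous_intros continuous_on_compose2[OF cf])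
    show "bounded ((\<lambda>x. x + (- c)) ` ?K)" by (rule bounded_translation_minus[of ?K c, simplified diff_conv_add_uminus]) (rule K')
    fix x assume "x \<notin> (\<lambda>x. x + (- c)) ` ?K"
    then have "x + c \<notin> ?K" by (auto simp: image_iff algebra_simps)
    then show "f (x + c) = 0" by (rule K')
  qed
  have s0: "integral\<^sup>L lebesgue (s n) = 0" for n
    unfolding s_def using trans int_f integral_lebesgue_translate[OF \<open>f \<in> borel_measurable borel\<close>]
    by (simp add: Bochner_Integration.integral_diff)
  have lim: "(\<lambda>n. s n x) \<longlonglongrightarrow> grad f x \<bullet> i" for x
  proof -
    have "GDERIV f x :> grad f x" by (rule Ck_GDERIV[OF f])
    then have "(f has_derivative (\<lambda>h. h \<bullet> grad f x)) (at x)" by (simp add: gderiv_def)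
    then have "((\<lambda>t. f (x + t *\<^sub>R i)) has_derivative (\<lambda>t. (t *\<^sub>R i) \<bullet> grad f x)) (at 0)"
      by (intro has_derivative_compose[of "\<lambda>t. x + t *\<^sub>R i" "\<lambda>t. t *\<^sub>R i" 0 UNIV f, simplified])
        (auto intro!: derivative_eq_intros)
    then have "((\<lambda>t. f (x + t *\<^sub>R i)) has_real_derivative (grad f x \<bullet> i)) (at 0)"
      by (simp add: has_field_derivative_def inner_commute mult.commute[of "i \<bullet> grad f x"] mult_commute_abs)
    then have "((\<lambda>t. (f (x + t *\<^sub>R i) - f x) / t) \<longlongrightarrow> grad f x \<bullet> i) (at 0)"
      by (simp add: DERIV_def)
    moreover have "filterlim (\<lambda>n. 1 / real (Suc n)) (at 0) sequentially"
      using LIMSEQ_Suc[OF lim_1_over_n[where 'a=real]] by (auto simp: filterlim_at)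
    ultimately show ?thesis unfolding s_def by (rule filterlim_compose)
  qed
  \<comment> \<open>The increment 1/(n+1) is at most 1, so all quotients vanish outside the ball of
    radius R + 1, and inside it the gradient bound M dominates them.\<close>
  have bound: "norm (s n x) \<le> indicator (cball 0 (R + 1)) x * M" for n x
  proof (cases "norm x \<le> R + 1")
    case True
    have "\<bar>f (x + (1 / real (Suc n)) *\<^sub>R i) - f x\<bar> \<le> M * norm ((x + (1 / real (Suc n)) *\<^sub>R i) - x)"
      by (rule norm_diff_le_grad_bound[of _ _ f "grad f"]) (auto intro: Ck_GDERIV[OF f] M)
    also have "\<dots> = M * (1 / real (Suc n))" using i by simp
    finally show ?thesis using True unfolding s_def by (simp add: abs_mult divide_simps mult.commute)
  next
    case False
    have "norm x \<le> norm (x + (1 / real (Suc n)) *\<^sub>R i) + norm ((1 / real (Suc n)) *\<^sub>R i)"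
      by (metis add_diff_cancel_right' norm_triangle_ineq4)
    also have "norm ((1 / real (Suc n)) *\<^sub>R i) \<le> 1" using i by simp
    finally have "norm (x + (1 / real (Suc n)) *\<^sub>R i) > R" using False by linarith
    then have "x + (1 / real (Suc n)) *\<^sub>R i \<notin> ?K" "x \<notin> ?K" using R False by force+
    then show ?thesis using False K'(2) unfolding s_def by simp
  qed
  have "(\<lambda>n. integral\<^sup>L lebesgue (s n)) \<longlonglongrightarrow> (\<integral>x. grad f x \<bullet> i \<partial>lebesgue)"
  proof (rule integral_dominated_convergence[where w="\<lambda>x. indicator (cball 0 (R + 1)) x * M"])
    show "integrable lebesgue (\<lambda>x. indicator (cball 0 (R + 1)) x * M)"
      using fmeasurableD2[OF lmeasurable_cball[of 0 "R + 1"]]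
      by (intro integrable_mult_left impI integrable_real_indicator) (auto simp: less_top)
    have "(\<lambda>x. grad f x \<bullet> i) \<in> borel_measurable borel" "s n \<in> borel_measurable borel" for n
      by (rule continuous_borel_measurable[OF continuous_on_inner[OF cg continuous_on_const]],
          rule continuous_borel_measurable[OF cs])
    then show "(\<lambda>x. grad f x \<bullet> i) \<in> borel_measurable lebesgue" "s n \<in> borel_measurable lebesgue" for n
      by (simp_all add: measurable_completion)
  qed (use lim bound in auto)
  then have "(\<lambda>n. 0::real) \<longlonglongrightarrow> (\<integral>x. grad f x \<bullet> i \<partial>lebesgue)" by (simp add: s0)
  then show ?thesis using LIMSEQ_unique tendsto_const by metis
qed

text \<open>The product of \<open>f\<close> and \<open>g\<close> inherits the bounded support of
  \<open>g\<close>, so the integral of its partial derivative is 0. Leaving \<open>f\<close> without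
  a support condition admits a coordinate function in the Poincare inequality.\<close>

lemma integration_by_parts_component:
  assumes f: "Ck (Suc k) f" and g: "Ck (Suc k) g" and K: "bounded K" "\<And>x. x \<notin> K \<Longrightarrow> g x = 0" and i: "i \<in> Basis"
  shows "(\<integral>x. f x * (grad g x \<bullet> i) \<partial>lebesgue) = - (\<integral>x. (grad f x \<bullet> i) * g x \<partial>lebesgue)"
proof -
  let ?K = "closure K"
  have K': "bounded ?K" "\<And>x. x \<notin> ?K \<Longrightarrow> g x = 0" "\<And>x. x \<notin> ?K \<Longrightarrow> grad g x = 0"
    using K closure_subset[of K] by (auto intro!: grad_vanish[of ?K])
  have "integrable lebesgue (\<lambda>x. f x * (grad g x \<bullet> i))" "integrable lebesgue (\<lambda>x. (grad f x \<bullet> i) * g x)"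
    using Ck_continuous[OF f] Ck_grad_continuous[OF f] Ck_continuous[OF g] Ck_grad_continuous[OF g] K'
    by (auto intro!: integrable_continuous_vanish[of _ ?K] continuous_intros)
  then have "(\<integral>x. f x * (grad g x \<bullet> i) \<partial>lebesgue) + (\<integral>x. (grad f x \<bullet> i) * g x \<partial>lebesgue)
    = (\<integral>x. f x * (grad g x \<bullet> i) + (grad f x \<bullet> i) * g x \<partial>lebesgue)" by simp
  also have "\<dots> = (\<integral>x. grad (\<lambda>x. f x * g x) x \<bullet> i \<partial>lebesgue)"
    by (simp add: grad_mult[OF f g] inner_add_left mult.commute)
  also have "\<dots> = 0"
    using K by (intro integral_grad_component_0[OF Ck_mult[OF f g] K(1) _ i]) auto
  finally show ?thesis by linarith
qed

section \<open>The Poincare inequality on bounded sets\<close>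

lemma GDERIV_inner: "GDERIV (\<lambda>x. x \<bullet> v) x :> v"
  unfolding gderiv_def by (rule bounded_linear_imp_has_derivative[OF bounded_linear_inner_left])

lemma Ck_inner: "Ck k (\<lambda>x. x \<bullet> v)"
proof (cases k)
  case (Suc n)
  then show ?thesis using Ck_SucI[OF GDERIV_inner, of n v] by (simp add: Ck_const)
qed (simp add: continuous_on_inner)

lemma test_square_integrable:
  assumes "\<phi> \<in> test_functions \<Omega>"
  shows "integrable lebesgue (\<lambda>x. (\<phi> x)\<^sup>2)" "integrable lebesgue (\<lambda>x. (norm (grad \<phi> x))\<^sup>2)"
proof -
  obtain K where "compact K" "K \<subseteq> \<Omega>" "\<forall>x. x \<notin> K \<longrightarrow> \<phi> x = 0" "\<forall>x. x \<notin> K \<longrightarrow> grad \<phi> x = 0"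
    using test_support[OF assms] by blast
  then show "integrable lebesgue (\<lambda>x. (\<phi> x)\<^sup>2)" "integrable lebesgue (\<lambda>x. (norm (grad \<phi> x))\<^sup>2)"
    using test_continuous[OF assms] compact_imp_bounded
    by (auto intro!: integrable_continuous_vanish[where K=K] continuous_on_power continuous_on_norm)
qed

text \<open>The constant 1 is the i-th partial derivative of the i-th coordinate. Integrating by
  parts against \<phi>^2 leaves -2 times the integral of the product of this coordinate, \<phi> and
  the i-th derivative of \<phi>. The coordinate is at most R on \<Omega>, and Young's inequality
  splits the product so that half of the integral of \<phi>^2 is absorbed; this gives the constant 4
  R^2.\<close>

lemma poincare_inequality:
  fixes \<Omega> :: "'a::euclidean_space set"
  assumes "bounded \<Omega>"
  obtains C where "C > 0" "\<And>\<phi>. \<phi> \<in> test_functions \<Omega> \<Longrightarrow>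
    (\<integral>x. (\<phi> x)\<^sup>2 \<partial>lebesgue) \<le> C * (\<integral>x. (norm (grad \<phi> x))\<^sup>2 \<partial>lebesgue)"
proof -
  obtain R where R: "R > 0" "\<And>x. x \<in> \<Omega> \<Longrightarrow> norm x \<le> R" using assms bounded_pos by blast
  obtain i :: 'a where i: "i \<in> Basis" using nonempty_Basis by blast
  have "(\<integral>x. (\<phi> x)\<^sup>2 \<partial>lebesgue) \<le> (4 * R\<^sup>2) * (\<integral>x. (norm (grad \<phi> x))\<^sup>2 \<partial>lebesgue)"
    if \<phi>: "\<phi> \<in> test_functions \<Omega>" for \<phi>
  proof -
    have C: "Ck (Suc 0) (\<lambda>x. x \<bullet> i)" "Ck (Suc 0) (\<lambda>x. \<phi> x * \<phi> x)"
      using \<phi> by (auto intro: Ck_inner Ck_mult test_Ck)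
    have gi: "grad (\<lambda>x. x \<bullet> i) x = i" for x
      by (rule grad_eq[OF GDERIV_inner])
    have "(\<integral>x. (\<phi> x)\<^sup>2 \<partial>lebesgue) = (\<integral>x. (grad (\<lambda>x. x \<bullet> i) x \<bullet> i) * (\<phi> x * \<phi> x) \<partial>lebesgue)"
      using i by (simp add: gi power2_eq_square)
    also have "\<dots> = - (\<integral>x. (x \<bullet> i) * (grad (\<lambda>x. \<phi> x * \<phi> x) x \<bullet> i) \<partial>lebesgue)"
      using integration_by_parts_component[OF C assms _ i] test_outside[OF \<phi>] by simp
    also have "\<dots> = (\<integral>x. - ((x \<bullet> i) * (2 * \<phi> x * (grad \<phi> x \<bullet> i))) \<partial>lebesgue)"
      by (simp add: grad_mult[OF test_Ck[OF \<phi>] test_Ck[OF \<phi>]] inner_add_left algebra_simps)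
    also have "\<dots> \<le> (\<integral>x. 1 / 2 * (\<phi> x)\<^sup>2 + 2 * R\<^sup>2 * (norm (grad \<phi> x))\<^sup>2 \<partial>lebesgue)"
    proof (rule integral_mono)
      show "integrable lebesgue (\<lambda>x. - ((x \<bullet> i) * (2 * \<phi> x * (grad \<phi> x \<bullet> i))))"
        using test_continuous[OF \<phi>] test_outside[OF \<phi>]
        by (auto intro!: integrable_continuous_vanish[OF _ assms] continuous_intros)
      show "integrable lebesgue (\<lambda>x. 1 / 2 * (\<phi> x)\<^sup>2 + 2 * R\<^sup>2 * (norm (grad \<phi> x))\<^sup>2)"
        using test_square_integrable[OF \<phi>] by simp
      fix x
      show "- ((x \<bullet> i) * (2 * \<phi> x * (grad \<phi> x \<bullet> i))) \<le> 1 / 2 * (\<phi> x)\<^sup>2 + 2 * R\<^sup>2 * (norm (grad \<phi> x))\<^sup>2"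
      proof (cases "x \<in> \<Omega>")
        case True
        have "\<bar>x \<bullet> i\<bar> \<le> R" using R(2)[OF True] Basis_le_norm[OF i, of x] by simp
        moreover have "\<bar>grad \<phi> x \<bullet> i\<bar> \<le> norm (grad \<phi> x)" by (rule Basis_le_norm[OF i])
        ultimately have "\<bar>(x \<bullet> i) * (grad \<phi> x \<bullet> i)\<bar> \<le> R * norm (grad \<phi> x)"
          unfolding abs_mult using R by (intro mult_mono) auto
        then have "((x \<bullet> i) * (grad \<phi> x \<bullet> i))\<^sup>2 \<le> (R * norm (grad \<phi> x))\<^sup>2" by (rule power2_le_iff_abs_le[THEN iffD2, rotated]) (use R in auto)
        moreover have "0 \<le> (\<phi> x + 2 * ((x \<bullet> i) * (grad \<phi> x \<bullet> i)))\<^sup>2" by simp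
        ultimately show ?thesis by (simp add: power2_sum power_mult_distrib algebra_simps)
      qed (use test_outside[OF \<phi>] in auto)
    qed
    also have "\<dots> = 1 / 2 * (\<integral>x. (\<phi> x)\<^sup>2 \<partial>lebesgue) + 2 * R\<^sup>2 * (\<integral>x. (norm (grad \<phi> x))\<^sup>2 \<partial>lebesgue)"
      using test_square_integrable[OF \<phi>] by simp
    finally show ?thesis by simp
  qed
  then show ?thesis using that[of "4 * R\<^sup>2"] R by auto
qed

section \<open>Mollification\<close>

lemma integrable_bounded_times:
  fixes g :: "'a::euclidean_space \<Rightarrow> 'b::euclidean_space" and w :: "'a \<Rightarrow> real"
  assumes "integrable lebesgue w" "continuous_on UNIV g" "\<And>x. norm (g x) \<le> M"
  shows "integrable lebesgue (\<lambda>y. w y *\<^sub>R g y)"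
proof (rule Bochner_Integration.integrable_bound)
  show "integrable lebesgue (\<lambda>y. M * w y)" using assms by simp
  have "g \<in> borel_measurable lebesgue"
    using continuous_borel_measurable[OF assms(2)] by (simp add: measurable_completion)
  then show "(\<lambda>y. w y *\<^sub>R g y) \<in> borel_measurable lebesgue"
    using assms(1) by (intro borel_measurable_scaleR) auto
  have "\<bar>w y\<bar> * norm (g y) \<le> norm (M * w y)" for y
    using mult_left_mono[OF assms(3)[of y] abs_ge_zero[of "w y"]] abs_ge_self[of M]
    by (simp add: abs_mult mult.commute) (meson abs_ge_zero mult_right_mono order_trans)
  then show "AE y in lebesgue. norm (w y *\<^sub>R g y) \<le> norm (M * w y)" by simp
qed

text \<open>Two points at distance below 1 either both lie in the compact ball of radius R + 2,
  where uniform continuity is automatic, or both lie outside \<open>K\<close>, where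
  \<open>f\<close> vanishes.\<close>

lemma uniformly_continuous_vanish:
  fixes f :: "'a::euclidean_space \<Rightarrow> 'b::euclidean_space"
  assumes "continuous_on UNIV f" "bounded K" "\<And>x. x \<notin> K \<Longrightarrow> f x = 0"
  shows "uniformly_continuous_on UNIV f"
proof -
  obtain R where R: "\<And>x. x \<in> K \<Longrightarrow> norm x \<le> R" using assms(2) bounded_iff by blast
  have u: "uniformly_continuous_on (cball 0 (R + 2)) f"
    using assms(1) by (intro compact_uniformly_continuous) (auto intro: continuous_on_subset)
  show ?thesis unfolding uniformly_continuous_on_def
  proof (intro allI impI)
    fix e :: real assume "e > 0"
    with u obtain d where d: "d > 0" "\<And>x y. norm x \<le> R + 2 \<Longrightarrow> norm y \<le> R + 2 \<Longrightarrow> dist y x < d \<Longrightarrow> dist (f y) (f x) < e"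
      unfolding uniformly_continuous_on_def by (metis mem_cball_0)
    have "dist (f y) (f x) < e" if "dist y x < min d 1" for x y
    proof (cases "norm x \<le> R + 2 \<and> norm y \<le> R + 2")
      case True then show ?thesis using d(2) that by simp
    next
      case False
      have "\<bar>norm y - norm x\<bar> < 1" using that norm_triangle_ineq3[of y x] by (simp add: dist_norm)
      then have "norm x > R" "norm y > R" using False by auto
      then have "f x = 0" "f y = 0" using R assms(3) by (meson not_le)+
      then show ?thesis using \<open>e > 0\<close> by simp
    qed
    then show "\<exists>d>0. \<forall>x\<in>UNIV. \<forall>x'\<in>UNIV. dist x' x < d \<longrightarrow> dist (f x') (f x) < e"
      using d(1) by (intro exI[of _ "min d 1"]) auto
  qed
qed

text \<open>The convolution of \<open>w\<close> and \<open>\<rho>\<close>, written so that x occurs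
  in the smooth kernel only; derivatives then fall on \<open>\<rho>\<close>.\<close>

definition mollify :: "('a::euclidean_space \<Rightarrow> real) \<Rightarrow> ('a \<Rightarrow> real) \<Rightarrow> 'a \<Rightarrow> real" where
  "mollify \<rho> w x = (\<integral>y. w y * \<rho> (x - y) \<partial>lebesgue)"

lemma continuous_reflect:
  fixes f :: "'a::euclidean_space \<Rightarrow> 'b::euclidean_space"
  shows "continuous_on UNIV f \<Longrightarrow> continuous_on UNIV (\<lambda>y. f (x - y))"
  by (rule continuous_on_compose2[of UNIV f]) (auto intro: continuous_on_diff)

lemma integrable_mollify:
  fixes g :: "'a::euclidean_space \<Rightarrow> 'b::euclidean_space" and w :: "'a \<Rightarrow> real"
  assumes "integrable lebesgue w" "continuous_on UNIV g" "bounded K" "\<And>x. x \<notin> K \<Longrightarrow> g x = 0"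
  shows "integrable lebesgue (\<lambda>y. w y *\<^sub>R g (x - y))"
proof -
  obtain M where "\<And>x. norm (g x) \<le> M" using bounded_range_vanish[OF assms(2-4)] by blast
  then show ?thesis by (intro integrable_bounded_times[where M=M] assms continuous_reflect)
qed

text \<open>Differentiation under the integral: uniform continuity of \<open>grad \<rho>\<close>
  makes the first-order remainder of the kernel small uniformly in the integration variable, and
  integrability of \<open>w\<close> does the rest.\<close>

lemma GDERIV_mollify:
  fixes w :: "'a::euclidean_space \<Rightarrow> real"
  assumes w: "integrable lebesgue w" and \<rho>: "Ck (Suc k) \<rho>" and K: "bounded K" "\<And>x. x \<notin> K \<Longrightarrow> \<rho> x = 0"
  shows "GDERIV (mollify \<rho> w) x :> (\<integral>y. w y *\<^sub>R grad \<rho> (x - y) \<partial>lebesgue)"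
proof -
  let ?K = "closure K"
  have K': "bounded ?K" "\<And>x. x \<notin> ?K \<Longrightarrow> \<rho> x = 0" "\<And>x. x \<notin> ?K \<Longrightarrow> grad \<rho> x = 0"
    using K closure_subset[of K] by (auto intro!: grad_vanish[of ?K])
  note c\<rho> = Ck_continuous[OF \<rho>] and cg = Ck_grad_continuous[OF \<rho>]
  note int1 = integrable_mollify[OF w c\<rho> K'(1,2), simplified]
    and int2 = integrable_mollify[OF w cg K'(1,3)]
  define D where "D = (\<integral>y. w y *\<^sub>R grad \<rho> (x - y) \<partial>lebesgue)"
  have uc: "uniformly_continuous_on UNIV (grad \<rho>)" by (rule uniformly_continuous_vanish[OF cg K'(1,3)])
  define N where "N = (\<integral>y. \<bar>w y\<bar> \<partial>lebesgue)"
  have N: "N \<ge> 0" unfolding N_def by simp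
  have "(mollify \<rho> w has_derivative (\<lambda>h. h \<bullet> D)) (at x)"
    unfolding has_derivative_at_alt
  proof (intro conjI allI impI)
    show "bounded_linear (\<lambda>h. h \<bullet> D)" by (rule bounded_linear_inner_left)
    fix e :: real assume e: "e > 0"
    \<comment> \<open>\<open>N\<close> is the L^1 norm of \<open>w\<close>; the summand 1 keeps the
      quotient defined when \<open>w\<close> vanishes almost everywhere.\<close>
    define e' where "e' = e / (N + 1)"
    have "e' > 0" using e N by (simp add: e'_def)
    with uc obtain d where d: "d > 0" "\<And>x y. dist y x < d \<Longrightarrow> dist (grad \<rho> y) (grad \<rho> x) < e'"
      unfolding uniformly_continuous_on_def by (metis UNIV_I)
    have pt: "\<bar>\<rho> (y - t) - \<rho> (x - t) - (y - x) \<bullet> grad \<rho> (x - t)\<bar> \<le> e' * norm (y - x)" if "norm (y - x) < d" for y t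
    proof -
      \<comment> \<open>Subtracting the linear part of the kernel at x - t leaves a function whose
        gradient is at most e' on the whole segment, so the mean value inequality bounds the
        remainder.\<close>
      let ?f = "\<lambda>z. \<rho> z - z \<bullet> grad \<rho> (x - t)"
      have "\<bar>?f (y - t) - ?f (x - t)\<bar> \<le> e' * norm ((y - t) - (x - t))"
      proof (rule norm_diff_le_grad_bound)
        fix z assume z: "z \<in> closed_segment (y - t) (x - t)"
        show "GDERIV ?f z :> grad \<rho> z - grad \<rho> (x - t)"
          by (intro GDERIV_diff Ck_GDERIV[OF \<rho>] GDERIV_inner)
        have "norm (z - (x - t)) \<le> norm ((y - t) - (x - t))"
          using segment_bound(2)[OF z] by (simp add: norm_minus_commute)
        then have "dist z (x - t) < d" using that by (simp add: dist_norm)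
        then show "norm (grad \<rho> z - grad \<rho> (x - t)) \<le> e'" using d(2) by (metis dist_norm less_imp_le)
      qed
      moreover have "?f (y - t) - ?f (x - t) = \<rho> (y - t) - \<rho> (x - t) - (y - x) \<bullet> grad \<rho> (x - t)"
        by (simp add: inner_diff_left)
      ultimately show ?thesis by simp
    qed
    show "\<exists>d>0. \<forall>y. norm (y - x) < d \<longrightarrow> norm (mollify \<rho> w y - mollify \<rho> w x - (y - x) \<bullet> D) \<le> e * norm (y - x)"
    proof (intro exI conjI allI impI)
      show "d > 0" by fact
      fix y assume y: "norm (y - x) < d"
      have i3: "integrable lebesgue (\<lambda>t. w t * ((y - x) \<bullet> grad \<rho> (x - t)))"
        using integrable_inner_right[OF int2[of x], of "y - x"] by simp
      have "mollify \<rho> w y - mollify \<rho> w x - (y - x) \<bullet> D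
        = (\<integral>t. w t * \<rho> (y - t) - w t * \<rho> (x - t) - w t * ((y - x) \<bullet> grad \<rho> (x - t)) \<partial>lebesgue)"
        unfolding mollify_def D_def using int1[of y] int1[of x] i3 int2[of x]
        by (simp add: integral_inner_right[symmetric] del: integral_inner_right)
      also have "norm \<dots> \<le> (\<integral>t. (e' * norm (y - x)) * \<bar>w t\<bar> \<partial>lebesgue)"
      proof (rule Bochner_Integration.integral_norm_bound_integral)
        show "integrable lebesgue (\<lambda>t. w t * \<rho> (y - t) - w t * \<rho> (x - t) - w t * ((y - x) \<bullet> grad \<rho> (x - t)))"
          using int1[of y] int1[of x] i3 by (intro Bochner_Integration.integrable_diff)
        show "integrable lebesgue (\<lambda>t. (e' * norm (y - x)) * \<bar>w t\<bar>)" using w by simp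
        fix t
        have "w t * \<rho> (y - t) - w t * \<rho> (x - t) - w t * ((y - x) \<bullet> grad \<rho> (x - t))
           = w t * (\<rho> (y - t) - \<rho> (x - t) - (y - x) \<bullet> grad \<rho> (x - t))" by (simp add: algebra_simps)
        then show "norm (w t * \<rho> (y - t) - w t * \<rho> (x - t) - w t * ((y - x) \<bullet> grad \<rho> (x - t))) \<le> (e' * norm (y - x)) * \<bar>w t\<bar>"
          using mult_left_mono[OF pt[OF y, of t] abs_ge_zero[of "w t"]] by (simp add: abs_mult mult.commute)
      qed
      also have "\<dots> = e' * norm (y - x) * N" unfolding N_def by simp
      also have "\<dots> \<le> e * norm (y - x)"
      proof -
        have "e' * N \<le> e" using e N unfolding e'_def by (simp add: field_simps)
        from mult_right_mono[OF this norm_ge_zero[of "y - x"]] show ?thesis by (simp add: mult_ac)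
      qed
      finally show "norm (mollify \<rho> w y - mollify \<rho> w x - (y - x) \<bullet> D) \<le> e * norm (y - x)" by simp
    qed
  qed
  then show ?thesis by (simp add: gderiv_def D_def)
qed

text \<open>A partial derivative of the mollification is the mollification with the corresponding
  partial derivative of the kernel. The induction therefore runs over all smooth kernels of bounded
  support, which are no longer nonnegative or normalised.\<close>

lemma Ck_mollify:
  fixes w :: "'a::euclidean_space \<Rightarrow> real"
  assumes w: "integrable lebesgue w" and \<rho>: "\<And>k. Ck k \<rho>" and K: "bounded K" "\<And>x. x \<notin> K \<Longrightarrow> \<rho> x = 0"
  shows "Ck k (mollify \<rho> w)"
  using \<rho> K
proof (induction k arbitrary: \<rho> K)
  case 0
  have "isCont (mollify \<rho> w) x" for x
    by (rule GDERIV_isCont[OF GDERIV_mollify[OF w 0(1)[of "Suc 0"] 0(2,3)]])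
  then show ?case by (simp add: continuous_at_imp_continuous_on)
next
  case (Suc k)
  let ?K = "closure K"
  have K': "bounded ?K" "\<And>x. x \<notin> ?K \<Longrightarrow> \<rho> x = 0" "\<And>x. x \<notin> ?K \<Longrightarrow> grad \<rho> x = 0"
    using Suc.prems(2,3) closure_subset[of K] by (auto intro!: grad_vanish[of ?K])
  show ?case
  proof (rule Ck_SucI[OF GDERIV_mollify[OF w Suc.prems(1)[of "Suc k"] Suc.prems(2,3)]])
    fix i :: 'a assume i: "i \<in> Basis"
    have "(\<lambda>x. (\<integral>y. w y *\<^sub>R grad \<rho> (x - y) \<partial>lebesgue) \<bullet> i) = mollify (\<lambda>z. grad \<rho> z \<bullet> i) w"
      using integrable_mollify[OF w Ck_grad_continuous[OF Suc.prems(1)[of "Suc k"]] K'(1,3)]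
      by (auto simp: fun_eq_iff mollify_def integral_inner_left[symmetric] simp del: integral_inner_left)
    moreover have "Ck k (mollify (\<lambda>z. grad \<rho> z \<bullet> i) w)"
    proof (rule Suc.IH[OF _ K'(1)])
      show "Ck k (\<lambda>z. grad \<rho> z \<bullet> i)" for k using Suc.prems(1)[of "Suc k"] i by (simp add: Ck_Suc_grad)
    qed (use K'(3) in auto)
    ultimately show "Ck k (\<lambda>x. (\<integral>y. w y *\<^sub>R grad \<rho> (x - y) \<partial>lebesgue) \<bullet> i)" by simp
  qed auto
qed

definition mollifier :: "real \<Rightarrow> ('a::euclidean_space \<Rightarrow> real) \<Rightarrow> bool" where
  "mollifier \<delta> \<rho> \<longleftrightarrow> (\<forall>k. Ck k \<rho>) \<and> (\<forall>x. \<rho> x \<ge> 0) \<and> (\<forall>x. norm x \<ge> \<delta> \<longrightarrow> \<rho> x = 0) \<and> integral\<^sup>L lebesgue \<rho> = 1"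

text \<open>A bump on a small box around 0, divided by its integral. The integral is positive
  because a nonempty open box is not negligible.\<close>

lemma mollifier_exists:
  assumes "\<delta> > 0" shows "\<exists>\<rho> :: 'a::euclidean_space \<Rightarrow> real. mollifier \<delta> \<rho>"
proof -
  obtain a b :: 'a where ab: "0 \<in> box a b" "box a b \<subseteq> ball 0 \<delta>"
    using rational_boxes[OF assms, of 0] by blast
  let ?b = "box_bump a b"
  have v: "?b x = 0" if "x \<notin> box a b" for x
    using box_bump_pos_iff[of a b x] box_bump_nonneg[of a b x] that by linarith
  have int: "integrable lebesgue ?b"
    by (rule integrable_continuous_vanish[OF Ck_continuous[OF Ck_box_bump] bounded_box v])
  have "integral\<^sup>L lebesgue ?b \<noteq> 0"
  proof
    assume "integral\<^sup>L lebesgue ?b = 0"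
    then have "AE x in lebesgue. ?b x = 0"
      using integral_nonneg_eq_0_iff_AE[OF int] box_bump_nonneg by auto
    then have "AE x in lebesgue. x \<notin> box a b"
      by eventually_elim (metis box_bump_pos_iff less_irrefl)
    then have "negligible (box a b)" by (simp add: negligible_iff_null_sets AE_iff_null_sets)
    then show False using ab(1) open_not_negligible[OF open_box] by blast
  qed
  moreover have "integral\<^sup>L lebesgue ?b \<ge> 0" by (intro Bochner_Integration.integral_nonneg box_bump_nonneg)
  ultimately have pos: "integral\<^sup>L lebesgue ?b > 0" by linarith
  show ?thesis unfolding mollifier_def
  proof (intro exI[of _ "\<lambda>x. (1 / integral\<^sup>L lebesgue ?b) * ?b x"] conjI allI impI)
    show "Ck k (\<lambda>x. (1 / integral\<^sup>L lebesgue ?b) * ?b x)" for k by (intro Ck_cmult Ck_box_bump)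
    show "0 \<le> (1 / integral\<^sup>L lebesgue ?b) * ?b x" for x using pos box_bump_nonneg[of a b x] by simp
    show "(1 / integral\<^sup>L lebesgue ?b) * ?b x = 0" if "\<delta> \<le> norm x" for x
      using that ab(2) v[of x] by (force simp: subset_iff)
    show "(\<integral>x. (1 / integral\<^sup>L lebesgue ?b) * ?b x \<partial>lebesgue) = 1" using pos by simp
  qed
qed

context
  fixes \<delta> :: real and \<rho> :: "'a::euclidean_space \<Rightarrow> real"
  assumes \<rho>: "mollifier \<delta> \<rho>"
begin

lemma mollifier_Ck: "Ck k \<rho>" and mollifier_nonneg: "\<rho> x \<ge> 0"
  and mollifier_vanish: "x \<notin> ball 0 \<delta> \<Longrightarrow> \<rho> x = 0" and mollifier_integral: "integral\<^sup>L lebesgue \<rho> = 1"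
  using \<rho> by (auto simp: mollifier_def)

lemma mollifier_continuous: "continuous_on UNIV \<rho>" by (rule Ck_continuous[OF mollifier_Ck])

lemma mollifier_integrable: "integrable lebesgue \<rho>"
  by (rule integrable_continuous_vanish[OF mollifier_continuous bounded_ball mollifier_vanish])

lemma mollifier_reflect: "(\<integral>y. \<rho> (x - y) \<partial>lebesgue) = 1" "integrable lebesgue (\<lambda>y. \<rho> (x - y))"
  using integral_lebesgue_reflect[OF continuous_borel_measurable[OF mollifier_continuous], of x]
    integrable_lebesgue_reflect[OF continuous_borel_measurable[OF mollifier_continuous], of x]
  by (simp_all add: mollifier_integral mollifier_integrable)

text \<open>The kernel centred at x is a probability density carried by the ball of radius \<delta>,
  so the mollification is an average of values that differ from \<open>w x\<close> by at most
  e.\<close>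

lemma mollify_close:
  assumes w: "integrable lebesgue w" and e: "\<And>y. dist x y < \<delta> \<Longrightarrow> \<bar>w y - w x\<bar> \<le> e"
  shows "\<bar>mollify \<rho> w x - w x\<bar> \<le> e"
proof -
  have i1: "integrable lebesgue (\<lambda>y. w y * \<rho> (x - y))"
    using integrable_mollify[OF w mollifier_continuous, of "ball 0 \<delta>" x] mollifier_vanish by auto
  have i2: "integrable lebesgue (\<lambda>y. w x * \<rho> (x - y))" using mollifier_reflect(2) by simp
  have "mollify \<rho> w x - w x = (\<integral>y. w y * \<rho> (x - y) - w x * \<rho> (x - y) \<partial>lebesgue)"
    unfolding mollify_def using i1 i2 by (simp add: mollifier_reflect(1))
  also have "norm \<dots> \<le> (\<integral>y. e * \<rho> (x - y) \<partial>lebesgue)"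
  proof (rule Bochner_Integration.integral_norm_bound_integral)
    fix y
    show "norm (w y * \<rho> (x - y) - w x * \<rho> (x - y)) \<le> e * \<rho> (x - y)"
    proof (cases "dist x y < \<delta>")
      case True
      have "norm (w y * \<rho> (x - y) - w x * \<rho> (x - y)) = \<bar>w y - w x\<bar> * \<rho> (x - y)"
        by (simp add: left_diff_distrib[symmetric] abs_mult mollifier_nonneg)
      then show ?thesis using mult_right_mono[OF e[OF True] mollifier_nonneg] by simp
    next
      case False
      then have "\<rho> (x - y) = 0" by (intro mollifier_vanish) (simp add: dist_norm norm_minus_commute)
      then show ?thesis by simp
    qed
  qed (use i1 i2 mollifier_reflect(2) in auto)
  finally show ?thesis by (simp add: mollifier_reflect(1))
qed

text \<open>After a reflection of the integration variable the mollification is an average of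
  translates of \<open>w\<close>, each of which has the Lipschitz constant L.\<close>

lemma mollify_lipschitz:
  assumes cw: "continuous_on UNIV w" and w: "integrable lebesgue w" and L: "\<And>x y. \<bar>w x - w y\<bar> \<le> L * norm (x - y)"
  shows "\<bar>mollify \<rho> w x - mollify \<rho> w y\<bar> \<le> L * norm (x - y)"
proof -
  have eq: "mollify \<rho> w x = (\<integral>z. w (x - z) * \<rho> z \<partial>lebesgue)"
    and int: "integrable lebesgue (\<lambda>z. w (x - z) * \<rho> z)" for x
  proof -
    have b: "(\<lambda>z. w (x - z) * \<rho> z) \<in> borel_measurable borel"
      by (intro continuous_borel_measurable continuous_on_mult continuous_reflect cw mollifier_continuous)
    show "mollify \<rho> w x = (\<integral>z. w (x - z) * \<rho> z \<partial>lebesgue)"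
      unfolding mollify_def integral_lebesgue_reflect[OF b, of x, symmetric] by simp
    show "integrable lebesgue (\<lambda>z. w (x - z) * \<rho> z)"
      using integrable_mollify[OF w mollifier_continuous, of "ball 0 \<delta>" x] mollifier_vanish
      unfolding integrable_lebesgue_reflect[OF b, of x, symmetric] by auto
  qed
  have "mollify \<rho> w x - mollify \<rho> w y = (\<integral>z. w (x - z) * \<rho> z - w (y - z) * \<rho> z \<partial>lebesgue)"
    unfolding eq using int by simp
  also have "norm \<dots> \<le> (\<integral>z. (L * norm (x - y)) * \<rho> z \<partial>lebesgue)"
  proof (rule Bochner_Integration.integral_norm_bound_integral)
    fix z
    have "norm (w (x - z) * \<rho> z - w (y - z) * \<rho> z) = \<bar>w (x - z) - w (y - z)\<bar> * \<rho> z"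
      by (simp add: left_diff_distrib[symmetric] abs_mult mollifier_nonneg)
    also have "\<dots> \<le> (L * norm (x - y)) * \<rho> z"
      using L[of "x - z" "y - z"] by (intro mult_right_mono mollifier_nonneg) simp
    finally show "norm (w (x - z) * \<rho> z - w (y - z) * \<rho> z) \<le> (L * norm (x - y)) * \<rho> z" .
  qed (use int mollifier_integrable in auto)
  finally show ?thesis by (simp add: mollifier_integral)
qed

lemma mollify_vanish:
  assumes "\<And>y. dist x y < \<delta> \<Longrightarrow> w y = 0" shows "mollify \<rho> w x = 0"
proof -
  have "w y * \<rho> (x - y) = 0" for y
    using assms[of y] mollifier_vanish[of "x - y"] by (cases "dist x y < \<delta>") (auto simp: dist_norm norm_minus_commute)
  then show ?thesis unfolding mollify_def by (simp only: Bochner_Integration.integral_zero)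
qed

end


text \<open>The difference quotient in the direction of the gradient itself tends to its norm; a
  step short enough for the error term e is taken along \<open>D\<close>.\<close>

lemma lipschitz_imp_norm_grad_le:
  fixes f :: "'a::euclidean_space \<Rightarrow> real"
  assumes "GDERIV f x :> D" "\<And>y. \<bar>f y - f x\<bar> \<le> L * norm (y - x)"
  shows "norm D \<le> L"
proof (rule field_le_epsilon)
  fix e :: real assume "e > 0"
  with assms(1) obtain d where d: "d > 0"
    "\<And>y. norm (y - x) < d \<Longrightarrow> norm (f y - f x - (y - x) \<bullet> D) \<le> e * norm (y - x)"
    unfolding gderiv_def has_derivative_at_alt by blast
  show "norm D \<le> L + e"
  proof (cases "D = 0")
    case True
    \<comment> \<open>Comparing x with x + i forces L to be nonnegative, which is all that a
      vanishing gradient requires.\<close>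
    obtain i :: 'a where "i \<in> Basis" using nonempty_Basis by blast
    then have "0 \<le> L" using assms(2)[of "x + i"] by simp
    then show ?thesis using True \<open>e > 0\<close> by simp
  next
    case False
    define t where "t = d / (2 * norm D)"
    have t: "t > 0" "norm ((x + t *\<^sub>R D) - x) < d" using False d(1) by (auto simp: t_def)
    have "t * (norm D)\<^sup>2 = ((x + t *\<^sub>R D) - x) \<bullet> D" by (simp add: power2_norm_eq_inner)
    also have "\<dots> \<le> \<bar>f (x + t *\<^sub>R D) - f x\<bar> + norm (f (x + t *\<^sub>R D) - f x - ((x + t *\<^sub>R D) - x) \<bullet> D)"
      by simp
    also have "\<dots> \<le> L * norm ((x + t *\<^sub>R D) - x) + e * norm ((x + t *\<^sub>R D) - x)"
      by (intro add_mono assms(2) d(2) t(2))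
    also have "\<dots> = t * (norm D * (L + e))" using t(1) by (simp add: algebra_simps)
    finally have "norm D * norm D \<le> norm D * (L + e)" using t(1) by (simp add: power2_eq_square)
    then show ?thesis using False by simp
  qed
qed

section \<open>Approximation by test functions, and mollification of functions with a weak
  gradient\<close>

lemma compact_cball_neighbourhood:
  fixes A :: "'a::euclidean_space set"
  assumes "compact A" "open \<Omega>" "A \<subseteq> \<Omega>"
  obtains d where "d > 0" "\<And>x. x \<in> A \<Longrightarrow> cball x d \<subseteq> \<Omega>"
  using compact_subset_open_imp_cball_epsilon_subset[OF assms] by (metis UN_subset_iff)

text \<open>Moving the values of \<open>w\<close> towards 0 by \<epsilon> confines the support to
  the compact set on which |w| \<ge> \<epsilon>, and neither this nor averaging increases the
  Lipschitz constant. That is why the gradient bound is L itself and not L plus an error.\<close>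

lemma test_function_approximation:
  fixes w :: "'a::euclidean_space \<Rightarrow> real"
  assumes \<Omega>: "open \<Omega>" "bounded \<Omega>" and L: "L \<ge> 0" "\<And>x y. \<bar>w x - w y\<bar> \<le> L * norm (x - y)"
    and z: "\<And>x. x \<notin> \<Omega> \<Longrightarrow> w x = 0" and e: "e > 0"
  obtains \<eta> where "\<eta> \<in> test_functions \<Omega>" "\<And>x. \<bar>\<eta> x - w x\<bar> \<le> e" "\<And>x. norm (grad \<eta> x) \<le> L"
proof -
  define \<epsilon> where "\<epsilon> = e / 2"
  have \<epsilon>: "\<epsilon> > 0" using e by (simp add: \<epsilon>_def)
  \<comment> \<open>Soft thresholding: \<open>w\<close> minus its truncation to the interval from
    -\<epsilon> to \<epsilon>.\<close>
  define T where "T x = w x - max (- \<epsilon>) (min \<epsilon> (w x))" for x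
  have Tw: "\<bar>T x - w x\<bar> \<le> \<epsilon>" for x using \<epsilon> unfolding T_def by linarith
  have LT: "\<bar>T x - T y\<bar> \<le> L * norm (x - y)" for x y
    using L(2)[of x y] \<epsilon> unfolding T_def by linarith
  have cont: "continuous_on UNIV g" if "\<And>x y. \<bar>g x - g y\<bar> \<le> L * norm (x - y)" for g :: "'a \<Rightarrow> real"
    using that L(1) by (intro lipschitz_on_continuous_on[of L] lipschitz_onI) (auto simp: dist_norm)
  define A where "A = {x. \<epsilon> \<le> \<bar>w x\<bar>}"
  have "closed A" unfolding A_def
    by (intro closed_Collect_le continuous_on_rabs cont L(2) continuous_on_const)
  moreover have A\<Omega>: "A \<subseteq> \<Omega>" using z \<epsilon> unfolding A_def by force
  ultimately have A: "compact A" using \<Omega>(2) bounded_subset by (auto simp: compact_eq_bounded_closed)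
  have T0: "T x = 0" if "x \<notin> A" for x using that unfolding T_def A_def by auto
  obtain d where d: "d > 0" "\<And>x. x \<in> A \<Longrightarrow> cball x d \<subseteq> \<Omega>"
    using compact_cball_neighbourhood[OF A \<Omega>(1) A\<Omega>] by blast
  \<comment> \<open>The radius d keeps the mollified support inside \<Omega>, and \<epsilon>/(L + 1)
    keeps the mollification error below \<epsilon>. Thresholding costs another \<epsilon>, whence
    \<epsilon> = e/2.\<close>
  define \<delta> where "\<delta> = min d (\<epsilon> / (L + 1))"
  have \<delta>: "\<delta> > 0" "\<delta> \<le> d" "L * \<delta> \<le> \<epsilon>"
  proof -
    show "\<delta> > 0" "\<delta> \<le> d" using d \<epsilon> L by (auto simp: \<delta>_def)
    have "L * \<delta> \<le> L * (\<epsilon> / (L + 1))" using L by (intro mult_left_mono) (auto simp: \<delta>_def)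
    also have "\<dots> \<le> \<epsilon>" using L \<epsilon> by (simp add: field_simps)
    finally show "L * \<delta> \<le> \<epsilon>" .
  qed
  obtain \<rho> :: "'a \<Rightarrow> real" where \<rho>: "mollifier \<delta> \<rho>" using mollifier_exists[OF \<delta>(1)] by blast
  have iT: "integrable lebesgue T"
    by (rule integrable_continuous_vanish[OF cont[OF LT] compact_imp_bounded[OF A] T0])
  let ?K = "{x + y | x y. x \<in> A \<and> y \<in> cball 0 d}"
  show ?thesis
  proof (rule that)
    show "mollify \<rho> T \<in> test_functions \<Omega>"
    proof (rule test_functionsI)
      show "Ck k (mollify \<rho> T)" for k
        by (rule Ck_mollify[OF iT mollifier_Ck[OF \<rho>] bounded_ball mollifier_vanish[OF \<rho>]])
      show "compact ?K" by (rule compact_sums[OF A compact_cball])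
      show "?K \<subseteq> \<Omega>"
      proof clarify
        fix x y :: 'a assume "x \<in> A" "y \<in> cball 0 d"
        then have "x + y \<in> cball x d" by (simp add: dist_norm)
        then show "x + y \<in> \<Omega>" using d(2)[OF \<open>x \<in> A\<close>] by blast
      qed
      fix x assume x: "x \<notin> ?K"
      show "mollify \<rho> T x = 0"
      proof (rule mollify_vanish[OF \<rho>])
        fix y assume y: "dist x y < \<delta>"
        have "y \<notin> A"
        proof
          assume "y \<in> A"
          moreover have "x - y \<in> cball 0 d" using y \<delta>(2) by (simp add: dist_norm norm_minus_commute)
          ultimately have "y + (x - y) \<in> ?K" by blast
          then show False using x by simp
        qed
        then show "T y = 0" by (rule T0)
      qed
    qed
    show "\<bar>mollify \<rho> T x - w x\<bar> \<le> e" for x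
    proof -
      have "\<bar>mollify \<rho> T x - T x\<bar> \<le> \<epsilon>"
      proof (rule mollify_close[OF \<rho> iT])
        fix y assume "dist x y < \<delta>"
        then have "L * norm (y - x) \<le> L * \<delta>" using L(1) by (intro mult_left_mono) (auto simp: dist_norm norm_minus_commute)
        then show "\<bar>T y - T x\<bar> \<le> \<epsilon>" using LT[of y x] \<delta>(3) by linarith
      qed
      then show ?thesis using Tw[of x] unfolding \<epsilon>_def by linarith
    qed
    show "norm (grad (mollify \<rho> T) x) \<le> L" for x
    proof (rule lipschitz_imp_norm_grad_le)
      show "GDERIV (mollify \<rho> T) x :> grad (mollify \<rho> T) x"
        by (rule Ck_GDERIV[where k=0], rule Ck_mollify[OF iT mollifier_Ck[OF \<rho>] bounded_ball mollifier_vanish[OF \<rho>]])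
      show "\<bar>mollify \<rho> T y - mollify \<rho> T x\<bar> \<le> L * norm (y - x)" for y
        by (rule mollify_lipschitz[OF \<rho> cont[OF LT] iT LT])
    qed
  qed
qed

text \<open>If the ball of radius \<delta> around x stays in \<Omega>, the kernel centred at x is a
  test function there. Moving the derivative off the kernel shows that the gradient of the
  mollification is an average of the weak gradient, and averages preserve the bound L.\<close>

lemma norm_grad_mollify_le:
  fixes w u :: "'a::euclidean_space \<Rightarrow> real"
  assumes \<rho>: "mollifier \<delta> \<rho>" and w: "integrable lebesgue w" "\<And>x. x \<notin> \<Omega> \<Longrightarrow> w x = 0"
    and \<Omega>: "open \<Omega>" and wu: "AE x in lebesgue_on \<Omega>. w x = u x"
    and p: "has_weak_grad \<Omega> u p" "AE x in lebesgue_on \<Omega>. norm (p x) \<le> L"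
    and x: "cball x \<delta> \<subseteq> \<Omega>"
  shows "norm (grad (mollify \<rho> w) x) \<le> L"
proof -
  note r = mollifier_Ck[OF \<rho>] mollifier_vanish[OF \<rho>]
  have S: "\<Omega> \<in> sets lebesgue" using \<Omega> by (intro sets_completionI_sets) auto
  let ?\<phi> = "\<lambda>y. \<rho> (x - y)"
  have \<phi>0: "?\<phi> y = 0" if "y \<notin> cball x \<delta>" for y
    using that by (intro r(2)) (auto simp: dist_norm norm_minus_commute)
  have \<phi>: "?\<phi> \<in> test_functions \<Omega>"
    by (rule test_functionsI[OF Ck_reflect[OF r(1)] compact_cball x \<phi>0])
  have g\<phi>: "grad ?\<phi> y = - grad \<rho> (x - y)" for y by (rule grad_reflect[OF r(1)[of "Suc 0"]])
  have pi: "integrable (lebesgue_on (cball x \<delta>)) p" and ui: "integrable (lebesgue_on (cball x \<delta>)) u"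
    using p(1) x unfolding has_weak_grad_def L1_loc_def by auto
  obtain M where M: "\<And>y. \<bar>?\<phi> y\<bar> \<le> M" using test_bounded[OF \<phi>] by metis
  have pm: "(\<lambda>y. ?\<phi> y *\<^sub>R p y) = (\<lambda>y. indicator (cball x \<delta>) y *\<^sub>R (?\<phi> y *\<^sub>R p y))"
    using \<phi>0 by (auto simp: indicator_def fun_eq_iff)
  have ci: "integrable (lebesgue_on (cball x \<delta>)) (\<lambda>y. ?\<phi> y *\<^sub>R p y)"
  proof (rule Bochner_Integration.integrable_bound)
    show "integrable (lebesgue_on (cball x \<delta>)) (\<lambda>y. M *\<^sub>R p y)" using pi by simp
    have "?\<phi> \<in> borel_measurable (lebesgue_on (cball x \<delta>))"
      by (rule continuous_imp_measurable_on_sets_lebesgue[OF test_continuous(1)[OF \<phi>]]) simp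
    then show "(\<lambda>y. ?\<phi> y *\<^sub>R p y) \<in> borel_measurable (lebesgue_on (cball x \<delta>))"
      using pi by (intro borel_measurable_scaleR) auto
    show "AE y in lebesgue_on (cball x \<delta>). norm (?\<phi> y *\<^sub>R p y) \<le> norm (M *\<^sub>R p y)"
      using M by (intro always_eventually) (auto intro!: mult_right_mono intro: order_trans[OF _ abs_ge_self])
  qed
  then have "integrable lebesgue (\<lambda>y. ?\<phi> y *\<^sub>R p y)"
    using integrable_lebesgue_on_vanish[of "cball x \<delta>" "\<lambda>y. ?\<phi> y *\<^sub>R p y"] \<phi>0 by simp
  then have int: "integrable (lebesgue_on \<Omega>) (\<lambda>y. ?\<phi> y *\<^sub>R p y)"
    using integrable_lebesgue_on_vanish[OF S, of "\<lambda>y. ?\<phi> y *\<^sub>R p y"] test_outside[OF \<phi>] by auto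
  have "GDERIV (mollify \<rho> w) x :> (\<integral>y. w y *\<^sub>R grad \<rho> (x - y) \<partial>lebesgue)" (is "GDERIV _ _ :> ?D")
    by (rule GDERIV_mollify[OF w(1) r(1) bounded_ball r(2)])
  then have "grad (mollify \<rho> w) x = ?D" by (rule grad_eq)
  also have "\<dots> = (\<integral>y. ?\<phi> y *\<^sub>R p y \<partial>lebesgue_on \<Omega>)"
  proof (rule euclidean_eqI)
    fix i :: 'a assume i: "i \<in> Basis"
    have gr: "grad \<rho> z = 0" if "z \<notin> cball 0 \<delta>" for z
      by (rule grad_vanish[OF closed_cball r(2) that]) auto
    have "?D \<bullet> i = (\<integral>y. w y * (grad \<rho> (x - y) \<bullet> i) \<partial>lebesgue)"
      using integrable_mollify[OF w(1) Ck_grad_continuous[OF r(1)] bounded_cball, of 0 \<delta>, OF gr, of x]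
      by (simp add: integral_inner_left[symmetric] del: integral_inner_left)
    also have "\<dots> = (\<integral>y. w y * (grad \<rho> (x - y) \<bullet> i) \<partial>lebesgue_on \<Omega>)"
      using w(2) by (intro integral_lebesgue_on_vanish[symmetric] S) auto
    also have "\<dots> = (\<integral>y. - (u y * (grad ?\<phi> y \<bullet> i)) \<partial>lebesgue_on \<Omega>)"
    proof (rule integral_cong_AE)
      show "AE y in lebesgue_on \<Omega>. w y * (grad \<rho> (x - y) \<bullet> i) = - (u y * (grad ?\<phi> y \<bullet> i))"
        using wu by eventually_elim (simp add: g\<phi>)
      have "(\<lambda>y. grad \<rho> (x - y) \<bullet> i) \<in> borel_measurable (lebesgue_on \<Omega>)"
        by (rule continuous_imp_measurable_on_sets_lebesgue[OF continuous_on_subset[OF continuous_on_inner[OF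
           continuous_reflect[OF Ck_grad_continuous[OF r(1)]] continuous_on_const] subset_UNIV] S])
      moreover have "w \<in> borel_measurable (lebesgue_on \<Omega>)"
        using w(1) by (intro measurable_restrict_space1) auto
      ultimately show "(\<lambda>y. w y * (grad \<rho> (x - y) \<bullet> i)) \<in> borel_measurable (lebesgue_on \<Omega>)" by simp
      \<comment> \<open>\<open>u\<close> is only known to be locally integrable, so measurability is
        shown for its restriction to the ball; the product is unchanged because the gradient of the
        kernel vanishes outside.\<close>
      have "(\<lambda>y. indicator (cball x \<delta>) y *\<^sub>R u y) \<in> borel_measurable (lebesgue_on \<Omega>)"
      proof (intro measurable_restrict_space1)
        show "(\<lambda>y. indicator (cball x \<delta>) y *\<^sub>R u y) \<in> borel_measurable lebesgue"
          using ui integrable_restrict_space[of "cball x \<delta>" lebesgue u] by auto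
      qed
      then have "(\<lambda>y. - ((indicator (cball x \<delta>) y *\<^sub>R u y) * (- grad \<rho> (x - y) \<bullet> i))) \<in> borel_measurable (lebesgue_on \<Omega>)"
        using \<open>(\<lambda>y. grad \<rho> (x - y) \<bullet> i) \<in> borel_measurable (lebesgue_on \<Omega>)\<close> by simp
      moreover have "- ((indicator (cball x \<delta>) y *\<^sub>R u y) * (- grad \<rho> (x - y) \<bullet> i)) = - (u y * (grad ?\<phi> y \<bullet> i))" for y
        unfolding g\<phi> using gr[of "x - y"] by (cases "y \<in> cball x \<delta>") (auto simp: dist_norm norm_minus_commute)
      ultimately show "(\<lambda>y. - (u y * (grad ?\<phi> y \<bullet> i))) \<in> borel_measurable (lebesgue_on \<Omega>)" by simp
    qed
    also have "\<dots> = (\<integral>y. (p y \<bullet> i) * ?\<phi> y \<partial>lebesgue_on \<Omega>)"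
      using p(1) \<phi> i unfolding has_weak_grad_def by simp
    also have "\<dots> = (\<integral>y. ?\<phi> y *\<^sub>R p y \<partial>lebesgue_on \<Omega>) \<bullet> i"
      using int by (simp add: integral_inner_left[symmetric] mult.commute del: integral_inner_left)
    finally show "?D \<bullet> i = (\<integral>y. ?\<phi> y *\<^sub>R p y \<partial>lebesgue_on \<Omega>) \<bullet> i" .
  qed
  also have "norm \<dots> \<le> (\<integral>y. norm (?\<phi> y *\<^sub>R p y) \<partial>lebesgue_on \<Omega>)"
    by (rule integral_norm_bound)
  also have "\<dots> \<le> (\<integral>y. L * ?\<phi> y \<partial>lebesgue_on \<Omega>)"
  proof (rule integral_mono_AE)
    show "integrable (lebesgue_on \<Omega>) (\<lambda>y. norm (?\<phi> y *\<^sub>R p y))" using int by (rule integrable_norm)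
    show "integrable (lebesgue_on \<Omega>) (\<lambda>y. L * ?\<phi> y)"
      using integrable_lebesgue_on_vanish[OF S, of ?\<phi>] test_outside[OF \<phi>] mollifier_reflect(2)[OF \<rho>] by simp
    show "AE y in lebesgue_on \<Omega>. norm (?\<phi> y *\<^sub>R p y) \<le> L * ?\<phi> y"
      using p(2) by eventually_elim (simp add: mollifier_nonneg[OF \<rho>] mult.commute mult_right_mono)
  qed
  also have "\<dots> = L * (\<integral>y. ?\<phi> y \<partial>lebesgue)"
    using integral_lebesgue_on_vanish[OF S, of ?\<phi>] test_outside[OF \<phi>] by simp
  finally show ?thesis by (simp add: mollifier_reflect(1)[OF \<rho>])
qed

section \<open>Lipschitz bounds and uniqueness of weak gradients\<close>

text \<open>A mollification with radius below the distance from the segment to the complement of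
  \<Omega> has gradient at most L along the whole segment. Continuity of \<open>w\<close> at the two
  end points makes the mollified values as close to the true ones as desired.\<close>

lemma lipschitz_on_segment:
  fixes w u :: "'a::euclidean_space \<Rightarrow> real"
  assumes w: "continuous_on UNIV w" "integrable lebesgue w" "\<And>x. x \<notin> \<Omega> \<Longrightarrow> w x = 0"
    and \<Omega>: "open \<Omega>" and wu: "AE x in lebesgue_on \<Omega>. w x = u x"
    and p: "has_weak_grad \<Omega> u p" "AE x in lebesgue_on \<Omega>. norm (p x) \<le> L"
    and xy: "closed_segment x y \<subseteq> \<Omega>"
  shows "\<bar>w x - w y\<bar> \<le> L * norm (x - y)"
proof (rule field_le_epsilon)
  fix e :: real assume "e > 0"
  then have e2: "e / 2 > 0" by simp
  obtain d where d: "d > 0" "\<And>z. z \<in> closed_segment x y \<Longrightarrow> cball z d \<subseteq> \<Omega>"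
    using compact_cball_neighbourhood[OF compact_segment \<Omega> xy] by blast
  obtain dx where dx: "dx > 0" "\<And>z. dist z x < dx \<Longrightarrow> dist (w z) (w x) < e / 2"
    using w(1) e2 unfolding continuous_on_iff by (metis UNIV_I)
  obtain dy where dy: "dy > 0" "\<And>z. dist z y < dy \<Longrightarrow> dist (w z) (w y) < e / 2"
    using w(1) e2 unfolding continuous_on_iff by (metis UNIV_I)
  define \<delta> where "\<delta> = min d (min dx dy)"
  have \<delta>: "\<delta> > 0" "\<delta> \<le> d" "\<delta> \<le> dx" "\<delta> \<le> dy" using d dx dy by (auto simp: \<delta>_def)
  obtain \<rho> :: "'a \<Rightarrow> real" where \<rho>: "mollifier \<delta> \<rho>" using mollifier_exists[OF \<delta>(1)] by blast
  have "\<bar>mollify \<rho> w x - mollify \<rho> w y\<bar> \<le> L * norm (x - y)"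
  proof (rule norm_diff_le_grad_bound)
    fix z assume z: "z \<in> closed_segment x y"
    show "GDERIV (mollify \<rho> w) z :> grad (mollify \<rho> w) z"
      by (rule Ck_GDERIV[where k=0], rule Ck_mollify[OF w(2) mollifier_Ck[OF \<rho>] bounded_ball mollifier_vanish[OF \<rho>]])
    have "cball z \<delta> \<subseteq> \<Omega>" using d(2)[OF z] \<delta>(2) by (meson order_trans subset_cball)
    then show "norm (grad (mollify \<rho> w) z) \<le> L"
      using norm_grad_mollify_le[OF \<rho> w(2) _ \<Omega> wu p] w(3) by blast
  qed
  moreover have "\<bar>mollify \<rho> w x - w x\<bar> \<le> e / 2"
  proof (rule mollify_close[OF \<rho> w(2)])
    fix z assume "dist x z < \<delta>"
    then show "\<bar>w z - w x\<bar> \<le> e / 2" using dx(2)[of z] \<delta> by (simp add: dist_real_def dist_commute)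
  qed
  moreover have "\<bar>mollify \<rho> w y - w y\<bar> \<le> e / 2"
  proof (rule mollify_close[OF \<rho> w(2)])
    fix z assume "dist y z < \<delta>"
    then show "\<bar>w z - w y\<bar> \<le> e / 2" using dy(2)[of z] \<delta> by (simp add: dist_real_def dist_commute)
  qed
  ultimately show "\<bar>w x - w y\<bar> \<le> L * norm (x - y) + e" by linarith
qed

text \<open>The constant C of the given representative may exceed L because \<Omega> may force
  detours. For a segment inside \<Omega> the bound L is already available. Otherwise the segment
  meets the complement at some z, and it suffices that |v x| is at most L times the distance from x
  to the complement: the straight path from x to a nearest point \<open>z0\<close> of the complement
  stays in \<Omega> up to its end.\<close>

lemma zero_extension_lipschitz:
  fixes w u :: "'a::euclidean_space \<Rightarrow> real"
  assumes \<Omega>: "open \<Omega>" "bounded \<Omega>" and w: "C-lipschitz_on (closure \<Omega>) w" "\<And>x. x \<in> frontier \<Omega> \<Longrightarrow> w x = 0"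
    and wu: "AE x in lebesgue_on \<Omega>. w x = u x"
    and p: "has_weak_grad \<Omega> u p" "AE x in lebesgue_on \<Omega>. norm (p x) \<le> L" and L: "L \<ge> 0"
  shows "\<bar>(if x \<in> \<Omega> then w x else 0) - (if y \<in> \<Omega> then w y else 0)\<bar> \<le> L * norm (x - y)"
proof -
  define v where "v x = (if x \<in> \<Omega> then w x else 0)" for x
  have vw: "v x = w x" if "x \<in> closure \<Omega>" for x
    using that w(2)[of x] \<Omega>(1) by (auto simp: v_def frontier_def interior_open)
  have v0: "v x = 0" if "x \<notin> \<Omega>" for x using that by (simp add: v_def)
  have "continuous_on (closure \<Omega> \<union> - \<Omega>) (\<lambda>x. if x \<in> \<Omega> then w x else 0)"
  proof (rule continuous_on_cases)
    show "continuous_on (closure \<Omega>) w" using w(1) by (rule lipschitz_on_continuous_on)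
    show "\<forall>x. x \<in> closure \<Omega> \<and> x \<notin> \<Omega> \<or> x \<in> - \<Omega> \<and> x \<in> \<Omega> \<longrightarrow> w x = 0"
      using w(2) \<Omega>(1) by (auto simp: frontier_def interior_open)
  qed (use \<Omega> in auto)
  moreover have "closure \<Omega> \<union> - \<Omega> = UNIV" using closure_subset by auto
  ultimately have vc: "continuous_on UNIV v" unfolding v_def by simp
  have vi: "integrable lebesgue v" by (rule integrable_continuous_vanish[OF vc \<Omega>(2) v0])
  have "AE x in lebesgue_on \<Omega>. x \<in> \<Omega>" by (intro AE_I2) (simp add: space_restrict_space)
  with wu have vu: "AE x in lebesgue_on \<Omega>. v x = u x"
    by eventually_elim (simp add: v_def)
  have seg: "\<bar>v x - v y\<bar> \<le> L * norm (x - y)" if "closed_segment x y \<subseteq> \<Omega>" for x y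
    using lipschitz_on_segment[OF vc vi _ \<Omega>(1) vu p that] v0 by blast
  have out: "\<bar>v x\<bar> \<le> L * norm (x - z)" if z: "z \<notin> \<Omega>" for x z
  proof (cases "x \<in> \<Omega>")
    case True
    obtain z0 where z0: "z0 \<in> - \<Omega>" "infdist x (- \<Omega>) = dist x z0"
      using infdist_attains_inf[of "- \<Omega>" x] z \<Omega>(1) by auto
    let ?d = "norm (x - z0)"
    have le: "?d \<le> norm (x - z')" if "z' \<notin> \<Omega>" for z'
      using infdist_le[of z' "- \<Omega>" x] that z0(2) by (simp add: dist_norm)
    have dpos: "?d > 0" using True z0(1) by auto
    \<comment> \<open>Up to parameter t < 1 the path to \<open>z0\<close> lies in \<Omega> and L
      applies. The remaining piece has length (1 - t) times the distance and is estimated by the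
      crude constant C; its contribution disappears as t tends to 1.\<close>
    have ray: "\<bar>v x\<bar> \<le> L * ?d + C * ((1 - t) * ?d)" if t: "0 \<le> t" "t < 1" for t
    proof -
      let ?z = "x + t *\<^sub>R (z0 - x)"
      have seg_in: "closed_segment x ?z \<subseteq> \<Omega>"
      proof
        fix y assume y: "y \<in> closed_segment x ?z"
        have "norm (x - y) \<le> norm (x - ?z)" using segment_bound(1)[OF y] by (simp add: norm_minus_commute)
        also have "\<dots> = t * ?d" using t(1) by (simp add: norm_minus_commute)
        also have "\<dots> < ?d" using t dpos by simp
        finally show "y \<in> \<Omega>" using le[of y] by linarith
      qed
      then have zin: "?z \<in> \<Omega>" by auto
      have "\<bar>v x - v ?z\<bar> \<le> L * norm (x - ?z)" by (rule seg[OF seg_in])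
      also have "norm (x - ?z) = t * ?d" using t(1) by (simp add: norm_minus_commute)
      also have "L * (t * ?d) \<le> L * ?d" using t L by (intro mult_left_mono) (auto intro: mult_left_le_one_le)
      finally have 1: "\<bar>v x - v ?z\<bar> \<le> L * ?d" .
      \<comment> \<open>The points of the path before its end lie in \<Omega> and approach
        \<open>z0\<close>, so the Lipschitz bound of \<open>w\<close> on the closure reaches
        \<open>z0\<close>.\<close>
      have "z0 \<in> closure \<Omega>"
      proof (rule closure_approachable[THEN iffD2], intro allI impI)
        fix e :: real assume e: "e > 0"
        \<comment> \<open>Chosen so that the point at parameter s is at distance at most e/2 from
          \<open>z0\<close>.\<close>
        define s where "s = max 0 (1 - e / (2 * ?d))"
        have s: "0 \<le> s" "s < 1" using e dpos by (auto simp: s_def)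
        have "closed_segment x (x + s *\<^sub>R (z0 - x)) \<subseteq> \<Omega>"
        proof
          fix y assume y: "y \<in> closed_segment x (x + s *\<^sub>R (z0 - x))"
          have "norm (x - y) \<le> norm (x - (x + s *\<^sub>R (z0 - x)))" using segment_bound(1)[OF y] by (simp add: norm_minus_commute)
          also have "\<dots> = s * ?d" using s(1) by (simp add: norm_minus_commute)
          also have "\<dots> < ?d" using s dpos by simp
          finally show "y \<in> \<Omega>" using le[of y] by linarith
        qed
        then have "x + s *\<^sub>R (z0 - x) \<in> \<Omega>" by auto
        moreover have "dist (x + s *\<^sub>R (z0 - x)) z0 < e"
        proof -
          have "(x + s *\<^sub>R (z0 - x)) - z0 = (1 - s) *\<^sub>R (x - z0)" by (simp add: algebra_simps)
          then have "dist (x + s *\<^sub>R (z0 - x)) z0 = (1 - s) * ?d" using s by (simp add: dist_norm)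
          also have "\<dots> \<le> e / (2 * ?d) * ?d" using dpos by (intro mult_right_mono) (auto simp: s_def)
          also have "\<dots> < e" using dpos e by simp
          finally show ?thesis .
        qed
        ultimately show "\<exists>y\<in>\<Omega>. dist y z0 < e" by blast
      qed
      moreover have "?z \<in> closure \<Omega>" using zin closure_subset by blast
      ultimately have "dist (w ?z) (w z0) \<le> C * dist ?z z0" by (intro lipschitz_onD[OF w(1)])
      moreover have "?z - z0 = (1 - t) *\<^sub>R (x - z0)" by (simp add: algebra_simps)
      then have "dist ?z z0 = (1 - t) * ?d" using t by (simp add: dist_norm)
      moreover have "w z0 = 0" "w ?z = v ?z" using vw[OF \<open>z0 \<in> closure \<Omega>\<close>] v0 z0(1) zin by (auto simp: v_def)
      ultimately have "\<bar>v ?z\<bar> \<le> C * ((1 - t) * ?d)" by (simp add: dist_real_def)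
      with 1 show ?thesis by linarith
    qed
    have "\<bar>v x\<bar> \<le> L * ?d"
    proof (rule field_le_epsilon)
      fix e :: real assume e: "e > 0"
      have C: "C \<ge> 0" using w(1) by (rule lipschitz_on_nonneg)
      \<comment> \<open>Chosen so that the crude contribution C (1 - s) times the distance is at
        most e; the summand 1 covers C = 0.\<close>
      define s where "s = max 0 (1 - e / ((C + 1) * ?d))"
      have s: "0 \<le> s" "s < 1" using e dpos C by (auto simp: s_def)
      have "C * ((1 - s) * ?d) \<le> C * ((e / ((C + 1) * ?d)) * ?d)" using C dpos
        by (intro mult_left_mono mult_right_mono) (auto simp: s_def)
      also have "\<dots> = C * (e / (C + 1))" using dpos by simp
      also have "\<dots> \<le> e" using C e by (simp add: field_simps)
      finally show "\<bar>v x\<bar> \<le> L * ?d + e" using ray[OF s] by linarith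
    qed
    also have "\<dots> \<le> L * norm (x - z)" by (intro mult_left_mono le z L)
    finally show ?thesis .
  qed (use L v0 in auto)
  show ?thesis
  proof (cases "closed_segment x y \<subseteq> \<Omega>")
    case True
    then show ?thesis using seg unfolding v_def by blast
  next
    case False
    \<comment> \<open>Since z lies between x and y, the distances of x and y to z add up to the
      distance of x and y, so two estimates against the complement combine without loss.\<close>
    then obtain z where z: "z \<in> closed_segment x y" "z \<notin> \<Omega>" by blast
    have "\<bar>v x - v y\<bar> \<le> \<bar>v x\<bar> + \<bar>v y\<bar>" by linarith
    also have "\<dots> \<le> L * norm (x - z) + L * norm (y - z)" by (intro add_mono out z)
    also have "\<dots> = L * (dist x z + dist z y)" by (simp add: dist_norm norm_minus_commute algebra_simps)
    also have "dist x z + dist z y = dist x y" using z(1) by (simp add: between_mem_segment[symmetric] between)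
    finally show ?thesis by (simp add: v_def dist_norm)
  qed
qed

section \<open>The fundamental lemma of the calculus of variations and uniqueness of weak
  gradients\<close>

lemma box_indicator_approximation:
  fixes a b :: "'a::euclidean_space"
  shows "(\<lambda>n. 1 - exp (- real n * box_bump a b x)) \<longlonglongrightarrow> indicator (box a b) x"
proof (cases "x \<in> box a b")
  case True
  then have c: "box_bump a b x > 0" by (simp add: box_bump_pos_iff)
  have "filterlim (\<lambda>n. - (real n * box_bump a b x)) at_bot sequentially"
    unfolding filterlim_uminus_at_bot minus_minus
    by (rule filterlim_at_top_mult_tendsto_pos[OF tendsto_const c filterlim_real_sequentially])
  then have "(\<lambda>n. exp (- real n * box_bump a b x)) \<longlonglongrightarrow> 0"
    using filterlim_compose[OF exp_at_bot] by auto
  from tendsto_diff[OF tendsto_const[of 1] this] show ?thesis using True by simp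
next
  case False
  then have "box_bump a b x = 0" using box_bump_pos_iff[of a b x] box_bump_nonneg[of a b x] by linarith
  then show ?thesis using False by simp
qed

text \<open>Boxes are a generator of the Borel sets that is closed under intersection, so it suffices that the
  integrals over them vanish.\<close>

lemma fundamental_lemma_box:
  fixes h :: "'a::euclidean_space \<Rightarrow> real"
  assumes h: "h \<in> L1_loc \<Omega>" and orth: "\<And>\<phi>. \<phi> \<in> test_functions \<Omega> \<Longrightarrow> (\<integral>x. h x * \<phi> x \<partial>lebesgue_on \<Omega>) = 0"
    and \<Omega>: "\<Omega> \<in> sets lebesgue" and ab: "cbox a b \<subseteq> \<Omega>"
  shows "AE x in lebesgue. x \<in> cbox a b \<longrightarrow> h x = 0"
proof -
  let ?B = "cbox a b"
  \<comment> \<open>Cutting \<open>h\<close> off outside a closed box contained in \<Omega> turns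
    local into global integrability.\<close>
  define H where "H x = indicator ?B x *\<^sub>R h x" for x
  have hi: "integrable (lebesgue_on ?B) h" using h ab by (auto simp: L1_loc_def)
  then have Hi: "integrable lebesgue H"
    unfolding H_def using integrable_restrict_space[of ?B lebesgue h] by simp
  have box0: "(\<integral>x. H x * indicator (box c d) x \<partial>lebesgue) = 0" if cd: "box c d \<subseteq> box a b" for c d
  proof (cases "box c d = {}")
    case False
    then have "cbox c d \<subseteq> cbox a b" using cd closure_mono[OF cd] False by (metis closure_box subset_empty)
    \<comment> \<open>Smooth functions with values between 0 and 1 that vanish outside the box and
      converge to its indicator; |H| dominates the products with \<open>H\<close>.\<close>
    let ?f = "\<lambda>n x. 1 - exp (- real n * box_bump c d x)"
    have bz: "box_bump c d x = 0" if "x \<notin> cbox c d" for x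
      using that box_bump_pos_iff[of c d x] box_bump_nonneg[of c d x] box_subset_cbox[of c d] by (meson in_mono not_less_iff_gr_or_eq order.antisym order_le_less)
    have f: "?f n \<in> test_functions \<Omega>" for n
      using bz ab \<open>cbox c d \<subseteq> cbox a b\<close>
      by (intro test_functionsI[of _ "cbox c d"] Ck_diff Ck_const Ck_exp Ck_cmult Ck_box_bump) auto
    have fb: "0 \<le> ?f n x" "?f n x \<le> 1" for n x using box_bump_nonneg[of c d x] by auto
    have "(\<integral>x. H x * ?f n x \<partial>lebesgue) = 0" for n
    proof -
      have "h x * ?f n x = H x * ?f n x" for x
        using bz[of x] \<open>cbox c d \<subseteq> cbox a b\<close> by (cases "x \<in> ?B") (auto simp: H_def)
      then have "(\<integral>x. H x * ?f n x \<partial>lebesgue) = (\<integral>x. h x * ?f n x \<partial>lebesgue)" by presburger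
      also have "\<dots> = (\<integral>x. h x * ?f n x \<partial>lebesgue_on \<Omega>)"
        using test_outside[OF f[of n]] by (intro integral_lebesgue_on_vanish[symmetric] \<Omega>) auto
      finally show ?thesis using orth[OF f] by simp
    qed
    moreover have "(\<lambda>n. \<integral>x. H x * ?f n x \<partial>lebesgue) \<longlonglongrightarrow> (\<integral>x. H x * indicator (box c d) x \<partial>lebesgue)"
    proof (rule integral_dominated_convergence[where w="\<lambda>x. norm (H x)"])
      have "?f n \<in> borel_measurable lebesgue" for n
        using continuous_borel_measurable[OF test_continuous(1)[OF f[of n]]] by (simp add: measurable_completion)
      then show "(\<lambda>x. H x * ?f n x) \<in> borel_measurable lebesgue" for n
        using Hi by (intro borel_measurable_times) auto
      show "(\<lambda>x. H x * indicator (box c d) x) \<in> borel_measurable lebesgue"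
        using Hi by (intro borel_measurable_times borel_measurable_indicator) auto
      show "AE x in lebesgue. (\<lambda>n. H x * ?f n x) \<longlonglongrightarrow> H x * indicator (box c d) x"
        by (intro AE_I2 tendsto_mult tendsto_const box_indicator_approximation)
      show "AE x in lebesgue. norm (H x * ?f n x) \<le> norm (H x)" for n
        using fb[of n] by (intro AE_I2) (auto simp: abs_mult intro!: mult_right_le_one_le)
    qed (use Hi in auto)
    ultimately show ?thesis by (simp add: LIMSEQ_const_iff)
  qed simp
  \<comment> \<open>A Borel representative is needed because the comparison of measures on the
    generator takes place over \<open>lborel\<close>.\<close>
  obtain H' where H': "H' \<in> borel_measurable lborel" "AE x in lborel. H x = H' x"
    using completion_ex_borel_measurable_real[of H lborel] Hi by auto
  have HH': "AE x in lebesgue. H x = H' x" using H'(2) by (rule AE_completion)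
  define G where "G x = indicator (box a b) x * H' x" for x
  have "integrable lebesgue H'"
    by (rule integrable_cong_AE_imp[OF Hi _ HH']) (use H'(1) in \<open>simp add: measurable_completion\<close>)
  then have "integrable lborel H'" using H'(1) by (simp add: integrable_completion)
  then have Gi: "integrable lborel G" unfolding G_def by (intro integrable_mult_indicator[where 'b=real, simplified]) auto
  have Gm[measurable]: "G \<in> borel_measurable borel" using Gi by auto
  have G0: "(\<integral>x. G x * indicator (box c d) x \<partial>lborel) = 0" for c d
  proof -
    \<comment> \<open>\<open>G\<close> is cut off to the open box, and the intersection of two boxes
      is again a box, so every box in the space reduces to one inside the given box.\<close>
    obtain e f where ef: "box c d \<inter> box a b = box e f" using box_Int_box by blast
    have eq: "G x * indicator (box c d) x = H' x * indicator (box e f) x" for x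
      unfolding G_def ef[symmetric] by (simp add: indicator_inter_arith mult_ac)
    have "(\<integral>x. G x * indicator (box c d) x \<partial>lborel) = (\<integral>x. H' x * indicator (box e f) x \<partial>lborel)" unfolding eq ..
    also have "\<dots> = (\<integral>x. H' x * indicator (box e f) x \<partial>lebesgue)"
      using H'(1) by (intro integral_completion[symmetric]) simp
    also have "\<dots> = (\<integral>x. H x * indicator (box e f) x \<partial>lebesgue)"
    proof (rule integral_cong_AE)
      show "(\<lambda>x. H' x * indicator (box e f) x) \<in> borel_measurable lebesgue"
        using H'(1) by (intro borel_measurable_times borel_measurable_indicator measurable_completion) auto
      show "(\<lambda>x. H x * indicator (box e f) x) \<in> borel_measurable lebesgue"
        using Hi by (intro borel_measurable_times borel_measurable_indicator) auto
      show "AE x in lebesgue. H' x * indicator (box e f) x = H x * indicator (box e f) x"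
        using HH' by eventually_elim simp
    qed
    also have "\<dots> = 0" by (rule box0) (use ef in blast)
    finally show ?thesis .
  qed
  \<comment> \<open>The densities of the positive and the negative part of \<open>G\<close>.
    Vanishing integrals over boxes say that the two measures agree on the generator, hence
    everywhere; so both parts of \<open>G\<close> coincide almost everywhere, which forces
    \<open>G\<close> to vanish.\<close>
  let ?P = "density lborel (\<lambda>x. ennreal (G x))" and ?N = "density lborel (\<lambda>x. ennreal (- G x))"
  have fin: "(\<integral>\<^sup>+x. ennreal (G x) \<partial>lborel) \<noteq> \<infinity>" using Gi by (simp add: real_integrable_def)
  have "?P = ?N"
  proof (rule measure_eqI_generator_eq)
    let ?E = "range (\<lambda>(a, b). box a b::'a set)"
    show "Int_stable ?E" by (auto simp: Int_stable_def box_Int_box)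
    show "?E \<subseteq> Pow UNIV" "sets ?P = sigma_sets UNIV ?E" "sets ?N = sigma_sets UNIV ?E"
      by (simp_all add: borel_eq_box)
    let ?A = "\<lambda>n::nat. box (- (real n *\<^sub>R One)) (real n *\<^sub>R One) :: 'a set"
    show "range ?A \<subseteq> ?E" "(\<Union>i. ?A i) = UNIV" unfolding UN_box_eq_UNIV by auto
    show "emeasure ?P (?A i) \<noteq> \<infinity>" for i
    proof -
      have "emeasure ?P (?A i) = (\<integral>\<^sup>+x. ennreal (G x) * indicator (?A i) x \<partial>lborel)"
        by (subst emeasure_density) auto
      also have "\<dots> \<le> (\<integral>\<^sup>+x. ennreal (G x) \<partial>lborel)"
        by (intro nn_integral_mono) (auto simp: indicator_def)
      finally show ?thesis using fin by (auto simp: top_unique)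
    qed
    fix X assume "X \<in> ?E"
    then obtain c d where X: "X = box c d" by auto
    have GX: "integrable lborel (\<lambda>x. G x * indicator X x)"
      using integrable_mult_indicator[of X lborel G] Gi X by (simp add: mult.commute)
    have i: "ennreal (G x) * indicator X x = ennreal (G x * indicator X x)"
      "ennreal (- G x) * indicator X x = ennreal (- (G x * indicator X x))" for x by (auto simp: indicator_def)
    have "enn2real (\<integral>\<^sup>+x. ennreal (G x * indicator X x) \<partial>lborel) = enn2real (\<integral>\<^sup>+x. ennreal (- (G x * indicator X x)) \<partial>lborel)"
      using G0[of c d] real_lebesgue_integral_def[OF GX] X by simp
    moreover have "(\<integral>\<^sup>+x. ennreal (G x * indicator X x) \<partial>lborel) \<noteq> \<infinity>" "(\<integral>\<^sup>+x. ennreal (- (G x * indicator X x)) \<partial>lborel) \<noteq> \<infinity>"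
      using GX by (simp_all add: real_integrable_def)
    ultimately have "(\<integral>\<^sup>+x. ennreal (G x * indicator X x) \<partial>lborel) = (\<integral>\<^sup>+x. ennreal (- (G x * indicator X x)) \<partial>lborel)"
      by (metis ennreal_enn2real_if infinity_ennreal_def)
    then show "emeasure ?P X = emeasure ?N X"
      using X unfolding i[symmetric] by (subst (1 2) emeasure_density) auto
  qed
  then have "AE x in lborel. ennreal (G x) = ennreal (- G x)"
    by (subst (asm) finite_density_unique) (use fin in auto)
  then have "AE x in lborel. G x = 0"
  proof eventually_elim
    case (elim x)
    then show ?case by (cases "G x \<ge> 0") (auto simp: ennreal_neg ennreal_eq_0_iff dest: sym)
  qed
  then have "AE x in lebesgue. G x = 0" by (rule AE_completion)
  moreover have "AE x in lebesgue. x \<notin> cbox a b - box a b"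
    by (rule AE_not_in) (simp only: negligible_iff_null_sets[symmetric] negligible_frontier_interval)
  ultimately show ?thesis using HH'
    by eventually_elim (auto simp: G_def H_def indicator_def split: if_splits)
qed

text \<open>An open set is a countable union of closed boxes, so the null sets excluded on the
  single boxes unite to a null set.\<close>

lemma fundamental_lemma:
  fixes h :: "'a::euclidean_space \<Rightarrow> real"
  assumes h: "h \<in> L1_loc \<Omega>" and \<Omega>: "open \<Omega>"
    and orth: "\<And>\<phi>. \<phi> \<in> test_functions \<Omega> \<Longrightarrow> (\<integral>x. h x * \<phi> x \<partial>lebesgue_on \<Omega>) = 0"
  shows "AE x in lebesgue. x \<in> \<Omega> \<longrightarrow> h x = 0"
proof -
  obtain \<D> where D: "countable \<D>" "\<D> \<subseteq> Pow \<Omega>" "\<And>X. X \<in> \<D> \<Longrightarrow> \<exists>a b. X = cbox a b" "\<Union>\<D> = \<Omega>"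
    using open_countable_Union_open_cbox[OF \<Omega>] by metis
  have "AE x in lebesgue. \<forall>X\<in>\<D>. x \<in> X \<longrightarrow> h x = 0"
  proof (rule AE_ball_countable[THEN iffD2, OF D(1)], rule ballI)
    fix X assume X: "X \<in> \<D>"
    then obtain a b where "X = cbox a b" using D(3) by blast
    moreover have "X \<subseteq> \<Omega>" using X D(2) by blast
    ultimately show "AE x in lebesgue. x \<in> X \<longrightarrow> h x = 0"
      using fundamental_lemma_box[OF h orth, of a b] \<Omega> by (auto intro: sets_completionI_sets)
  qed
  then show ?thesis by eventually_elim (use D(4) in blast)
qed

text \<open>Each component of the difference is orthogonal to all test functions. This is what ties
  \<open>weak_grad\<close>, a mere choice, to any concrete weak gradient in the functional and in
  \<open>H1_0\<close>.\<close>

lemma weak_grad_unique: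
  fixes p p' :: "'a::euclidean_space \<Rightarrow> 'a"
  assumes \<Omega>: "open \<Omega>" and p: "has_weak_grad \<Omega> u p" "has_weak_grad \<Omega> u p'"
  shows "AE x in lebesgue_on \<Omega>. p x = p' x"
proof -
  have S: "\<Omega> \<in> sets lebesgue" using \<Omega> by (intro sets_completionI_sets) auto
  have loc: "p \<in> L1_loc \<Omega>" "p' \<in> L1_loc \<Omega>" using p by (auto simp: has_weak_grad_def)
  have integrable_times: "integrable (lebesgue_on \<Omega>) (\<lambda>x. (q x \<bullet> i) * \<phi> x)"
    if q: "q \<in> L1_loc \<Omega>" and \<phi>: "\<phi> \<in> test_functions \<Omega>" for q :: "'a \<Rightarrow> 'a" and i \<phi>
  proof -
    obtain K where K: "compact K" "K \<subseteq> \<Omega>" "\<forall>x. x \<notin> K \<longrightarrow> \<phi> x = 0"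
      using test_support[OF \<phi>] by blast
    obtain M where M: "\<And>y. \<bar>\<phi> y\<bar> \<le> M" using test_bounded[OF \<phi>] by metis
    have K': "K \<in> sets lebesgue" using K(1) by (intro sets_completionI_sets) (simp add: borel_compact)
    have qi: "integrable (lebesgue_on K) (\<lambda>x. q x \<bullet> i)" using q K by (auto simp: L1_loc_def)
    have "integrable (lebesgue_on K) (\<lambda>x. (q x \<bullet> i) * \<phi> x)"
    proof (rule Bochner_Integration.integrable_bound)
      show "integrable (lebesgue_on K) (\<lambda>x. M * (q x \<bullet> i))" using qi by simp
      show "(\<lambda>x. (q x \<bullet> i) * \<phi> x) \<in> borel_measurable (lebesgue_on K)"
        using qi continuous_imp_measurable_on_sets_lebesgue[OF test_continuous(1)[OF \<phi>] K']
        by (intro borel_measurable_times) auto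
      have "\<bar>(q x \<bullet> i) * \<phi> x\<bar> \<le> \<bar>M * (q x \<bullet> i)\<bar>" for x
        using mult_right_mono[OF order_trans[OF M[of x] abs_ge_self[of M]] abs_ge_zero[of "q x \<bullet> i"]]
        by (simp add: abs_mult mult.commute)
      then show "AE x in lebesgue_on K. norm ((q x \<bullet> i) * \<phi> x) \<le> norm (M * (q x \<bullet> i))" by simp
    qed
    then have "integrable lebesgue (\<lambda>x. (q x \<bullet> i) * \<phi> x)"
      using integrable_lebesgue_on_vanish[OF K', of "\<lambda>x. (q x \<bullet> i) * \<phi> x"] K(3) by auto
    then show ?thesis
      using integrable_lebesgue_on_vanish[OF S, of "\<lambda>x. (q x \<bullet> i) * \<phi> x"] test_outside[OF \<phi>] by auto
  qed
  have "AE x in lebesgue. x \<in> \<Omega> \<longrightarrow> (p x - p' x) \<bullet> i = 0" if i: "i \<in> Basis" for i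
  proof (rule fundamental_lemma[OF _ \<Omega>])
    show "(\<lambda>x. (p x - p' x) \<bullet> i) \<in> L1_loc \<Omega>" using loc by (auto simp: L1_loc_def)
    fix \<phi> assume \<phi>: "\<phi> \<in> test_functions \<Omega>"
    have "(\<integral>x. (p x \<bullet> i) * \<phi> x \<partial>lebesgue_on \<Omega>) = (\<integral>x. (p' x \<bullet> i) * \<phi> x \<partial>lebesgue_on \<Omega>)"
    proof -
      have "(\<integral>x. u x * (grad \<phi> x \<bullet> i) \<partial>lebesgue_on \<Omega>) = - (\<integral>x. (p x \<bullet> i) * \<phi> x \<partial>lebesgue_on \<Omega>)"
        "(\<integral>x. u x * (grad \<phi> x \<bullet> i) \<partial>lebesgue_on \<Omega>) = - (\<integral>x. (p' x \<bullet> i) * \<phi> x \<partial>lebesgue_on \<Omega>)"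
        using p \<phi> i unfolding has_weak_grad_def by blast+
      then show ?thesis by linarith
    qed
    then show "(\<integral>x. ((p x - p' x) \<bullet> i) * \<phi> x \<partial>lebesgue_on \<Omega>) = 0"
      using integrable_times[OF loc(1) \<phi>, of i] integrable_times[OF loc(2) \<phi>, of i]
      by (simp add: inner_diff_left left_diff_distrib)
  qed
  then have "AE x in lebesgue. \<forall>i\<in>Basis. x \<in> \<Omega> \<longrightarrow> (p x - p' x) \<bullet> i = 0"
    by (intro AE_ball_countable[THEN iffD2]) (auto intro: countable_finite)
  then have "AE x in lebesgue. x \<in> \<Omega> \<longrightarrow> p x = p' x"
  proof eventually_elim
    case (elim x)
    show ?case
    proof
      assume "x \<in> \<Omega>"
      then show "p x = p' x"
        by (intro euclidean_eqI[of "p x" "p' x"]) (use elim in \<open>auto simp: inner_diff_left\<close>)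
    qed
  qed
  then show ?thesis using S by (subst AE_restrict_space_iff) auto
qed

section \<open>The Hahn--Banach theorem\<close>

text \<open>A functional on a subspace is represented by its graph; the bound by the norm forces the graph to be
  single-valued.\<close>

lemma Hahn_Banach_graph:
  fixes G :: "('a::real_normed_vector \<times> real) set"
  assumes G: "subspace G" "\<And>x a. (x, a) \<in> G \<Longrightarrow> a \<le> norm x"
  obtains L :: "'a \<Rightarrow> real" where "linear L" "\<And>x. \<bar>L x\<bar> \<le> norm x" "\<And>x a. (x, a) \<in> G \<Longrightarrow> L x = a"
proof -
  define A where "A = {H. subspace H \<and> G \<subseteq> H \<and> (\<forall>(x, a)\<in>H. a \<le> norm x)}"
  have "\<exists>M\<in>A. \<forall>X\<in>A. M \<subseteq> X \<longrightarrow> X = M"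
  proof (rule subset_Zorn_nonempty)
    show "A \<noteq> {}" using G by (auto simp: A_def)
    fix C assume C: "C \<noteq> {}" "subset.chain A C"
    then have CA: "\<And>H. H \<in> C \<Longrightarrow> H \<in> A" and lin: "\<And>H H'. H \<in> C \<Longrightarrow> H' \<in> C \<Longrightarrow> H \<subseteq> H' \<or> H' \<subseteq> H"
      by (auto simp: subset_chain_def)
    have "subspace (\<Union>C)"
    proof (rule subspaceI)
      obtain H where "H \<in> C" using C(1) by blast
      then show "0 \<in> \<Union>C" using CA[of H] subspace_0[of H] by (auto simp: A_def)
      show "c *\<^sub>R x \<in> \<Union>C" if "x \<in> \<Union>C" for c x
        using that CA subspace_scale unfolding A_def by blast
      fix x y assume "x \<in> \<Union>C" "y \<in> \<Union>C"
      then obtain H H' where H: "x \<in> H" "H \<in> C" "y \<in> H'" "H' \<in> C" by blast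
      then obtain K where "K \<in> C" "x \<in> K" "y \<in> K" using lin[OF H(2,4)] by blast
      then show "x + y \<in> \<Union>C" using CA[of K] subspace_add[of K x y] unfolding A_def by blast
    qed
    moreover have "G \<subseteq> \<Union>C" using C(1) CA unfolding A_def by blast
    moreover have "\<forall>(x, a)\<in>\<Union>C. a \<le> norm x" using CA unfolding A_def by blast
    ultimately show "\<Union>C \<in> A" by (simp add: A_def)
  qed
  then obtain M where MA: "M \<in> A" and max: "\<forall>X\<in>A. M \<subseteq> X \<longrightarrow> X = M" by blast
  have M: "subspace M" "G \<subseteq> M" "\<And>x a. (x, a) \<in> M \<Longrightarrow> a \<le> norm x"
    using MA by (auto simp: A_def)
  have total: "\<exists>a. (x0, a) \<in> M" for x0
  proof (rule ccontr)
    assume not_in: "\<nexists>a. (x0, a) \<in> M"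
    \<comment> \<open>A value \<alpha> at \<open>x0\<close> is admissible if it lies above all
      \<open>a - norm (x - x0)\<close> and below all \<open>norm (y + x0) - b\<close> for pairs in
      \<open>M\<close>. The triangle inequality orders the two families, and \<alpha> is the
      supremum of the lower one.\<close>
    define S where "S = (\<lambda>(x, a). - norm (x - x0) + a) ` M"
    have key: "- norm (x - x0) + a \<le> norm (y + x0) - b" if "(x, a) \<in> M" "(y, b) \<in> M" for x a y b
    proof -
      have "(x + y, a + b) \<in> M" using subspace_add[OF M(1) that] by simp
      then have "a + b \<le> norm (x + y)" by (rule M(3))
      also have "\<dots> \<le> norm (x - x0) + norm (y + x0)" using norm_triangle_ineq[of "x - x0" "y + x0"] by simp
      finally show ?thesis by simp
    qed
    have M0: "(0, 0) \<in> M" using subspace_0[OF M(1)] by (simp add: zero_prod_def)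
    have ne: "S \<noteq> {}" using M0 by (auto simp: S_def)
    have bdd: "bdd_above S" unfolding S_def bdd_above_def using key[OF _ M0] by fastforce
    define \<alpha> where "\<alpha> = Sup S"
    have up: "- norm (x - x0) + a \<le> \<alpha>" if "(x, a) \<in> M" for x a
      unfolding \<alpha>_def using that by (intro cSup_upper[OF _ bdd]) (force simp: S_def)
    have lo: "\<alpha> \<le> norm (y + x0) - b" if "(y, b) \<in> M" for y b
      unfolding \<alpha>_def using key[OF _ that] by (intro cSup_least[OF ne]) (auto simp: S_def)
    have ext: "a + t * \<alpha> \<le> norm (x + t *\<^sub>R x0)" if xa: "(x, a) \<in> M" for x a t
    proof -
      \<comment> \<open>By homogeneity only t = 1 and t = -1 matter: positive t uses the upper
        family of bounds for \<alpha>, negative t the lower one.\<close>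
      consider "t = 0" | "t > 0" | "t < 0" by linarith
      then show ?thesis
      proof cases
        case 1 then show ?thesis using M(3)[OF xa] by simp
      next
        case 2
        have "(x /\<^sub>R t, a / t) \<in> M" using subspace_scale[OF M(1) xa, of "inverse t"] by (simp add: divide_inverse mult.commute)
        then have "t * \<alpha> \<le> t * (norm (x /\<^sub>R t + x0) - a / t)" using 2 lo by (intro mult_left_mono) auto
        also have "\<dots> = norm (t *\<^sub>R (x /\<^sub>R t + x0)) - a" using 2 by (simp add: right_diff_distrib)
        also have "t *\<^sub>R (x /\<^sub>R t + x0) = x + t *\<^sub>R x0" using 2 by (simp add: algebra_simps)
        finally show ?thesis by simp
      next
        case 3
        define s where "s = - t"
        have s: "s > 0" using 3 by (simp add: s_def)
        have "(x /\<^sub>R s, a / s) \<in> M" using subspace_scale[OF M(1) xa, of "inverse s"] by (simp add: divide_inverse mult.commute)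
        then have 1: "s * (- norm (x /\<^sub>R s - x0) + a / s) \<le> s * \<alpha>" using s up by (intro mult_left_mono) auto
        have 2: "s * (- norm (x /\<^sub>R s - x0) + a / s) = - norm (s *\<^sub>R (x /\<^sub>R s - x0)) + a"
          using s by (simp add: right_diff_distrib distrib_left)
        have 3: "s *\<^sub>R (x /\<^sub>R s - x0) = x + t *\<^sub>R x0" using s by (simp add: algebra_simps s_def)
        have "- norm (x + t *\<^sub>R x0) + a \<le> s * \<alpha>" using 1 unfolding 2 3 .
        then show ?thesis by (simp add: s_def)
      qed
    qed
    define M' where "M' = {z + t *\<^sub>R (x0, \<alpha>) | z t. z \<in> M}"
    have "subspace M'"
    proof (rule subspaceI)
      have "0 = 0 + 0 *\<^sub>R (x0, \<alpha>)" by (simp add: zero_prod_def)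
      then show "0 \<in> M'" unfolding M'_def using subspace_0[OF M(1)] by blast
    next
      fix u v assume "u \<in> M'" "v \<in> M'"
      then obtain z t z' t' where "u = z + t *\<^sub>R (x0, \<alpha>)" "v = z' + t' *\<^sub>R (x0, \<alpha>)" "z \<in> M" "z' \<in> M"
        unfolding M'_def by blast
      then have "u + v = (z + z') + (t + t') *\<^sub>R (x0, \<alpha>)" "z + z' \<in> M"
        using subspace_add[OF M(1)] by (auto simp: algebra_simps)
      then show "u + v \<in> M'" unfolding M'_def by blast
    next
      fix c u assume "u \<in> M'"
      then obtain z t where "u = z + t *\<^sub>R (x0, \<alpha>)" "z \<in> M" unfolding M'_def by blast
      then have "c *\<^sub>R u = c *\<^sub>R z + (c * t) *\<^sub>R (x0, \<alpha>)" "c *\<^sub>R z \<in> M"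
        using subspace_scale[OF M(1)] by (auto simp: algebra_simps)
      then show "c *\<^sub>R u \<in> M'" unfolding M'_def by blast
    qed
    moreover have MM': "M \<subseteq> M'"
    proof
      fix z assume "z \<in> M"
      moreover have "z = z + 0 *\<^sub>R (x0, \<alpha>)" by (simp add: zero_prod_def[symmetric])
      ultimately show "z \<in> M'" unfolding M'_def by blast
    qed
    moreover have "\<forall>(x, a)\<in>M'. a \<le> norm x" unfolding M'_def using ext by auto
    ultimately have "M' \<in> A" using M(2) by (auto simp: A_def)
    then have "M' = M" using max MM' by simp
    moreover have "(x0, \<alpha>) = 0 + 1 *\<^sub>R (x0, \<alpha>)" by (simp add: zero_prod_def)
    then have "(x0, \<alpha>) \<in> M'" unfolding M'_def using subspace_0[OF M(1)] by blast
    ultimately show False using not_in by blast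
  qed
  have unique: "a = b" if "(x, a) \<in> M" "(x, b) \<in> M" for x a b
    using subspace_diff[OF M(1) that] subspace_diff[OF M(1) that(2,1)] M(3)[of 0 "a - b"] M(3)[of 0 "b - a"] by simp
  define L where "L x = (THE a. (x, a) \<in> M)" for x
  have LM: "(x, L x) \<in> M" for x
  proof -
    obtain a where a: "(x, a) \<in> M" using total by blast
    then have "(THE a. (x, a) \<in> M) = a" by (rule the_equality) (rule unique[OF _ a])
    then show ?thesis using a by (simp add: L_def)
  qed
  have Leq: "L x = a" if "(x, a) \<in> M" for x a using unique[OF LM that] .
  show ?thesis
  proof (rule that)
    show "linear L"
    proof (rule linearI)
      show "L (x + y) = L x + L y" for x y using subspace_add[OF M(1) LM LM, of x y] by (intro Leq) simp
      show "L (c *\<^sub>R x) = c *\<^sub>R L x" for c x using subspace_scale[OF M(1) LM, of c x] by (intro Leq) simp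
    qed
    then show "\<bar>L x\<bar> \<le> norm x" for x
      using M(3)[OF LM, of x] M(3)[OF LM, of "- x"] linear_neg[of L x] by simp
    show "L x = a" if "(x, a) \<in> G" for x a using that M(2) by (intro Leq) blast
  qed
qed

section \<open>Functionals on a compact totally disconnected space\<close>

definition clopen :: "'x::topological_space set \<Rightarrow> bool" where
  "clopen A \<longleftrightarrow> open A \<and> closed A"

lemma clopen_intros:
  "clopen {}" "clopen UNIV" "clopen A \<Longrightarrow> clopen (- A)" "clopen A \<Longrightarrow> clopen B \<Longrightarrow> clopen (A \<union> B)"
  "clopen A \<Longrightarrow> clopen B \<Longrightarrow> clopen (A \<inter> B)"
  by (auto simp: clopen_def)

lemma clopen_UN: "finite I \<Longrightarrow> (\<And>i. i \<in> I \<Longrightarrow> clopen (A i)) \<Longrightarrow> clopen (\<Union>i\<in>I. A i)"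
  and clopen_INT: "finite I \<Longrightarrow> (\<And>i. i \<in> I \<Longrightarrow> clopen (A i)) \<Longrightarrow> clopen (\<Inter>i\<in>I. A i)"
  by (auto simp: clopen_def)

text \<open>If clopen sets decrease to the empty set, their complements form an open cover, so the
  sequence is eventually empty. Continuity at the empty set, the hypothesis of Caratheodory's
  theorem, thus follows from finite additivity alone.\<close>

lemma clopen_measure_extension:
  fixes m :: "'x::topological_space set \<Rightarrow> real"
  assumes comp: "compact (UNIV :: 'x set)" and pos: "\<And>A. clopen A \<Longrightarrow> m A \<ge> 0"
    and add: "\<And>A B. clopen A \<Longrightarrow> clopen B \<Longrightarrow> A \<inter> B = {} \<Longrightarrow> m (A \<union> B) = m A + m B"
  shows "\<exists>M. sets M = sigma_sets UNIV (Collect clopen) \<and> space M = UNIV \<and>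
    (\<forall>A. clopen A \<longrightarrow> emeasure M A = ennreal (m A))"
proof -
  have "algebra UNIV (Collect (clopen :: 'x set \<Rightarrow> bool))"
    by (auto simp: algebra_iff_Un clopen_intros Compl_eq_Diff_UNIV[symmetric])
  then interpret algebra UNIV "Collect (clopen :: 'x set \<Rightarrow> bool)" .
  have m0: "m {} = 0" using add[of "{}" "{}"] clopen_intros(1) by simp
  have "\<exists>\<mu> :: 'x set \<Rightarrow> ennreal. (\<forall>s\<in>Collect clopen. \<mu> s = ennreal (m s)) \<and> measure_space UNIV (sigma_sets UNIV (Collect clopen)) \<mu>"
  proof (rule caratheodory_empty_continuous)
    show "positive (Collect clopen) (\<lambda>A. ennreal (m A))" using m0 by (simp add: positive_def)
    show "additive (Collect clopen) (\<lambda>A. ennreal (m A))"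
      by (auto simp: additive_def add pos ennreal_plus)
    fix A :: "nat \<Rightarrow> 'x set" assume A: "range A \<subseteq> Collect clopen" "decseq A" "(\<Inter>i. A i) = {}"
    obtain C where C: "finite C" "(UNIV :: 'x set) \<subseteq> (\<Union>i\<in>C. - A i)"
    proof (rule compactE_image[OF comp, of UNIV "\<lambda>i. - A i"])
      have "clopen (A i)" for i using A(1) by blast
      then show "open (- A i)" for i by (simp add: clopen_def open_Compl)
      show "UNIV \<subseteq> (\<Union>i. - A i)" using A(3) by blast
    qed auto
    define N where "N = Max (insert 0 C)"
    have "A n = {}" if "n \<ge> N" for n
    proof -
      have "A n \<subseteq> A i" if "i \<in> C" for i
      proof -
        have "i \<le> N" using that C(1) by (simp add: N_def)
        then show ?thesis using A(2) \<open>n \<ge> N\<close> by (auto simp: decseq_def)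
      qed
      then show ?thesis using C(2) by blast
    qed
    then have "eventually (\<lambda>n. ennreal (m (A n)) = 0) sequentially"
      unfolding eventually_sequentially using m0 by (intro exI[of _ N]) simp
    then show "(\<lambda>i. ennreal (m (A i))) \<longlonglongrightarrow> 0" by (rule tendsto_eventually)
  qed simp
  then obtain \<mu> :: "'x set \<Rightarrow> ennreal" where \<mu>: "\<forall>s\<in>Collect clopen. \<mu> s = ennreal (m s)"
    "measure_space UNIV (sigma_sets UNIV (Collect clopen)) \<mu>" by blast
  let ?M = "measure_of UNIV (Collect clopen) \<mu>"
  have "emeasure ?M A = ennreal (m A)" if "clopen A" for A
    using \<mu> that by (subst emeasure_measure_of[OF refl]) (auto simp: measure_space_def)
  then show ?thesis by (intro exI[of _ ?M]) auto
qed

text \<open>The situation after the extension by Hahn-Banach. Total disconnectedness enters through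
  the approximability by locally constant functions assumed in
  \<open>charge_integral\<close>.\<close>

locale clopen_functional =
  fixes L :: "('x::topological_space \<Rightarrow>\<^sub>C 'b::euclidean_space) \<Rightarrow> real"
  assumes comp: "compact (UNIV :: 'x set)" and lin: "linear L" and bound: "\<bar>L F\<bar> \<le> norm F"
begin

text \<open>\<open>F\<close> times the indicator of \<open>A\<close>. It is an admissible argument
  of \<open>L\<close> because a clopen \<open>A\<close> makes it continuous.\<close>

definition res :: "'x set \<Rightarrow> ('x \<Rightarrow>\<^sub>C 'b) \<Rightarrow> ('x \<Rightarrow>\<^sub>C 'b)" where
  "res A F = Bcontfun (\<lambda>x. if x \<in> A then apply_bcontfun F x else 0)"

lemma apply_res: "clopen A \<Longrightarrow> apply_bcontfun (res A F) x = (if x \<in> A then apply_bcontfun F x else 0)"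
proof -
  assume A: "clopen A"
  have "continuous_on (A \<union> - A) (\<lambda>x. if x \<in> A then apply_bcontfun F x else 0)"
    using A by (intro continuous_on_cases) (auto simp: clopen_def)
  then have "(\<lambda>x. if x \<in> A then apply_bcontfun F x else 0) \<in> bcontfun"
    using norm_bounded[of F] by (intro bcontfun_normI[where b="norm F"]) auto
  then show ?thesis by (simp add: res_def Bcontfun_inverse)
qed

lemma norm_res_le: "clopen A \<Longrightarrow> norm (res A F) \<le> norm F"
  by (rule norm_bound) (auto simp: apply_res norm_bounded)

text \<open>The norm of \<open>L\<close> on fields carried by \<open>A\<close>, which is the total
  variation of the vector charge under construction.\<close>

definition variation :: "'x set \<Rightarrow> real" where
  "variation A = (SUP F\<in>{F. norm F \<le> 1}. L (res A F))"

lemma variation_upper: "clopen A \<Longrightarrow> norm F \<le> 1 \<Longrightarrow> L (res A F) \<le> variation A"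
  unfolding variation_def
proof (rule cSUP_upper)
  assume A: "clopen A"
  have "L (res A F) \<le> 1" if "norm F \<le> 1" for F
    using bound[of "res A F"] norm_res_le[OF A, of F] that by linarith
  then show "bdd_above ((\<lambda>F. L (res A F)) ` {F. norm F \<le> 1})" by (auto simp: bdd_above_def)
qed auto

lemma variation_least: "(\<And>F. norm F \<le> 1 \<Longrightarrow> L (res A F) \<le> c) \<Longrightarrow> variation A \<le> c"
  unfolding variation_def by (rule cSUP_least) (auto intro: exI[of _ 0])

lemma variation_le_1: "clopen A \<Longrightarrow> variation A \<le> 1"
  using bound norm_res_le by (intro variation_least) (meson abs_le_D1 order_trans)

lemma variation_nonneg: "clopen A \<Longrightarrow> variation A \<ge> 0"
proof -
  assume A: "clopen A"
  have "res A 0 = 0" by (rule bcontfun_eqI) (simp add: apply_res[OF A])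
  then show ?thesis using variation_upper[OF A, of 0] linear_0[OF lin] by simp
qed

lemma res_Un:
  assumes "clopen A" "clopen B" "A \<inter> B = {}" shows "res (A \<union> B) F = res A F + res B F"
  using assms by (intro bcontfun_eqI) (auto simp: apply_res clopen_intros)

text \<open>Superadditivity is the substantial half: fields of norm at most 1 on disjoint clopen
  sets glue to one continuous field of norm at most 1, so both suprema can be approached by one
  competitor.\<close>

lemma variation_Un:
  assumes A: "clopen A" and B: "clopen B" and AB: "A \<inter> B = {}"
  shows "variation (A \<union> B) = variation A + variation B"
proof (rule antisym)
  show "variation (A \<union> B) \<le> variation A + variation B"
  proof (rule variation_least)
    fix F :: "'x \<Rightarrow>\<^sub>C 'b" assume "norm F \<le> 1"
    then show "L (res (A \<union> B) F) \<le> variation A + variation B"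
      unfolding res_Un[OF assms] linear_add[OF lin] by (intro add_mono variation_upper A B)
  qed
  have *: "L (res A F) + L (res B F') \<le> variation (A \<union> B)" if F: "norm F \<le> 1" "norm F' \<le> 1" for F F'
  proof -
    let ?H = "res A F + res B F'"
    have "norm ?H \<le> 1"
    proof (rule norm_bound)
      fix x
      show "norm (apply_bcontfun ?H x) \<le> 1"
        using AB norm_bounded[of F x] norm_bounded[of F' x] F by (auto simp: apply_res A B)
    qed
    moreover have "res (A \<union> B) ?H = ?H"
      using AB by (intro bcontfun_eqI) (auto simp: apply_res A B clopen_intros)
    ultimately have "L ?H \<le> variation (A \<union> B)"
      using variation_upper[of "A \<union> B" ?H] A B by (simp add: clopen_intros)
    then show ?thesis by (simp add: linear_add[OF lin])
  qed
  have "variation A \<le> variation (A \<union> B) - variation B"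
  proof (rule variation_least)
    fix F :: "'x \<Rightarrow>\<^sub>C 'b" assume F: "norm F \<le> 1"
    have "variation B \<le> variation (A \<union> B) - L (res A F)"
      by (rule variation_least) (use *[OF F] in force)
    then show "L (res A F) \<le> variation (A \<union> B) - variation B" by linarith
  qed
  then show "variation A + variation B \<le> variation (A \<union> B)" by linarith
qed

text \<open>The component along \<open>v\<close> of the vector charge: \<open>L\<close> applied to
  the indicator of \<open>A\<close> times the constant vector \<open>v\<close>.\<close>

definition charge :: "'b \<Rightarrow> 'x set \<Rightarrow> real" where "charge v A = L (res A (const_bcontfun v))"

lemma charge_Un: "clopen A \<Longrightarrow> clopen B \<Longrightarrow> A \<inter> B = {} \<Longrightarrow> charge v (A \<union> B) = charge v A + charge v B"
  by (simp add: charge_def res_Un linear_add[OF lin])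

lemma charge_le_variation: "clopen A \<Longrightarrow> norm v \<le> 1 \<Longrightarrow> charge v A \<le> variation A"
  unfolding charge_def by (intro variation_upper norm_bound) auto

lemma charge_linear: "clopen A \<Longrightarrow> linear (\<lambda>v. charge v A)"
proof (rule linearI)
  assume A: "clopen A"
  fix v w :: 'b and c :: real
  have "res A (const_bcontfun (v + w)) = res A (const_bcontfun v) + res A (const_bcontfun w)"
    by (rule bcontfun_eqI) (simp add: apply_res A)
  then show "charge (v + w) A = charge v A + charge w A" by (simp add: charge_def linear_add[OF lin])
  have "res A (const_bcontfun (c *\<^sub>R v)) = c *\<^sub>R res A (const_bcontfun v)"
    by (rule bcontfun_eqI) (simp add: apply_res A)
  then show "charge (c *\<^sub>R v) A = c *\<^sub>R charge v A" by (simp add: charge_def linear_scale[OF lin])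
qed

lemma charge_plus_variation_nonneg: "clopen A \<Longrightarrow> norm v \<le> 1 \<Longrightarrow> variation A + charge v A \<ge> 0"
  using charge_le_variation[of A "- v"] linear_neg[OF charge_linear, of A v] by simp

text \<open>Adding the variation makes a charge nonnegative, so that it extends to a measure.\<close>

abbreviation "E \<equiv> Collect (clopen :: 'x set \<Rightarrow> bool)"

definition V :: "'x measure" where
  "V = (SOME M. sets M = sigma_sets UNIV E \<and> space M = UNIV \<and> (\<forall>A. clopen A \<longrightarrow> emeasure M A = ennreal (variation A)))"

definition W :: "'b \<Rightarrow> 'x measure" where
  "W v = (SOME M. sets M = sigma_sets UNIV E \<and> space M = UNIV \<and> (\<forall>A. clopen A \<longrightarrow> emeasure M A = ennreal (variation A + charge v A)))"

lemma V: "sets V = sigma_sets UNIV E" "space V = UNIV" "clopen A \<Longrightarrow> emeasure V A = ennreal (variation A)"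
proof -
  have "\<exists>M. sets M = sigma_sets UNIV E \<and> space M = UNIV \<and> (\<forall>A. clopen A \<longrightarrow> emeasure M A = ennreal (variation A))"
    by (rule clopen_measure_extension[OF comp]) (auto simp: variation_nonneg variation_Un)
  from someI_ex[OF this] show "sets V = sigma_sets UNIV E" "space V = UNIV" "clopen A \<Longrightarrow> emeasure V A = ennreal (variation A)"
    unfolding V_def by blast+
qed

lemma W:
  assumes "norm v \<le> 1"
  shows "sets (W v) = sigma_sets UNIV E" "space (W v) = UNIV" "clopen A \<Longrightarrow> emeasure (W v) A = ennreal (variation A + charge v A)"
proof -
  have "\<exists>M. sets M = sigma_sets UNIV E \<and> space M = UNIV \<and> (\<forall>A. clopen A \<longrightarrow> emeasure M A = ennreal (variation A + charge v A))"
    using assms by (intro clopen_measure_extension[OF comp]) (auto simp: charge_plus_variation_nonneg variation_Un charge_Un)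
  from someI_ex[OF this] show "sets (W v) = sigma_sets UNIV E" "space (W v) = UNIV" "clopen A \<Longrightarrow> emeasure (W v) A = ennreal (variation A + charge v A)"
    unfolding W_def by blast+
qed

lemma finite_V: "finite_measure V"
  by (rule finite_measureI) (simp add: V clopen_intros)

lemma finite_W: "norm v \<le> 1 \<Longrightarrow> finite_measure (W v)"
  by (rule finite_measureI) (simp add: W clopen_intros)

lemma measure_V: "clopen A \<Longrightarrow> measure V A = variation A"
  by (simp add: measure_def V variation_nonneg)

lemma measure_W: "norm v \<le> 1 \<Longrightarrow> clopen A \<Longrightarrow> measure (W v) A = variation A + charge v A"
  by (simp add: measure_def W charge_plus_variation_nonneg)

text \<open>On clopen sets this is linearity of the charge in \<open>v\<close>; both sides are
  differences of finite measures, so the identity spreads to the generated sigma-algebra. It allows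
  the vector measure, built from finitely many coordinates, to be tested in every direction.\<close>

lemma W_component:
  assumes v: "norm v \<le> 1" and A: "A \<in> sigma_sets UNIV E"
  shows "measure (W v) A - measure V A = (\<Sum>i\<in>Basis. (v \<bullet> i) * (measure (W i) A - measure V A))"
proof -
  have "Int_stable E" by (auto simp: Int_stable_def clopen_intros)
  moreover have "E \<subseteq> Pow UNIV" by simp
  ultimately show ?thesis using A
  proof (induction rule: sigma_sets_induct_disjoint)
    case (basic A)
    then have A: "clopen A" by simp
    have "charge v A = (\<Sum>i\<in>Basis. (v \<bullet> i) * charge i A)"
    proof -
      have "charge v A = charge (\<Sum>i\<in>Basis. (v \<bullet> i) *\<^sub>R i) A" by (simp add: euclidean_representation)
      also have "\<dots> = (\<Sum>i\<in>Basis. charge ((v \<bullet> i) *\<^sub>R i) A)" by (rule linear_sum[OF charge_linear[OF A]])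
      finally show ?thesis by (simp add: linear_scale[OF charge_linear[OF A]])
    qed
    then show ?case using v A by (simp add: measure_W measure_V)
  next
    case empty
    show ?case by simp
  next
    case (compl A)
    \<comment> \<open>Taking complements turns the extended charge into the total charge minus its
      value, and the total charge is linear in the vector since the whole space is clopen.\<close>
    have *: "measure (W w) (UNIV - A) - measure V (UNIV - A)
       = charge w UNIV - (measure (W w) A - measure V A)" if "norm w \<le> 1" for w
      using finite_measure.finite_measure_compl[OF finite_W[OF that], of A] finite_measure.finite_measure_compl[OF finite_V, of A]
        compl.hyps that by (simp add: W V measure_W measure_V clopen_intros)
    have "charge v UNIV = (\<Sum>i\<in>Basis. (v \<bullet> i) * charge i UNIV)"
    proof -
      have "charge v UNIV = charge (\<Sum>i\<in>Basis. (v \<bullet> i) *\<^sub>R i) UNIV" by (simp add: euclidean_representation)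
      also have "\<dots> = (\<Sum>i\<in>Basis. charge ((v \<bullet> i) *\<^sub>R i) UNIV)" by (rule linear_sum[OF charge_linear[OF clopen_intros(2)]])
      finally show ?thesis by (simp add: linear_scale[OF charge_linear[OF clopen_intros(2)]])
    qed
    then show ?case using compl.IH v by (simp add: * right_diff_distrib sum_subtractf)
  next
    case (union A)
    have *: "(\<lambda>n. measure (W w) (A n) - measure V (A n)) sums (measure (W w) (\<Union>n. A n) - measure V (\<Union>n. A n))" if "norm w \<le> 1" for w
      using union.hyps that by (intro sums_diff finite_measure.finite_measure_UNION finite_W finite_V) (auto simp: W V)
    have "(\<lambda>n. \<Sum>i\<in>Basis. (v \<bullet> i) * (measure (W i) (A n) - measure V (A n))) sums
       (\<Sum>i\<in>Basis. (v \<bullet> i) * (measure (W i) (\<Union>n. A n) - measure V (\<Union>n. A n)))"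
      by (intro sums_sum sums_mult *) simp
    then show ?case using *[OF v] union.IH by (simp add: sums_unique2)
  qed
qed

text \<open>The vector measure that represents \<open>L\<close>: its component along a basis vector
  i extends \<open>charge i\<close>.\<close>

definition Q :: "'x set \<Rightarrow> 'b" where
  "Q A = (\<Sum>i\<in>Basis. (measure (W i) A - measure V A) *\<^sub>R i)"

text \<open>For the unit vector v opposite to \<open>Q A\<close> the component is - |Q A|. It equals
  \<open>measure (W v) A - measure V A\<close> with a nonnegative first term, which is the claim. A
  bound by coordinates would lose the Euclidean norm and with it the constant 1.\<close>

lemma norm_Q_le:
  assumes A: "A \<in> sigma_sets UNIV E" shows "norm (Q A) \<le> measure V A"
proof -
  have *: "v \<bullet> Q A = measure (W v) A - measure V A" if "norm v \<le> 1" for v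
    unfolding W_component[OF that A] Q_def by (simp add: inner_sum_right mult.commute)
  have "- norm (Q A) = - sgn (Q A) \<bullet> Q A"
    by (simp add: sgn_div_norm power2_norm_eq_inner[symmetric] power2_eq_square divide_simps)
  also have "\<dots> = measure (W (- sgn (Q A))) A - measure V A" by (rule *) (simp add: norm_sgn)
  finally show ?thesis using measure_nonneg[of "W (- sgn (Q A))" A] by linarith
qed

definition locally_constant :: "('x \<Rightarrow> real) \<Rightarrow> bool" where
  "locally_constant s \<longleftrightarrow> finite (range s) \<and> (\<forall>y. clopen (s -` {y}))"

text \<open>The field is a finite combination of constant fields restricted to clopen level sets; on
  each of them \<open>L\<close> is a charge, and a charge is the difference of \<open>W v\<close>
  and \<open>V\<close>.\<close>

lemma charge_integral_locally_constant:
  assumes s: "locally_constant s" and v: "norm v \<le> 1"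
  shows "integrable V s" "integrable (W v) s" "(\<lambda>x. s x *\<^sub>R v) \<in> bcontfun"
    "L (Bcontfun (\<lambda>x. s x *\<^sub>R v)) = (\<integral>x. s x \<partial>W v) - (\<integral>x. s x \<partial>V)"
proof -
  let ?A = "\<lambda>y. s -` {y}"
  have fin: "finite (range s)" and cl: "clopen (?A y)" for y using s by (auto simp: locally_constant_def)
  have rep: "s x = (\<Sum>y\<in>range s. y * indicator (?A y) x)" for x
  proof -
    have "(\<Sum>y\<in>range s. y * indicator (?A y) x) = (\<Sum>y\<in>range s. if y = s x then y else 0)"
      by (intro sum.cong) (auto simp: indicator_def)
    then show ?thesis using fin by simp
  qed
  have mV: "?A y \<in> sets V" and mW: "?A y \<in> sets (W v)" for y using cl v by (auto simp: V W)
  have iV: "integrable V (indicator (?A y) :: _ \<Rightarrow> real)" for y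
    using mV cl by (intro integrable_real_indicator) (auto simp: V)
  have iW: "integrable (W v) (indicator (?A y) :: _ \<Rightarrow> real)" for y
    using mW cl v by (intro integrable_real_indicator) (auto simp: W)
  show "integrable V s" by (subst rep[abs_def], rule Bochner_Integration.integrable_sum) (use iV in auto)
  show "integrable (W v) s" by (subst rep[abs_def], rule Bochner_Integration.integrable_sum) (use iW in auto)
  have eqF: "(\<lambda>x. s x *\<^sub>R v) = apply_bcontfun (\<Sum>y\<in>range s. y *\<^sub>R res (?A y) (const_bcontfun v))"
  proof
    fix x
    have ap: "apply_bcontfun (\<Sum>y\<in>I. g y) x = (\<Sum>y\<in>I. apply_bcontfun (g y) x)" for g :: "real \<Rightarrow> 'x \<Rightarrow>\<^sub>C 'b" and I
      by (induction I rule: infinite_finite_induct) auto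
    have "s x *\<^sub>R v = (\<Sum>y\<in>range s. (y * indicator (?A y) x) *\<^sub>R v)"
      by (subst rep) (simp add: scaleR_sum_left)
    also have "\<dots> = (\<Sum>y\<in>range s. y *\<^sub>R (apply_bcontfun (res (?A y) (const_bcontfun v)) x))"
      by (intro sum.cong) (auto simp: apply_res[OF cl])
    finally show "s x *\<^sub>R v = apply_bcontfun (\<Sum>y\<in>range s. y *\<^sub>R res (?A y) (const_bcontfun v)) x"
      by (simp add: ap)
  qed
  then show "(\<lambda>x. s x *\<^sub>R v) \<in> bcontfun" using apply_bcontfun by metis
  have "L (Bcontfun (\<lambda>x. s x *\<^sub>R v)) = (\<Sum>y\<in>range s. y * charge v (?A y))"
    unfolding eqF apply_bcontfun_inverse by (simp add: linear_sum[OF lin] linear_scale[OF lin] charge_def)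
  also have "\<dots> = (\<Sum>y\<in>range s. y * measure (W v) (?A y)) - (\<Sum>y\<in>range s. y * measure V (?A y))"
    using v cl by (simp add: measure_W measure_V sum_subtractf[symmetric] algebra_simps)
  also have "(\<Sum>y\<in>range s. y * measure (W v) (?A y)) = (\<integral>x. s x \<partial>W v)"
    by (subst rep[abs_def], subst Bochner_Integration.integral_sum) (use iW v in \<open>auto simp: W\<close>)
  also have "(\<Sum>y\<in>range s. y * measure V (?A y)) = (\<integral>x. s x \<partial>V)"
    by (subst rep[abs_def], subst Bochner_Integration.integral_sum) (use iV in \<open>auto simp: V\<close>)
  finally show "L (Bcontfun (\<lambda>x. s x *\<^sub>R v)) = (\<integral>x. s x \<partial>W v) - (\<integral>x. s x \<partial>V)" .
qed

lemma charge_integral: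
  assumes s: "\<And>n. locally_constant (s n)" and g: "continuous_on UNIV g" "uniform_limit UNIV s g sequentially"
    and v: "norm v \<le> 1"
  shows "integrable V g" "integrable (W v) g" "(\<lambda>x. g x *\<^sub>R v) \<in> bcontfun"
    "L (Bcontfun (\<lambda>x. g x *\<^sub>R v)) = (\<integral>x. g x \<partial>W v) - (\<integral>x. g x \<partial>V)"
proof -
  interpret V: finite_measure V by (rule finite_V)
  interpret W: finite_measure "W v" by (rule finite_W[OF v])
  note lc = charge_integral_locally_constant[OF s v]
  have lim: "(\<lambda>n. s n x) \<longlonglongrightarrow> g x" for x using tendsto_uniform_limitI[OF g(2)] by simp
  have gV: "g \<in> borel_measurable V" by (rule borel_measurable_LIMSEQ_metric[OF _ lim]) (use lc(1) in auto)
  have gW: "g \<in> borel_measurable (W v)" by (rule borel_measurable_LIMSEQ_metric[OF _ lim]) (use lc(2) in auto)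
  have "compact (range g)" by (rule compact_continuous_image[OF g(1) comp])
  then obtain M where M: "\<And>x. \<bar>g x\<bar> \<le> M" using compact_imp_bounded bounded_iff by (metis rangeI real_norm_def)
  show gVi: "integrable V g" using gV M by (intro V.integrable_const_bound[where B=M]) auto
  show gWi: "integrable (W v) g" using gW M by (intro W.integrable_const_bound[where B=M]) auto
  show b: "(\<lambda>x. g x *\<^sub>R v) \<in> bcontfun"
  proof (rule bcontfun_normI[where b="M * 1"])
    show "continuous_on UNIV (\<lambda>x. g x *\<^sub>R v)" using g(1) by (intro continuous_on_scaleR continuous_on_const)
    show "norm (g x *\<^sub>R v) \<le> M * 1" for x unfolding norm_scaleR real_norm_def
      using M[of x] v by (intro mult_mono) auto
  qed
  show "L (Bcontfun (\<lambda>x. g x *\<^sub>R v)) = (\<integral>x. g x \<partial>W v) - (\<integral>x. g x \<partial>V)"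
  proof -
    \<comment> \<open>The sum of the three factors by which a uniform error is amplified: the norm
      bound 1 of \<open>L\<close> and the masses of \<open>W v\<close> and \<open>V\<close>.\<close>
    define K where "K = 1 + measure (W v) UNIV + measure V UNIV"
    have K: "K > 0" by (simp add: K_def add_pos_nonneg)
    have le: "\<bar>L (Bcontfun (\<lambda>x. g x *\<^sub>R v)) - ((\<integral>x. g x \<partial>W v) - (\<integral>x. g x \<partial>V))\<bar> \<le> e" if "e > 0" for e
    proof -
      have "e / K > 0" using that K by simp
      from uniform_limitD[OF g(2) this] obtain n where n: "\<And>x. dist (s n x) (g x) < e / K"
        using eventually_happens'[OF sequentially_bot] by (metis (mono_tags, lifting) UNIV_I)
      have "norm (Bcontfun (\<lambda>x. g x *\<^sub>R v) - Bcontfun (\<lambda>x. s n x *\<^sub>R v)) \<le> e / K"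
      proof (rule norm_bound)
        fix x
        have "norm (g x *\<^sub>R v - s n x *\<^sub>R v) = \<bar>g x - s n x\<bar> * norm v" by (simp add: scaleR_diff_left[symmetric])
        also have "\<dots> \<le> (e / K) * 1" using n[of x] v by (intro mult_mono) (auto simp: dist_real_def)
        finally show "norm (apply_bcontfun (Bcontfun (\<lambda>x. g x *\<^sub>R v) - Bcontfun (\<lambda>x. s n x *\<^sub>R v)) x) \<le> e / K"
          by (simp add: Bcontfun_inverse b lc(3))
      qed
      then have 1: "\<bar>L (Bcontfun (\<lambda>x. g x *\<^sub>R v)) - L (Bcontfun (\<lambda>x. s n x *\<^sub>R v))\<bar> \<le> e / K"
        using bound[of "Bcontfun (\<lambda>x. g x *\<^sub>R v) - Bcontfun (\<lambda>x. s n x *\<^sub>R v)"] by (simp add: linear_diff[OF lin])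
      have "\<bar>\<integral>x. g x - s n x \<partial>W v\<bar> \<le> (\<integral>x. e / K \<partial>W v)"
        using gWi lc(2)[of n] n by (intro order_trans[OF integral_abs_bound integral_mono]) (auto simp: dist_real_def abs_minus_commute less_imp_le)
      then have 2: "\<bar>(\<integral>x. g x \<partial>W v) - (\<integral>x. s n x \<partial>W v)\<bar> \<le> e / K * measure (W v) UNIV"
        using gWi lc(2)[of n] v by (simp add: W mult.commute)
      have "\<bar>\<integral>x. g x - s n x \<partial>V\<bar> \<le> (\<integral>x. e / K \<partial>V)"
        using gVi lc(1)[of n] n by (intro order_trans[OF integral_abs_bound integral_mono]) (auto simp: dist_real_def abs_minus_commute less_imp_le)
      then have 3: "\<bar>(\<integral>x. g x \<partial>V) - (\<integral>x. s n x \<partial>V)\<bar> \<le> e / K * measure V UNIV"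
        using gVi lc(1)[of n] by (simp add: V mult.commute)
      have "e / K + e / K * measure (W v) UNIV + e / K * measure V UNIV = e / K * (1 + measure (W v) UNIV + measure V UNIV)"
        by (simp add: distrib_left)
      also have "\<dots> = e / K * K" by (simp only: K_def)
      also have "\<dots> = e" using K by simp
      finally show ?thesis using 1 2 3 lc(4)[of n] by linarith
    qed
    have "\<bar>L (Bcontfun (\<lambda>x. g x *\<^sub>R v)) - ((\<integral>x. g x \<partial>W v) - (\<integral>x. g x \<partial>V))\<bar> \<le> 0"
      by (rule dense_ge) (rule le)
    then show ?thesis by simp
  qed
qed

end

section \<open>A Riesz representation for vector fields\<close>

text \<open>The coordinate along b has the binary digits \<open>x (b, 0)\<close>,
  \<open>x (b, 1)\<close> and so on, rescaled from the unit interval to the interval from -R to R.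
  Indexing by all pairs keeps the Cantor space a plain function type; entries at vectors outside the
  basis have no influence.\<close>

definition cantor_map :: "real \<Rightarrow> ('a::euclidean_space \<times> nat \<Rightarrow> bool) \<Rightarrow> 'a" where
  "cantor_map R x = (\<Sum>b\<in>Basis. (- R + 2 * R * (\<Sum>k. of_bool (x (b, k)) / 2 ^ Suc k)) *\<^sub>R b)"

text \<open>Entries outside the basis are cleared too, so that only finitely many values remain
  possible.\<close>

definition truncate :: "nat \<Rightarrow> ('a::euclidean_space \<times> nat \<Rightarrow> bool) \<Rightarrow> 'a \<times> nat \<Rightarrow> bool" where
  "truncate n x = (\<lambda>(b, k). b \<in> Basis \<and> k < n \<and> x (b, k))"

section \<open>The Cantor space: compactness, clopen sets and the surjection onto a cube\<close>

lemma compact_bool_functions: "compact (UNIV :: ('i \<Rightarrow> bool) set)"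
proof -
  have "compact_space (euclidean :: bool topology)"
    by (simp add: compact_space_def finite_imp_compact)
  then have "compact_space (product_topology (\<lambda>i :: 'i. euclidean :: bool topology) UNIV)"
    by (simp add: compact_space_product_topology)
  then show ?thesis by (simp add: euclidean_product_topology compact_space_def)
qed

lemma clopen_coordinate: "clopen {x :: 'i \<Rightarrow> bool. x i = c}"
proof -
  have "open ((\<lambda>x :: 'i \<Rightarrow> bool. x i) -` {c})" "closed ((\<lambda>x :: 'i \<Rightarrow> bool. x i) -` {c})"
    by (auto intro!: open_vimage closed_vimage open_discrete)
  then show ?thesis by (simp add: clopen_def vimage_def)
qed

lemma summable_binary: "summable (\<lambda>k. of_bool (P k) / 2 ^ Suc k :: real)"
  by (rule summable_comparison_test'[OF sums_summable[OF power_half_series], of 0])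
    (auto simp: power_one_over)

text \<open>The digits from position n on contribute at most the geometric tail, which sums to
  (1/2)^n.\<close>

lemma binary_tail_bound:
  "\<bar>(\<Sum>k. of_bool (P k) / 2 ^ Suc k) - (\<Sum>k. of_bool (k < n \<and> P k) / 2 ^ Suc k)\<bar> \<le> (1/2 :: real) ^ n"
proof -
  have s: "(\<lambda>k. (1/2 :: real) ^ n * (1 / 2 ^ Suc k)) sums ((1/2) ^ n * 1)"
    using sums_mult[OF power_half_series, of "(1/2 :: real) ^ n"] by (simp add: power_one_over)
  have "(\<Sum>k. of_bool (P k) / 2 ^ Suc k) - (\<Sum>k. of_bool (k < n \<and> P k) / 2 ^ Suc k :: real)
     = (\<Sum>k. of_bool (P k) / 2 ^ Suc k - of_bool (k < n \<and> P k) / 2 ^ Suc k)"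
    by (rule suminf_diff) (rule summable_binary)+
  also have "\<dots> = (\<Sum>k. of_bool (k \<ge> n \<and> P k) / 2 ^ Suc k)"
    by (intro suminf_cong) auto
  also have "\<dots> = (\<Sum>k. of_bool (k + n \<ge> n \<and> P (k + n)) / 2 ^ Suc (k + n)) + (\<Sum>k<n. of_bool (k \<ge> n \<and> P k) / 2 ^ Suc k)"
    by (rule suminf_split_initial_segment) (rule summable_binary)
  also have "(\<Sum>k<n. of_bool (k \<ge> n \<and> P k) / 2 ^ Suc k :: real) = 0" by simp
  finally have eq: "(\<Sum>k. of_bool (P k) / 2 ^ Suc k) - (\<Sum>k. of_bool (k < n \<and> P k) / 2 ^ Suc k :: real)
    = (\<Sum>k. of_bool (k + n \<ge> n \<and> P (k + n)) / 2 ^ Suc (k + n))" by simp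
  have sm: "summable (\<lambda>k. of_bool (k + n \<ge> n \<and> P (k + n)) / 2 ^ Suc (k + n) :: real)"
    using summable_ignore_initial_segment[OF summable_binary[of P], of n] by simp
  have "(\<Sum>k. of_bool (k + n \<ge> n \<and> P (k + n)) / 2 ^ Suc (k + n)) \<le> (\<Sum>k. (1/2 :: real) ^ n * (1 / 2 ^ Suc k))"
    by (intro suminf_le sm sums_summable[OF s]) (auto simp: power_add power_one_over mult_ac)
  also have "\<dots> = (1/2) ^ n" using sums_unique[OF s] by simp
  finally have "(\<Sum>k. of_bool (k + n \<ge> n \<and> P (k + n)) / 2 ^ Suc (k + n)) \<le> (1/2 :: real) ^ n" .
  moreover have "0 \<le> (\<Sum>k. of_bool (k + n \<ge> n \<and> P (k + n)) / 2 ^ Suc (k + n) :: real)"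
    by (intro suminf_nonneg sm) auto
  ultimately show ?thesis unfolding eq by simp
qed

lemma cantor_map_component:
  "b \<in> Basis \<Longrightarrow> cantor_map R x \<bullet> b = - R + 2 * R * (\<Sum>k. of_bool (x (b, k)) / 2 ^ Suc k)"
  unfolding cantor_map_def by simp

lemma cantor_map_truncate:
  fixes x :: "'a::euclidean_space \<times> nat \<Rightarrow> bool"
  assumes "R \<ge> 0"
  shows "dist (cantor_map R (truncate n x)) (cantor_map R x) \<le> DIM('a) * (2 * R * (1/2) ^ n)"
proof -
  have "\<bar>(cantor_map R (truncate n x) - cantor_map R x) \<bullet> b\<bar> \<le> 2 * R * (1/2) ^ n" if b: "b \<in> Basis" for b
  proof -
    have "(cantor_map R (truncate n x) - cantor_map R x) \<bullet> b
      = 2 * R * ((\<Sum>k. of_bool (k < n \<and> x (b, k)) / 2 ^ Suc k) - (\<Sum>k. of_bool (x (b, k)) / 2 ^ Suc k))"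
      using b by (simp add: inner_diff_left cantor_map_component truncate_def right_diff_distrib)
    also have "\<bar>\<dots>\<bar> = 2 * R * \<bar>(\<Sum>k. of_bool (x (b, k)) / 2 ^ Suc k) - (\<Sum>k. of_bool (k < n \<and> x (b, k)) / 2 ^ Suc k)\<bar>"
      using assms by (simp add: abs_mult abs_minus_commute)
    also have "\<dots> \<le> 2 * R * (1/2) ^ n"
      using assms by (intro mult_left_mono binary_tail_bound) auto
    finally show ?thesis .
  qed
  then have "norm (cantor_map R (truncate n x) - cantor_map R x) \<le> (\<Sum>b\<in>(Basis :: 'a set). 2 * R * (1/2) ^ n)"
    by (intro order_trans[OF norm_le_l1] sum_mono)
  then show ?thesis by (simp add: dist_norm)
qed

lemma uniform_limit_cantor_truncate:
  assumes "R \<ge> 0"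
  shows "uniform_limit UNIV (\<lambda>n x. cantor_map R (truncate n x)) (cantor_map R :: _ \<Rightarrow> 'a::euclidean_space) sequentially"
proof (rule uniform_limitI)
  fix e :: real assume "e > 0"
  have "(\<lambda>n. DIM('a) * (2 * R * (1/2) ^ n)) \<longlonglongrightarrow> DIM('a) * (2 * R * 0)"
    by (intro tendsto_intros LIMSEQ_realpow_zero) auto
  then have "eventually (\<lambda>n. DIM('a) * (2 * R * (1/2) ^ n) < e) sequentially"
    by (rule order_tendstoD(2)) (use \<open>e > 0\<close> in simp)
  then show "\<forall>\<^sub>F n in sequentially. \<forall>x\<in>UNIV. dist (cantor_map R (truncate n x)) (cantor_map R x :: 'a) < e"
    by eventually_elim (use cantor_map_truncate[OF assms] in \<open>fastforce intro: le_less_trans\<close>)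
qed

lemma finite_range_truncate: "finite (range (truncate n :: ('a::euclidean_space \<times> nat \<Rightarrow> bool) \<Rightarrow> _))"
proof (rule finite_subset)
  show "range (truncate n :: ('a \<times> nat \<Rightarrow> bool) \<Rightarrow> _) \<subseteq> (\<lambda>S p. p \<in> S) ` Pow (Basis \<times> {..<n})"
  proof
    fix y :: "'a \<times> nat \<Rightarrow> bool" assume "y \<in> range (truncate n)"
    then obtain x where "y = truncate n x" by blast
    then have "y = (\<lambda>p. p \<in> {p. y p})" "{p. y p} \<subseteq> Basis \<times> {..<n}" by (auto simp: truncate_def)
    then show "y \<in> (\<lambda>S p. p \<in> S) ` Pow (Basis \<times> {..<n})" by blast
  qed
qed simp

text \<open>Fixing finitely many digits is a clopen condition, and a truncation takes finitely many
  values, so an arbitrary \<open>S\<close> is allowed. Hence every function of the truncation is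
  locally constant, which supplies continuity, measurability and the approximants of
  integrands.\<close>

lemma clopen_truncate: "clopen {x. truncate n x \<in> S}"
proof -
  have eq1: "{x. truncate n x = truncate n z} = (\<Inter>p\<in>Basis \<times> {..<n}. {x. x p = z p})" for z :: "'a \<times> nat \<Rightarrow> bool"
    by (auto simp: truncate_def fun_eq_iff)
  have "clopen {x. truncate n x = truncate n z}" for z :: "'a \<times> nat \<Rightarrow> bool"
    unfolding eq1 by (intro clopen_INT clopen_coordinate) auto
  then have "clopen (\<Union>y\<in>range (truncate n) \<inter> S. {x :: 'a \<times> nat \<Rightarrow> bool. truncate n x = y})"
    using finite_range_truncate by (intro clopen_UN) auto
  moreover have "(\<Union>y\<in>range (truncate n) \<inter> S. {x :: 'a \<times> nat \<Rightarrow> bool. truncate n x = y}) = {x. truncate n x \<in> S}"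
    by auto
  ultimately show ?thesis by simp
qed

lemma continuous_cantor_map:
  assumes "R \<ge> 0" shows "continuous_on UNIV (cantor_map R :: _ \<Rightarrow> 'a::euclidean_space)"
proof (rule uniform_limit_theorem[OF _ uniform_limit_cantor_truncate[OF assms]])
  have "open ((\<lambda>x. cantor_map R (truncate n x) :: 'a) -` U)" for n U
    using clopen_truncate[of n "{y. (cantor_map R y :: 'a) \<in> U}"] by (simp add: clopen_def vimage_def)
  then show "\<forall>\<^sub>F n in sequentially. continuous_on UNIV (\<lambda>x. cantor_map R (truncate n x) :: 'a)"
    by (intro always_eventually allI) (simp add: continuous_on_open_vimage)
qed simp

lemma binary_expansion:
  fixes t :: real
  assumes "0 \<le> t" "t < 1"
  shows "\<exists>P. t = (\<Sum>k. of_bool (P k) / 2 ^ Suc k)"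
proof
  \<comment> \<open>Digit k is 1 precisely if doubling changes the floor by more than a factor 2.
    The partial sums then telescope to the floor of 2^n t divided by 2^n, using that t < 1 has floor
    0.\<close>
  let ?P = "\<lambda>k. \<lfloor>2 ^ Suc k * t\<rfloor> \<noteq> 2 * \<lfloor>2 ^ k * t\<rfloor>"
  have double: "\<lfloor>2 * z\<rfloor> = 2 * \<lfloor>z\<rfloor> \<or> \<lfloor>2 * z\<rfloor> = 2 * \<lfloor>z\<rfloor> + 1" for z :: real by linarith
  have bit: "of_bool (?P k) = real_of_int \<lfloor>2 ^ Suc k * t\<rfloor> - 2 * real_of_int \<lfloor>2 ^ k * t\<rfloor>" for k
  proof -
    have "\<lfloor>2 ^ Suc k * t\<rfloor> = 2 * \<lfloor>2 ^ k * t\<rfloor> \<or> \<lfloor>2 ^ Suc k * t\<rfloor> = 2 * \<lfloor>2 ^ k * t\<rfloor> + 1"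
      using double[of "2 ^ k * t"] by (simp add: mult.assoc)
    then show ?thesis by auto
  qed
  have partial: "(\<Sum>k<n. of_bool (?P k) / 2 ^ Suc k) = \<lfloor>2 ^ n * t\<rfloor> / 2 ^ n" for n
  proof (induction n)
    case 0
    have "\<lfloor>t\<rfloor> = 0" using assms by linarith
    then show ?case by simp
  next
    case (Suc n)
    have "(\<Sum>k<Suc n. of_bool (?P k) / 2 ^ Suc k) = \<lfloor>2 ^ n * t\<rfloor> / 2 ^ n + of_bool (?P n) / 2 ^ Suc n"
      by (simp only: sum.lessThan_Suc Suc.IH)
    also have "\<dots> = \<lfloor>2 ^ Suc n * t\<rfloor> / 2 ^ Suc n" unfolding bit by (simp add: field_simps)
    finally show ?case .
  qed
  have "(\<lambda>n. \<lfloor>2 ^ n * t\<rfloor> / 2 ^ n) \<longlonglongrightarrow> t"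
  proof (rule tendsto_sandwich)
    show "\<forall>\<^sub>F n in sequentially. t - (1/2) ^ n \<le> \<lfloor>2 ^ n * t\<rfloor> / 2 ^ n"
    proof (intro always_eventually allI)
      fix n
      have "(2 ^ n * t - 1) / 2 ^ n \<le> \<lfloor>2 ^ n * t\<rfloor> / 2 ^ n" by (intro divide_right_mono) (linarith, simp)
      then show "t - (1/2) ^ n \<le> \<lfloor>2 ^ n * t\<rfloor> / 2 ^ n" by (simp add: diff_divide_distrib power_one_over)
    qed
    show "\<forall>\<^sub>F n in sequentially. \<lfloor>2 ^ n * t\<rfloor> / 2 ^ n \<le> t"
    proof (intro always_eventually allI)
      fix n
      have "\<lfloor>2 ^ n * t\<rfloor> \<le> 2 ^ n * t" by linarith
      then show "\<lfloor>2 ^ n * t\<rfloor> / 2 ^ n \<le> t" by (simp add: field_simps)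
    qed
    have "(\<lambda>n. t - (1/2) ^ n) \<longlonglongrightarrow> t - 0" by (intro tendsto_intros LIMSEQ_realpow_zero) auto
    then show "(\<lambda>n. t - (1/2) ^ n) \<longlonglongrightarrow> t" by simp
  qed auto
  then have "(\<lambda>k. of_bool (?P k) / 2 ^ Suc k) sums t" unfolding sums_def partial .
  then show "t = (\<Sum>k. of_bool (?P k) / 2 ^ Suc k)" by (rule sums_unique)
qed

lemma cantor_map_surj:
  fixes y :: "'a::euclidean_space"
  assumes "norm y < R"
  shows "\<exists>x. cantor_map R x = y"
proof -
  have R: "R > 0" using assms norm_ge_zero[of y] by linarith
  \<comment> \<open>Rescaling a coordinate to the unit interval gives a value strictly below 1
    because the norm of y is strictly below R, as the binary expansion requires.\<close>
  have "\<exists>P. (y \<bullet> b + R) / (2 * R) = (\<Sum>k. of_bool (P k) / 2 ^ Suc k)" if "b \<in> Basis" for b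
  proof (rule binary_expansion)
    have "\<bar>y \<bullet> b\<bar> < R" using Basis_le_norm[OF that, of y] assms by linarith
    then show "0 \<le> (y \<bullet> b + R) / (2 * R)" "(y \<bullet> b + R) / (2 * R) < 1" using R by (auto simp: field_simps)
  qed
  then obtain P where P: "\<And>b. b \<in> Basis \<Longrightarrow> (y \<bullet> b + R) / (2 * R) = (\<Sum>k. of_bool (P b k) / 2 ^ Suc k)" by metis
  have "cantor_map R (\<lambda>(b, k). P b k) = y"
  proof (rule euclidean_eqI)
    fix b :: 'a assume b: "b \<in> Basis"
    have "cantor_map R (\<lambda>(b, k). P b k) \<bullet> b = - R + 2 * R * ((y \<bullet> b + R) / (2 * R))"
      unfolding cantor_map_component[OF b] P[OF b] by (simp only: prod.case)
    then show "cantor_map R (\<lambda>(b, k). P b k) \<bullet> b = y \<bullet> b" using R by simp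
  qed
  then show ?thesis by blast
qed


text \<open>The functional is given by its graph \<open>G\<close>; its well-definedness on fields
  follows from the bound by the supremum norm. The vector measure is delivered with components
  \<open>\<mu> i\<close> minus \<open>\<nu>\<close>, all nonnegative and finite, where
  \<open>\<nu>\<close> also dominates its variation and has mass at most 1.\<close>

lemma vector_riesz_representation:
  fixes G :: "(('a::euclidean_space \<Rightarrow> 'a) \<times> real) set"
  assumes \<Omega>: "bounded \<Omega>"
    and cont: "\<And>F a. (F, a) \<in> G \<Longrightarrow> continuous_on UNIV F"
    and supp: "\<And>F a x. (F, a) \<in> G \<Longrightarrow> x \<notin> \<Omega> \<Longrightarrow> F x = 0"
    and zero: "((\<lambda>x. 0), 0) \<in> G"
    and add: "\<And>F a F' a'. (F, a) \<in> G \<Longrightarrow> (F', a') \<in> G \<Longrightarrow> ((\<lambda>x. F x + F' x), a + a') \<in> G"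
    and scale: "\<And>F a c. (F, a) \<in> G \<Longrightarrow> ((\<lambda>x. c *\<^sub>R F x), c * a) \<in> G"
    and le: "\<And>F a B. (F, a) \<in> G \<Longrightarrow> (\<And>x. norm (F x) \<le> B) \<Longrightarrow> a \<le> B"
  shows "\<exists>(\<nu> :: 'a measure) (\<mu> :: 'a \<Rightarrow> 'a measure). sets \<nu> = sets borel \<and> (\<forall>i\<in>Basis. sets (\<mu> i) = sets borel) \<and>
    finite_measure \<nu> \<and> (\<forall>i\<in>Basis. finite_measure (\<mu> i)) \<and> measure \<nu> UNIV \<le> 1 \<and>
    (\<forall>A\<in>sets borel. norm (\<Sum>i\<in>Basis. (measure (\<mu> i) A - measure \<nu> A) *\<^sub>R i) \<le> measure \<nu> A) \<and>
    (\<forall>F a. (F, a) \<in> G \<longrightarrow> a = (\<Sum>i\<in>Basis. (\<integral>x. F x \<bullet> i \<partial>\<mu> i) - (\<integral>x. F x \<bullet> i \<partial>\<nu>)))"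
proof -
  obtain R where R: "R > 0" "\<And>x. x \<in> \<Omega> \<Longrightarrow> norm x < R"
    using bounded_pos_less[of \<Omega>] \<Omega> by metis
  let ?c = "cantor_map R :: ('a \<times> nat \<Rightarrow> bool) \<Rightarrow> 'a"
  have cc: "continuous_on UNIV ?c" using R(1) by (intro continuous_cantor_map) simp
  have bc: "(\<lambda>x. F (?c x)) \<in> bcontfun" if F: "(F, a) \<in> G" for F a
  proof -
    obtain M where "\<And>x. norm (F x) \<le> M" using bounded_range_vanish[OF cont[OF F] \<Omega> supp[OF F]] by blast
    moreover have "continuous_on UNIV (\<lambda>x. F (?c x))"
      by (rule continuous_on_compose2[OF cont[OF F] cc]) auto
    ultimately show ?thesis by (intro bcontfun_normI)
  qed
  define G' where "G' = (\<lambda>(F, a). (Bcontfun (\<lambda>x. F (?c x)), a)) ` G"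
  have G'I: "(H, a) \<in> G'" if "(F, a) \<in> G" "\<And>x. apply_bcontfun H x = F (?c x)" for H F a
  proof -
    have "H = Bcontfun (\<lambda>x. F (?c x))" by (rule bcontfun_eqI) (simp add: that(2) Bcontfun_inverse[OF bc[OF that(1)]])
    then show ?thesis unfolding G'_def using that(1) by (force simp: image_iff)
  qed
  have G'E: "\<exists>F. (F, a) \<in> G \<and> (\<forall>x. apply_bcontfun H x = F (?c x))" if "(H, a) \<in> G'" for H a
    using that unfolding G'_def by (auto simp: Bcontfun_inverse[OF bc])
  have "subspace G'"
  proof (rule subspaceI)
    show "0 \<in> G'" unfolding zero_prod_def by (rule G'I[OF zero]) simp
  next
    fix u v assume u: "u \<in> G'" and v: "v \<in> G'"
    obtain H a H' a' where uv: "u = (H, a)" "v = (H', a')" by (cases u, cases v) blast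
    obtain F F' where "(F, a) \<in> G" "\<forall>x. apply_bcontfun H x = F (?c x)" "(F', a') \<in> G" "\<forall>x. apply_bcontfun H' x = F' (?c x)"
      using G'E u v unfolding uv by metis
    then show "u + v \<in> G'" unfolding uv add_Pair by (intro G'I[OF add]) auto
  next
    fix c u assume u: "u \<in> G'"
    obtain H a where uv: "u = (H, a)" by (cases u) blast
    obtain F where "(F, a) \<in> G" "\<forall>x. apply_bcontfun H x = F (?c x)" using G'E u unfolding uv by metis
    then show "c *\<^sub>R u \<in> G'" unfolding uv scaleR_Pair by (intro G'I[of "\<lambda>x. c *\<^sub>R F x"]) (auto simp: scale)
  qed
  moreover have "a \<le> norm H" if H: "(H, a) \<in> G'" for H a
  proof -
    obtain F where F: "(F, a) \<in> G" "\<forall>x. apply_bcontfun H x = F (?c x)" using G'E[OF H] by blast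
    show ?thesis
    proof (rule le[OF F(1)])
      fix y
      \<comment> \<open>Every point of \<Omega> is an image of the Cantor map, and F vanishes
        elsewhere, so the pullback has a supremum norm that bounds F. This transfers the norm bound
        to the Cantor space.\<close>
      show "norm (F y) \<le> norm H"
      proof (cases "y \<in> \<Omega>")
        case True
        then obtain x where "?c x = y" using cantor_map_surj R(2) by blast
        then show ?thesis using norm_bounded[of H x] F(2) by simp
      qed (simp add: supp[OF F(1)])
    qed
  qed
  ultimately obtain L where L: "linear L" "\<And>x. \<bar>L x\<bar> \<le> norm x" "\<And>x a. (x, a) \<in> G' \<Longrightarrow> L x = a"
    using Hahn_Banach_graph by blast
  interpret clopen_functional L by (intro clopen_functional.intro compact_bool_functions L(1,2))
  \<comment> \<open>The measures are defined on the sigma-algebra generated by the clopen sets;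
    measurability comes from the locally constant truncations, whose pointwise limit is the Cantor
    map.\<close>
  have cm: "?c \<in> measurable M borel" if M: "sets M = sigma_sets UNIV E" "space M = UNIV" for M
  proof (rule borel_measurable_LIMSEQ_metric)
    show "(\<lambda>x. ?c (truncate n x)) \<in> borel_measurable M" for n
    proof (rule measurableI)
      fix A :: "'a set"
      have "clopen {x. truncate n x \<in> {y. ?c y \<in> A}}" by (rule clopen_truncate)
      then show "(\<lambda>x. ?c (truncate n x)) -` A \<inter> space M \<in> sets M" by (simp add: M vimage_def)
    qed simp
    show "(\<lambda>n. ?c (truncate n x)) \<longlonglongrightarrow> ?c x" for x
      by (rule tendsto_uniform_limitI[OF uniform_limit_cantor_truncate]) (use R in auto)
  qed
  have cV: "?c \<in> measurable V borel" by (rule cm) (auto simp: V)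
  have cW: "?c \<in> measurable (W i) borel" if "i \<in> Basis" for i by (rule cm) (use that in \<open>auto simp: W\<close>)
  define \<nu> where "\<nu> = distr V borel ?c"
  define \<mu> where "\<mu> i = distr (W i) borel ?c" for i
  show ?thesis
  proof (intro exI[of _ \<nu>] exI[of _ \<mu>] conjI ballI allI impI)
    show "sets \<nu> = sets borel" "sets (\<mu> i) = sets borel" for i by (auto simp: \<nu>_def \<mu>_def)
    show "finite_measure \<nu>" unfolding \<nu>_def by (rule finite_measure.finite_measure_distr[OF finite_V cV])
    show "finite_measure (\<mu> i)" if "i \<in> Basis" for i unfolding \<mu>_def
      by (rule finite_measure.finite_measure_distr[OF finite_W cW[OF that]]) (use that in simp)
    show "measure \<nu> UNIV \<le> 1"
      using cV by (simp add: \<nu>_def measure_distr V measure_V clopen_intros variation_le_1)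
    show "norm (\<Sum>i\<in>Basis. (measure (\<mu> i) A - measure \<nu> A) *\<^sub>R i) \<le> measure \<nu> A" if A: "A \<in> sets borel" for A
    proof -
      have "?c -` A \<in> sigma_sets UNIV E" using measurable_sets[OF cV A] by (simp add: V)
      then have "norm (Q (?c -` A)) \<le> measure V (?c -` A)" by (rule norm_Q_le)
      moreover have "measure \<nu> A = measure V (?c -` A)" unfolding \<nu>_def using A cV by (simp add: measure_distr V)
      moreover have "measure (\<mu> i) A = measure (W i) (?c -` A)" if "i \<in> Basis" for i
        unfolding \<mu>_def using A cW that by (simp add: measure_distr W)
      ultimately show ?thesis by (simp add: Q_def)
    qed
    fix F a assume F: "(F, a) \<in> G"
    have ucF: "uniformly_continuous_on UNIV F" by (rule uniformly_continuous_vanish[OF cont[OF F] \<Omega> supp[OF F]])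
    have Fm: "F \<in> borel_measurable borel" by (rule continuous_borel_measurable[OF cont[OF F]])
    have ch: "(\<lambda>x. (F (?c x) \<bullet> i) *\<^sub>R i) \<in> bcontfun"
       "L (Bcontfun (\<lambda>x. (F (?c x) \<bullet> i) *\<^sub>R i)) = (\<integral>x. F (?c x) \<bullet> i \<partial>W i) - (\<integral>x. F (?c x) \<bullet> i \<partial>V)" if i: "i \<in> Basis" for i
    proof -
      have 1: "locally_constant (\<lambda>x. F (?c (truncate n x)) \<bullet> i)" for n
        unfolding locally_constant_def
      proof (intro conjI allI)
        have "range (\<lambda>x. F (?c (truncate n x)) \<bullet> i) = (\<lambda>y. F (?c y) \<bullet> i) ` range (truncate n)" by auto
        then show "finite (range (\<lambda>x. F (?c (truncate n x)) \<bullet> i))" by (simp add: finite_range_truncate)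
        show "clopen ((\<lambda>x. F (?c (truncate n x)) \<bullet> i) -` {y})" for y
          using clopen_truncate[of n "{z. F (?c z) \<bullet> i = y}"] by (simp add: vimage_def)
      qed
      have 2: "continuous_on UNIV (\<lambda>x. F (?c x) \<bullet> i)"
        by (intro continuous_on_inner continuous_on_const continuous_on_compose2[OF cont[OF F] cc]) auto
      have 3: "uniform_limit UNIV (\<lambda>n x. F (?c (truncate n x)) \<bullet> i) (\<lambda>x. F (?c x) \<bullet> i) sequentially"
      proof (rule uniform_limitI)
        fix e :: real assume "e > 0"
        with ucF obtain d where d: "d > 0" "\<And>x y. dist y x < d \<Longrightarrow> dist (F y) (F x) < e"
          unfolding uniformly_continuous_on_def by (metis UNIV_I)
        have "\<forall>\<^sub>F n in sequentially. \<forall>x\<in>UNIV. dist (?c (truncate n x)) (?c x) < d"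
          by (rule uniform_limitD[OF uniform_limit_cantor_truncate d(1)]) (use R in simp)
        then show "\<forall>\<^sub>F n in sequentially. \<forall>x\<in>UNIV. dist (F (?c (truncate n x)) \<bullet> i) (F (?c x) \<bullet> i) < e"
        proof eventually_elim
          case (elim n)
          show ?case
          proof
            fix x
            have "dist (F (?c (truncate n x)) \<bullet> i) (F (?c x) \<bullet> i) \<le> dist (F (?c (truncate n x))) (F (?c x))"
              using Basis_le_norm[OF i, of "F (?c (truncate n x)) - F (?c x)"] by (simp add: dist_norm inner_diff_left)
            also have "\<dots> < e" using elim d(2) by blast
            finally show "dist (F (?c (truncate n x)) \<bullet> i) (F (?c x) \<bullet> i) < e" .
          qed
        qed
      qed
      show "(\<lambda>x. (F (?c x) \<bullet> i) *\<^sub>R i) \<in> bcontfun"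
       "L (Bcontfun (\<lambda>x. (F (?c x) \<bullet> i) *\<^sub>R i)) = (\<integral>x. F (?c x) \<bullet> i \<partial>W i) - (\<integral>x. F (?c x) \<bullet> i \<partial>V)"
        using charge_integral(3,4)[OF 1 2 3, of i] i by simp_all
    qed
    have "Bcontfun (\<lambda>x. F (?c x)) = (\<Sum>i\<in>Basis. Bcontfun (\<lambda>x. (F (?c x) \<bullet> i) *\<^sub>R i))"
    proof (rule bcontfun_eqI)
      fix x
      have ap: "apply_bcontfun (\<Sum>y\<in>I. g y) x = (\<Sum>y\<in>I. apply_bcontfun (g y) x)" for g :: "'a \<Rightarrow> ('a \<times> nat \<Rightarrow> bool) \<Rightarrow>\<^sub>C 'a" and I
        by (induction I rule: infinite_finite_induct) auto
      show "apply_bcontfun (Bcontfun (\<lambda>x. F (?c x))) x = apply_bcontfun (\<Sum>i\<in>Basis. Bcontfun (\<lambda>x. (F (?c x) \<bullet> i) *\<^sub>R i)) x"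
        unfolding ap by (simp add: Bcontfun_inverse bc[OF F] ch(1) euclidean_representation)
    qed
    moreover have "L (Bcontfun (\<lambda>x. F (?c x))) = a"
      by (rule L(3)[OF G'I[OF F]]) (simp add: Bcontfun_inverse[OF bc[OF F]])
    ultimately have "a = (\<Sum>i\<in>Basis. (\<integral>x. F (?c x) \<bullet> i \<partial>W i) - (\<integral>x. F (?c x) \<bullet> i \<partial>V))"
      by (simp add: linear_sum[OF L(1)] ch(2))
    also have "\<dots> = (\<Sum>i\<in>Basis. (\<integral>x. F x \<bullet> i \<partial>\<mu> i) - (\<integral>x. F x \<bullet> i \<partial>\<nu>))"
      unfolding \<mu>_def \<nu>_def using cV cW Fm by (intro sum.cong refl) (simp add: integral_distr)
    finally show "a = (\<Sum>i\<in>Basis. (\<integral>x. F x \<bullet> i \<partial>\<mu> i) - (\<integral>x. F x \<bullet> i \<partial>\<nu>))" .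
  qed
qed

section \<open>Jordan decomposition and total variation\<close>

lemma borel_sets_on_iff: "open \<Omega> \<Longrightarrow> A \<in> borel_sets_on \<Omega> \<longleftrightarrow> A \<subseteq> \<Omega> \<and> A \<in> sets borel"
  by (subst sets_restrict_space_iff) auto

text \<open>Boundedness is carried along so that the suprema defining the Jordan parts are real
  numbers.\<close>

definition signed_measure_on :: "'a::euclidean_space set \<Rightarrow> ('a set \<Rightarrow> real) \<Rightarrow> bool" where
  "signed_measure_on \<Omega> \<nu> \<longleftrightarrow> (\<forall>A::nat \<Rightarrow> 'a set. range A \<subseteq> borel_sets_on \<Omega> \<and> disjoint_family A
     \<longrightarrow> (\<lambda>i. \<nu> (A i)) sums \<nu> (\<Union>i. A i)) \<and> (\<exists>K. \<forall>A\<in>borel_sets_on \<Omega>. \<bar>\<nu> A\<bar> \<le> K)"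

section \<open>The positive variation and the Jordan decomposition of a signed measure\<close>

lemma signed_measure_on_uminus: "signed_measure_on \<Omega> \<nu> \<Longrightarrow> signed_measure_on \<Omega> (\<lambda>A. - \<nu> A)"
  unfolding signed_measure_on_def by (auto intro: sums_minus)

context
  fixes \<Omega> :: "'a::euclidean_space set" and \<nu> :: "'a set \<Rightarrow> real"
  assumes \<Omega>: "open \<Omega>" and \<nu>: "signed_measure_on \<Omega> \<nu>"
begin

interpretation B: sigma_algebra \<Omega> "borel_sets_on \<Omega>"
  using sets.sigma_algebra_axioms[of "restrict_space borel \<Omega>"] by (simp add: space_restrict_space)

lemma signed_sums:
  "range A \<subseteq> borel_sets_on \<Omega> \<Longrightarrow> disjoint_family A \<Longrightarrow> (\<lambda>i. \<nu> (A i)) sums \<nu> (\<Union>i::nat. A i)"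
  using \<nu> by (simp add: signed_measure_on_def)

lemma signed_empty: "\<nu> {} = 0"
proof -
  have "(\<lambda>i::nat. \<nu> {}) sums \<nu> {}"
    using signed_sums[of "\<lambda>i. {}"] by (simp add: disjoint_family_on_def)
  then show ?thesis by (simp add: sums_iff summable_const_iff)
qed

lemma signed_Un:
  assumes "A \<in> borel_sets_on \<Omega>" "C \<in> borel_sets_on \<Omega>" "A \<inter> C = {}"
  shows "\<nu> (A \<union> C) = \<nu> A + \<nu> C"
proof -
  have "(\<lambda>i. \<nu> (binaryset A C i)) sums \<nu> (A \<union> C)"
  proof -
    have "disjoint_family (binaryset A C)" using assms(3) by (auto simp: disjoint_family_on_def binaryset_def)
    moreover have "range (binaryset A C) \<subseteq> borel_sets_on \<Omega>" using assms by (auto simp: range_binaryset_eq)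
    ultimately show ?thesis using signed_sums[of "binaryset A C"] by (simp add: UN_binaryset_eq)
  qed
  moreover have "(\<lambda>i. \<nu> (binaryset A C i)) sums (\<nu> A + \<nu> C)" by (rule binaryset_sums[of \<nu>]) (rule signed_empty)
  ultimately show ?thesis by (rule sums_unique2)
qed

text \<open>The positive variation, as a real-valued counterpart of the supremum inside
  \<open>jordan_pos\<close>.\<close>

definition upper :: "'a set \<Rightarrow> real" where
  "upper A = (SUP C\<in>{C \<in> borel_sets_on \<Omega>. C \<subseteq> A}. \<nu> C)"

lemma upper_ge: "C \<in> borel_sets_on \<Omega> \<Longrightarrow> C \<subseteq> A \<Longrightarrow> \<nu> C \<le> upper A"
  unfolding upper_def
proof (rule cSUP_upper)
  obtain K where "\<forall>A\<in>borel_sets_on \<Omega>. \<bar>\<nu> A\<bar> \<le> K" using \<nu> by (auto simp: signed_measure_on_def)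
  then have "\<forall>A\<in>borel_sets_on \<Omega>. \<nu> A \<le> K" by (auto dest: abs_le_D1)
  then show "bdd_above (\<nu> ` {C \<in> borel_sets_on \<Omega>. C \<subseteq> A})" by (auto simp: bdd_above_def)
qed simp

lemma upper_least: "(\<And>C. C \<in> borel_sets_on \<Omega> \<Longrightarrow> C \<subseteq> A \<Longrightarrow> \<nu> C \<le> c) \<Longrightarrow> upper A \<le> c"
  unfolding upper_def by (rule cSUP_least) (auto intro: exI[of _ "{}"])

lemma upper_nonneg: "upper A \<ge> 0"
  using upper_ge[of "{}" A] signed_empty by simp

lemma upper_mono: "A \<subseteq> A' \<Longrightarrow> upper A \<le> upper A'"
  by (rule upper_least) (auto intro: upper_ge)

lemma upper_superadditive:
  assumes "A \<inter> A' = {}" shows "upper A + upper A' \<le> upper (A \<union> A')"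
proof -
  have *: "\<nu> C + \<nu> C' \<le> upper (A \<union> A')"
    if "C \<in> borel_sets_on \<Omega>" "C \<subseteq> A" "C' \<in> borel_sets_on \<Omega>" "C' \<subseteq> A'" for C C'
  proof -
    have "\<nu> C + \<nu> C' = \<nu> (C \<union> C')" using that assms by (intro signed_Un[symmetric]) auto
    also have "\<dots> \<le> upper (A \<union> A')" using that by (intro upper_ge) auto
    finally show ?thesis .
  qed
  have "upper A \<le> upper (A \<union> A') - upper A'"
  proof (rule upper_least)
    fix C assume C: "C \<in> borel_sets_on \<Omega>" "C \<subseteq> A"
    have "upper A' \<le> upper (A \<union> A') - \<nu> C"
      by (rule upper_least) (use *[OF C] in force)
    then show "\<nu> C \<le> upper (A \<union> A') - upper A'" by linarith
  qed
  then show ?thesis by linarith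
qed

text \<open>Competitors on disjoint sets unite, which bounds all partial sums from above; conversely
  any competitor on the union splits along the sequence, and countable additivity of
  \<open>\<nu>\<close> compares it with the series.\<close>

lemma upper_sums:
  assumes A: "range A \<subseteq> borel_sets_on \<Omega>" "disjoint_family A"
  shows "(\<lambda>i::nat. upper (A i)) sums upper (\<Union>i. A i)"
proof -
  have partial: "(\<Sum>i<n. upper (A i)) \<le> upper (\<Union>i<n. A i)" for n
  proof (induction n)
    case 0 show ?case using upper_nonneg by simp
  next
    case (Suc n)
    have "A i \<inter> A n = {}" if "i < n" for i using A(2) that by (simp add: disjoint_family_on_def)
    then have "(\<Union>i<n. A i) \<inter> A n = {}" by blast
    moreover have "(\<Union>i<Suc n. A i) = (\<Union>i<n. A i) \<union> A n" by (auto simp: less_Suc_eq)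
    ultimately show ?case using upper_superadditive[of "\<Union>i<n. A i" "A n"] Suc by simp
  qed
  have le: "(\<Sum>i<n. upper (A i)) \<le> upper (\<Union>i. A i)" for n
    using partial[of n] upper_mono[of "\<Union>i<n. A i" "\<Union>i. A i"] by force
  have sm: "summable (\<lambda>i. upper (A i))"
    by (rule summableI_nonneg_bounded[OF upper_nonneg le])
  have "upper (\<Union>i. A i) \<le> (\<Sum>i. upper (A i))"
  proof (rule upper_least)
    fix C assume C: "C \<in> borel_sets_on \<Omega>" "C \<subseteq> (\<Union>i. A i)"
    have "(\<lambda>i. \<nu> (C \<inter> A i)) sums \<nu> (\<Union>i. C \<inter> A i)"
      using A C by (intro signed_sums) (auto simp: disjoint_family_on_def)
    moreover have "(\<Union>i. C \<inter> A i) = C" using C by blast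
    ultimately have s: "(\<lambda>i. \<nu> (C \<inter> A i)) sums \<nu> C" by simp
    show "\<nu> C \<le> (\<Sum>i. upper (A i))"
      by (rule sums_le[OF _ s summable_sums[OF sm]]) (use A C in \<open>auto intro!: upper_ge\<close>)
  qed
  moreover have "(\<Sum>i. upper (A i)) \<le> upper (\<Union>i. A i)" by (rule suminf_le_const[OF sm le])
  ultimately have "upper (\<Union>i. A i) = (\<Sum>i. upper (A i))" by (rule antisym)
  then show ?thesis using summable_sums[OF sm] by simp
qed

text \<open>Cutting negative values to 0 does not change the supremum, because the empty set already
  contributes 0.\<close>

lemma sup_ennreal_upper: "(SUP C\<in>{C \<in> borel_sets_on \<Omega>. C \<subseteq> A}. ennreal (\<nu> C)) = ennreal (upper A)"
proof (rule antisym)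
  show le: "(SUP C\<in>{C \<in> borel_sets_on \<Omega>. C \<subseteq> A}. ennreal (\<nu> C)) \<le> ennreal (upper A)"
    by (rule SUP_least) (auto intro!: ennreal_leI upper_ge)
  let ?s = "SUP C\<in>{C \<in> borel_sets_on \<Omega>. C \<subseteq> A}. ennreal (\<nu> C)"
  have fin: "?s < top" using le ennreal_less_top le_less_trans by blast
  have "upper A \<le> enn2real ?s"
  proof (rule upper_least)
    fix C assume "C \<in> borel_sets_on \<Omega>" "C \<subseteq> A"
    then have "ennreal (\<nu> C) \<le> ?s" by (intro SUP_upper) auto
    then show "\<nu> C \<le> enn2real ?s" using fin
      by (metis enn2real_mono enn2real_ennreal enn2real_nonneg linear order_trans)
  qed
  then have "ennreal (upper A) \<le> ennreal (enn2real ?s)" by (rule ennreal_leI)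
  then show "ennreal (upper A) \<le> ?s" using fin by simp
qed

lemma jordan_pos:
  shows sets_jordan_pos: "sets (jordan_pos \<Omega> \<nu>) = borel_sets_on \<Omega>"
    and space_jordan_pos: "space (jordan_pos \<Omega> \<nu>) = \<Omega>"
    and emeasure_jordan_pos: "A \<in> borel_sets_on \<Omega> \<Longrightarrow> emeasure (jordan_pos \<Omega> \<nu>) A = ennreal (upper A)"
proof -
  show "sets (jordan_pos \<Omega> \<nu>) = borel_sets_on \<Omega>" "space (jordan_pos \<Omega> \<nu>) = \<Omega>"
    unfolding jordan_pos_def by simp_all
  assume A: "A \<in> borel_sets_on \<Omega>"
  have "upper {} = 0"
    by (rule antisym[OF upper_least upper_nonneg]) (auto simp: signed_empty)
  then show "emeasure (jordan_pos \<Omega> \<nu>) A = ennreal (upper A)"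
    unfolding jordan_pos_def sup_ennreal_upper
  proof (intro emeasure_measure_of_sigma A B.sigma_algebra_axioms)
    show "countably_additive (borel_sets_on \<Omega>) (\<lambda>A. ennreal (upper A))"
      unfolding countably_additive_def
    proof (intro allI impI)
      fix A :: "nat \<Rightarrow> 'a set" assume "range A \<subseteq> borel_sets_on \<Omega>" "disjoint_family A"
      from upper_sums[OF this] show "(\<Sum>i. ennreal (upper (A i))) = ennreal (upper (\<Union>i. A i))"
        by (simp add: suminf_ennreal2 upper_nonneg sums_iff)
    qed
  qed (simp add: positive_def)
qed

lemma finite_jordan_pos: "finite_measure (jordan_pos \<Omega> \<nu>)"
  by (rule finite_measureI) (simp add: space_jordan_pos emeasure_jordan_pos)

lemma measure_jordan_pos: "A \<in> borel_sets_on \<Omega> \<Longrightarrow> measure (jordan_pos \<Omega> \<nu>) A = upper A"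
  by (simp add: measure_def emeasure_jordan_pos upper_nonneg)

end

text \<open>For \<open>C\<close> inside \<open>A\<close> the value on \<open>C\<close> is
  \<open>\<nu> A\<close> minus the value on \<open>A - C\<close>. Taking suprema over
  \<open>C\<close> on both sides relates the two variations, and no Hahn set has to be
  found.\<close>

lemma jordan_decomposition:
  assumes \<Omega>: "open \<Omega>" and \<nu>: "signed_measure_on \<Omega> \<nu>" and A: "A \<in> borel_sets_on \<Omega>"
  shows "measure (jordan_pos \<Omega> \<nu>) A - measure (jordan_pos \<Omega> (\<lambda>A. - \<nu> A)) A = \<nu> A"
proof -
  note \<nu>' = signed_measure_on_uminus[OF \<nu>]
  have sub: "\<nu> A = \<nu> C + \<nu> (A - C)" if "C \<in> borel_sets_on \<Omega>" "C \<subseteq> A" for C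
  proof -
    have "C \<union> (A - C) = A" using that by blast
    then show ?thesis using signed_Un[OF \<Omega> \<nu>, of C "A - C"] that A by (auto simp: sets.Diff)
  qed
  have "upper \<Omega> \<nu> A \<le> \<nu> A + upper \<Omega> (\<lambda>A. - \<nu> A) A"
  proof (rule upper_least[OF \<Omega> \<nu>])
    fix C assume C: "C \<in> borel_sets_on \<Omega>" "C \<subseteq> A"
    have "- \<nu> (A - C) \<le> upper \<Omega> (\<lambda>A. - \<nu> A) A" using C A by (intro upper_ge[OF \<Omega> \<nu>']) auto
    then show "\<nu> C \<le> \<nu> A + upper \<Omega> (\<lambda>A. - \<nu> A) A" using sub[OF C] by linarith
  qed
  moreover have "upper \<Omega> (\<lambda>A. - \<nu> A) A \<le> upper \<Omega> \<nu> A - \<nu> A"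
  proof (rule upper_least[OF \<Omega> \<nu>'])
    fix C assume C: "C \<in> borel_sets_on \<Omega>" "C \<subseteq> A"
    have "\<nu> (A - C) \<le> upper \<Omega> \<nu> A" using C A by (intro upper_ge[OF \<Omega> \<nu>]) auto
    then show "- \<nu> C \<le> upper \<Omega> \<nu> A - \<nu> A" using sub[OF C] by linarith
  qed
  ultimately show ?thesis
    using measure_jordan_pos[OF \<Omega> \<nu> A] measure_jordan_pos[OF \<Omega> \<nu>' A] by linarith
qed

section \<open>Integrals against linear combinations of finite measures\<close>

lemma finite_measure_integral_simple:
  fixes g :: "'y \<Rightarrow> real"
  assumes "finite_measure M" "simple_function M t"
  shows "(\<integral>x. g (t x) \<partial>M) = (\<Sum>y\<in>t ` space M. g y * measure M (t -` {y} \<inter> space M))"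
proof -
  interpret finite_measure M by fact
  have fin: "finite (t ` space M)" and A: "t -` {y} \<inter> space M \<in> sets M" for y
    using assms(2) by (auto intro: simple_functionD)
  have "(\<integral>x. g (t x) \<partial>M) = (\<integral>x. (\<Sum>y\<in>t ` space M. g y * indicator (t -` {y} \<inter> space M) x) \<partial>M)"
  proof (rule Bochner_Integration.integral_cong[OF refl])
    fix x assume x: "x \<in> space M"
    have "(\<Sum>y\<in>t ` space M. g y * indicator (t -` {y} \<inter> space M) x) = (\<Sum>y\<in>t ` space M. if y = t x then g y else 0)"
      using x by (intro sum.cong) (auto simp: indicator_def)
    then show "g (t x) = (\<Sum>y\<in>t ` space M. g y * indicator (t -` {y} \<inter> space M) x)" using fin x by simp
  qed
  also have "\<dots> = (\<Sum>y\<in>t ` space M. g y * measure M (t -` {y} \<inter> space M))"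
    using A by (subst Bochner_Integration.integral_sum) (auto simp: emeasure_eq_measure)
  finally show ?thesis .
qed

text \<open>A linear relation between finite measures that holds set by set passes to simple
  functions and, by dominated convergence, to bounded measurable ones.\<close>

lemma measure_combination_integral:
  fixes f :: "'x \<Rightarrow> real"
  assumes I: "finite I" and N: "\<And>k. k \<in> I \<Longrightarrow> finite_measure (N k)" "\<And>k. k \<in> I \<Longrightarrow> sets (N k) = sets M"
    and eq: "\<And>A. A \<in> sets M \<Longrightarrow> (\<Sum>k\<in>I. c k * measure (N k) A) = 0"
    and f: "f \<in> borel_measurable M" "\<And>x. x \<in> space M \<Longrightarrow> \<bar>f x\<bar> \<le> K"
  shows "(\<Sum>k\<in>I. c k * (\<integral>x. f x \<partial>N k)) = 0"
proof -
  have sp: "space (N k) = space M" if "k \<in> I" for k by (rule sets_eq_imp_space_eq[OF N(2)[OF that]])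
  obtain s where s0: "\<forall>n. simple_function M (s n)" "\<forall>x\<in>space M. (\<lambda>n. s n x) \<longlonglongrightarrow> f x"
    "\<forall>n. \<forall>x\<in>space M. dist (s n x) 0 \<le> 2 * dist (f x) 0"
    using borel_measurable_implies_sequence_metric[OF f(1), of 0] by blast
  then have s: "\<And>n. simple_function M (s n)" "\<And>x. x \<in> space M \<Longrightarrow> (\<lambda>n. s n x) \<longlonglongrightarrow> f x"
    "\<And>n x. x \<in> space M \<Longrightarrow> norm (s n x) \<le> 2 * norm (f x)" by auto
  have sN: "simple_function (N k) (s n)" if "k \<in> I" for k n
    using s(1) simple_function_cong_algebra[OF N(2)[OF that, symmetric] sp[OF that, symmetric]] by blast
  have "(\<lambda>n. \<Sum>k\<in>I. c k * (\<integral>x. s n x \<partial>N k)) \<longlonglongrightarrow> (\<Sum>k\<in>I. c k * (\<integral>x. f x \<partial>N k))"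
  proof (intro tendsto_sum tendsto_mult tendsto_const)
    fix k assume k: "k \<in> I"
    interpret finite_measure "N k" by (rule N(1)[OF k])
    show "(\<lambda>n. \<integral>x. s n x \<partial>N k) \<longlonglongrightarrow> (\<integral>x. f x \<partial>N k)"
    proof (rule integral_dominated_convergence[where w="\<lambda>_. 2 * K"])
      show "f \<in> borel_measurable (N k)" using f(1) by (simp add: measurable_cong_sets[OF N(2)[OF k] refl])
      show "s n \<in> borel_measurable (N k)" for n by (rule borel_measurable_simple_function[OF sN[OF k]])
      show "AE x in N k. (\<lambda>n. s n x) \<longlonglongrightarrow> f x" using s(2) sp[OF k] by (intro AE_I2) simp
      show "AE x in N k. norm (s n x) \<le> 2 * K" for n
      proof (rule AE_I2)
        fix x assume "x \<in> space (N k)"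
        then show "norm (s n x) \<le> 2 * K" using s(3)[of x n] f(2)[of x] sp[OF k] by simp
      qed
    qed simp
  qed
  moreover have "(\<Sum>k\<in>I. c k * (\<integral>x. s n x \<partial>N k)) = 0" for n
  proof -
    have "(\<Sum>k\<in>I. c k * (\<integral>x. s n x \<partial>N k)) = (\<Sum>k\<in>I. \<Sum>y\<in>s n ` space M. y * (c k * measure (N k) (s n -` {y} \<inter> space M)))"
    proof (rule sum.cong)
      fix k assume k: "k \<in> I"
      show "c k * (\<integral>x. s n x \<partial>N k) = (\<Sum>y\<in>s n ` space M. y * (c k * measure (N k) (s n -` {y} \<inter> space M)))"
        using finite_measure_integral_simple[OF N(1)[OF k] sN[OF k], of "\<lambda>y. y" n] sp[OF k]
        by (simp add: sum_distrib_left mult_ac)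
    qed simp
    also have "\<dots> = (\<Sum>y\<in>s n ` space M. y * (\<Sum>k\<in>I. c k * measure (N k) (s n -` {y} \<inter> space M)))"
      by (subst sum.swap) (simp add: sum_distrib_left)
    also have "\<dots> = 0"
    proof (rule sum.neutral, rule ballI)
      fix y
      have "s n -` {y} \<inter> space M \<in> sets M" by (rule simple_functionD(2)[OF s(1)])
      then show "y * (\<Sum>k\<in>I. c k * measure (N k) (s n -` {y} \<inter> space M)) = 0" using eq by simp
    qed
    finally show ?thesis .
  qed
  ultimately show ?thesis by (simp add: LIMSEQ_const_iff)
qed

lemma signed_measure_on_combination:
  assumes \<Omega>: "open \<Omega>" and I: "finite I" and N: "\<And>k. k \<in> I \<Longrightarrow> finite_measure (N k)" "\<And>k. k \<in> I \<Longrightarrow> sets (N k) = borel_sets_on \<Omega>"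
    and eq: "\<And>A. A \<in> borel_sets_on \<Omega> \<Longrightarrow> \<nu> A = (\<Sum>k\<in>I. c k * measure (N k) A)"
  shows "signed_measure_on \<Omega> \<nu>"
  unfolding signed_measure_on_def
proof (intro conjI allI impI)
  fix A :: "nat \<Rightarrow> 'a set" assume A: "range A \<subseteq> borel_sets_on \<Omega> \<and> disjoint_family A"
  have "(\<lambda>i. \<Sum>k\<in>I. c k * measure (N k) (A i)) sums (\<Sum>k\<in>I. c k * measure (N k) (\<Union>i. A i))"
    using A N by (intro sums_sum sums_mult finite_measure.finite_measure_UNION) auto
  moreover have "\<nu> (A i) = (\<Sum>k\<in>I. c k * measure (N k) (A i))" for i using A by (intro eq) auto
  moreover have "\<nu> (\<Union>i. A i) = (\<Sum>k\<in>I. c k * measure (N k) (\<Union>i. A i))" using A by (intro eq) auto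
  ultimately show "(\<lambda>i. \<nu> (A i)) sums \<nu> (\<Union>i. A i)" by simp
next
  show "\<exists>K. \<forall>A\<in>borel_sets_on \<Omega>. \<bar>\<nu> A\<bar> \<le> K"
  proof (intro exI ballI)
    fix A assume A: "A \<in> borel_sets_on \<Omega>"
    have "\<bar>\<nu> A\<bar> \<le> (\<Sum>k\<in>I. \<bar>c k * measure (N k) A\<bar>)" unfolding eq[OF A] by (rule sum_abs)
    also have "\<dots> \<le> (\<Sum>k\<in>I. \<bar>c k\<bar> * measure (N k) (space (N k)))"
      unfolding abs_mult using N by (intro sum_mono mult_left_mono) (auto intro: finite_measure.bounded_measure)
    finally show "\<bar>\<nu> A\<bar> \<le> (\<Sum>k\<in>I. \<bar>c k\<bar> * measure (N k) (space (N k)))" .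
  qed
qed

text \<open>\<open>vector_integral\<close> is defined through the Jordan parts, but measures arise
  as other differences of finite measures. This lemma makes the integral independent of the
  representation, and so supplies the linearity used for q - g dx.\<close>

lemma jordan_integral_combination:
  assumes \<Omega>: "open \<Omega>" and I: "finite I" and N: "\<And>k. k \<in> I \<Longrightarrow> finite_measure (N k)" "\<And>k. k \<in> I \<Longrightarrow> sets (N k) = borel_sets_on \<Omega>"
    and eq: "\<And>A. A \<in> borel_sets_on \<Omega> \<Longrightarrow> \<nu> A = (\<Sum>k\<in>I. c k * measure (N k) A)"
    and f: "f \<in> borel_measurable borel" "\<And>x. \<bar>f x\<bar> \<le> K"
  shows "(\<integral>x. f x \<partial>jordan_pos \<Omega> \<nu>) - (\<integral>x. f x \<partial>jordan_pos \<Omega> (\<lambda>A. - \<nu> A)) = (\<Sum>k\<in>I. c k * (\<integral>x. f x \<partial>N k))"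
proof -
  have \<nu>: "signed_measure_on \<Omega> \<nu>" by (rule signed_measure_on_combination[OF \<Omega> I N eq])
  note \<nu>' = signed_measure_on_uminus[OF \<nu>]
  let ?P = "jordan_pos \<Omega> \<nu>" and ?N = "jordan_pos \<Omega> (\<lambda>A. - \<nu> A)"
  \<comment> \<open>The two Jordan parts, with signs -1 and 1, and the given measures are collected
    in one relation whose value is 0 on every set.\<close>
  let ?I = "insert (Inl True) (insert (Inl False) (Inr ` I))"
  let ?M = "case_sum (\<lambda>b. if b then ?P else ?N) N" and ?c = "case_sum (\<lambda>b. if b then -1 else 1) c"
  have sum_I: "(\<Sum>k\<in>?I. h k) = h (Inl True) + h (Inl False) + (\<Sum>k\<in>I. h (Inr k))" for h :: "_ \<Rightarrow> real"
    using I by (subst sum.insert, simp, blast, subst sum.insert, simp, blast) (simp add: sum.reindex)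
  have "(\<Sum>k\<in>?I. ?c k * (\<integral>x. f x \<partial>?M k)) = 0"
  proof (rule measure_combination_integral[where M="restrict_space borel \<Omega>" and K=K])
    show "finite_measure (?M k)" "sets (?M k) = borel_sets_on \<Omega>" if "k \<in> ?I" for k
      using that N finite_jordan_pos[OF \<Omega> \<nu>] finite_jordan_pos[OF \<Omega> \<nu>'] sets_jordan_pos[OF \<Omega> \<nu>] sets_jordan_pos[OF \<Omega> \<nu>']
      by auto
    show "(\<Sum>k\<in>?I. ?c k * measure (?M k) A) = 0" if "A \<in> borel_sets_on \<Omega>" for A
      unfolding sum_I using jordan_decomposition[OF \<Omega> \<nu> that] eq[OF that] by simp
    show "f \<in> borel_measurable (restrict_space borel \<Omega>)" by (rule measurable_restrict_space1[OF f(1)])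
  qed (use I f in auto)
  then show ?thesis unfolding sum_I by simp
qed


section \<open>Total variation and the bound it gives for vector integrals\<close>

lemma total_variation_finite_partition:
  assumes I: "finite I" and A: "\<And>i. i \<in> I \<Longrightarrow> A i \<in> borel_sets_on \<Omega>" "disjoint_family_on A I" "(\<Union>i\<in>I. A i) = \<Omega>"
  shows "(\<Sum>i\<in>I. ennreal (norm (\<mu> (A i)))) \<le> total_variation \<Omega> \<mu> \<Omega>"
proof -
  obtain h where h: "bij_betw h {0..<card I} I" using ex_bij_betw_nat_finite[OF I] by blast
  \<comment> \<open>The definition of the variation ranges over sequences, so the finite partition
    is enumerated and padded with empty sets.\<close>
  define C where "C n = (if n < card I then A (h n) else {})" for n
  have hI: "h n \<in> I" if "n < card I" for n using bij_betwE[OF h] that by simp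
  have "(\<Sum>i\<in>I. ennreal (norm (\<mu> (A i)))) = (\<Sum>n\<in>{0..<card I}. ennreal (norm (\<mu> (A (h n)))))"
    by (rule sum.reindex_bij_betw[OF h, symmetric])
  also have "\<dots> = (\<Sum>n<card I. ennreal (norm (\<mu> (C n))))"
    by (rule sum.cong) (auto simp: C_def)
  also have "\<dots> \<le> (\<Sum>n. ennreal (norm (\<mu> (C n))))" by (rule sum_le_suminf) auto
  also have "\<dots> \<le> total_variation \<Omega> \<mu> \<Omega>" unfolding total_variation_def
  proof (rule SUP_upper, safe)
    show "C n \<in> borel_sets_on \<Omega>" for n using A(1) hI by (simp add: C_def)
    show "disjoint_family C" unfolding disjoint_family_on_def
    proof (intro ballI impI)
      fix m n :: nat assume "m \<noteq> n"
      then show "C m \<inter> C n = {}" unfolding C_def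
        using A(2) hI inj_onD[OF bij_betw_imp_inj_on[OF h], of m n] by (auto simp: disjoint_family_on_def)
    qed
    show "x \<in> \<Omega>" if "x \<in> C n" for x n using that A(3) hI by (auto simp: C_def split: if_splits)
    fix x assume "x \<in> \<Omega>"
    then obtain i where "i \<in> I" "x \<in> A i" using A(3) by blast
    moreover then obtain n where "n < card I" "h n = i" using bij_betw_imp_surj_on[OF h] by force
    ultimately show "x \<in> (\<Union>n. C n)" by (auto simp: C_def)
  qed
  finally show ?thesis .
qed

lemma norm_le_total_variation:
  assumes \<Omega>: "open \<Omega>" and A: "A \<in> borel_sets_on \<Omega>" and tv: "total_variation \<Omega> \<mu> \<Omega> \<le> ennreal c" and c: "c \<ge> 0"
  shows "norm (\<mu> A) \<le> c"
proof -
  \<comment> \<open>The partition of \<Omega> into \<open>A\<close> and its complement already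
    bounds the norm of the single value.\<close>
  let ?C = "\<lambda>b. if b then A else \<Omega> - A"
  have "(\<Sum>b\<in>UNIV. ennreal (norm (\<mu> (?C b)))) \<le> total_variation \<Omega> \<mu> \<Omega>"
  proof (rule total_variation_finite_partition)
    show "?C b \<in> borel_sets_on \<Omega>" for b using A \<Omega> by (auto simp: borel_sets_on_iff)
    show "disjoint_family_on ?C UNIV" by (auto simp: disjoint_family_on_def)
    show "(\<Union>b. ?C b) = \<Omega>" using A \<Omega> by (auto simp: borel_sets_on_iff UNIV_bool)
  qed simp
  moreover have "ennreal (norm (\<mu> (?C True))) \<le> (\<Sum>b\<in>UNIV. ennreal (norm (\<mu> (?C b))))"
    by (rule member_le_sum) auto
  ultimately have "ennreal (norm (\<mu> (?C True))) \<le> ennreal c" using tv by (blast intro: order_trans)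
  then have "ennreal (norm (\<mu> A)) \<le> ennreal c" by simp
  then show ?thesis using c by (simp add: ennreal_le_iff)
qed

lemma vector_measure_component:
  assumes \<Omega>: "open \<Omega>" and q: "q \<in> vector_measures \<Omega>" and tv: "total_variation \<Omega> q \<Omega> \<le> 1" and i: "i \<in> Basis"
  shows "signed_measure_on \<Omega> (\<lambda>A. q A \<bullet> i)"
  unfolding signed_measure_on_def
proof (intro conjI allI impI exI ballI)
  fix A :: "nat \<Rightarrow> 'a set" assume "range A \<subseteq> borel_sets_on \<Omega> \<and> disjoint_family A"
  then have "(\<lambda>i. q (A i)) sums q (\<Union>i. A i)" using q by (simp add: vector_measures_def)
  then show "(\<lambda>n. q (A n) \<bullet> i) sums (q (\<Union>i. A i) \<bullet> i)"
    by (rule bounded_linear.sums[OF bounded_linear_inner_left])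
next
  fix A assume "A \<in> borel_sets_on \<Omega>"
  then have "norm (q A) \<le> 1" using norm_le_total_variation[OF \<Omega>, of A q 1] tv by simp
  then show "\<bar>q A \<bullet> i\<bar> \<le> 1" using Basis_le_norm[OF i, of "q A"] by linarith
qed

text \<open>For a simple field the integral is the sum of y \<bullet> q(A_y) over its values y,
  hence at most M times the sum of the norms |q(A_y)| over a finite partition, which the total
  variation bounds by 1.\<close>

lemma vector_integral_le:
  fixes q :: "'a::euclidean_space set \<Rightarrow> 'a"
  assumes \<Omega>: "open \<Omega>" and q: "q \<in> vector_measures \<Omega>" and tv: "total_variation \<Omega> q \<Omega> \<le> 1"
    and F: "F \<in> borel_measurable borel" "\<And>x. norm (F x) \<le> M"
  shows "vector_integral \<Omega> q F \<le> M"
proof -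
  have M: "M \<ge> 0" using F(2)[of 0] norm_ge_zero[of "F 0"] by linarith
  let ?S = "restrict_space borel \<Omega> :: 'a measure"
  let ?P = "\<lambda>i. jordan_pos \<Omega> (\<lambda>A. q A \<bullet> i)" and ?N = "\<lambda>i. jordan_pos \<Omega> (\<lambda>A. - (q A \<bullet> i))"
  note sm = vector_measure_component[OF \<Omega> q tv]
  note sm' = signed_measure_on_uminus[OF sm]
  have P: "finite_measure (?P i)" "sets (?P i) = sets ?S" "space (?P i) = space ?S" if "i \<in> Basis" for i
    using finite_jordan_pos[OF \<Omega> sm[OF that]] sets_jordan_pos[OF \<Omega> sm[OF that]] space_jordan_pos[OF \<Omega> sm[OF that]]
    by (simp_all add: space_restrict_space)
  have N: "finite_measure (?N i)" "sets (?N i) = sets ?S" "space (?N i) = space ?S" if "i \<in> Basis" for i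
    using finite_jordan_pos[OF \<Omega> sm'[OF that]] sets_jordan_pos[OF \<Omega> sm'[OF that]] space_jordan_pos[OF \<Omega> sm'[OF that]]
    by (simp_all add: space_restrict_space)
  have FS: "F \<in> borel_measurable ?S" by (rule measurable_restrict_space1[OF F(1)])
  obtain s where s: "\<forall>n. simple_function ?S (s n)" "\<forall>x\<in>space ?S. (\<lambda>n. s n x) \<longlonglongrightarrow> F x"
    "\<forall>n. \<forall>x\<in>space ?S. dist (s n x) 0 \<le> 2 * dist (F x) 0"
    using borel_measurable_implies_sequence_metric[OF FS, of 0] by blast
  \<comment> \<open>The approximating simple functions are bounded only by twice the norm of F.
    Projecting them to the ball of radius M restores the bound M and, by continuity of the
    projection, preserves convergence to F.\<close>
  define cp where "cp = closest_point (cball (0::'a) M)"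
  have cp: "norm (cp y) \<le> M" for y
    using closest_point_in_set[OF closed_cball, of 0 M y] M by (simp add: cp_def)
  have cpF: "cp (F x) = F x" for x unfolding cp_def by (rule closest_point_self) (simp add: F(2))
  have ccp: "continuous_on UNIV cp" unfolding cp_def
    by (rule continuous_on_closest_point) (use M in auto)
  define t where "t n x = cp (s n x)" for n x
  have ts: "simple_function ?S (t n)" for n unfolding t_def by (rule simple_function_compose1) (use s in auto)
  have tlim: "(\<lambda>n. t n x) \<longlonglongrightarrow> F x" if "x \<in> space ?S" for x
  proof -
    have "(\<lambda>n. cp (s n x)) \<longlonglongrightarrow> cp (F x)"
      using continuous_on_tendsto_compose[OF ccp, of "\<lambda>n. s n x" "F x"] s(2) that by auto
    then show ?thesis by (simp add: t_def cpF)
  qed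
  have lim: "(\<lambda>n. \<integral>x. t n x \<bullet> i \<partial>m) \<longlonglongrightarrow> (\<integral>x. F x \<bullet> i \<partial>m)"
    if m: "finite_measure m" "sets m = sets ?S" "space m = space ?S" and i: "i \<in> Basis" for m i
  proof -
    interpret finite_measure m by fact
    show ?thesis
    proof (rule integral_dominated_convergence[where w="\<lambda>_. M"])
      have "F \<in> borel_measurable m" "t n \<in> borel_measurable m" for n
        using FS borel_measurable_simple_function[OF ts] by (simp_all add: measurable_cong_sets[OF m(2) refl])
      then show "(\<lambda>x. F x \<bullet> i) \<in> borel_measurable m" "(\<lambda>x. t n x \<bullet> i) \<in> borel_measurable m" for n by auto
      show "AE x in m. (\<lambda>n. t n x \<bullet> i) \<longlonglongrightarrow> F x \<bullet> i"
        using tlim m(3) by (intro AE_I2 tendsto_inner tendsto_const) auto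
      show "AE x in m. norm (t n x \<bullet> i) \<le> M" for n
        using order_trans[OF Basis_le_norm[OF i] cp] by (intro AE_I2) (simp add: t_def)
    qed simp
  qed
  have "(\<lambda>n. vector_integral \<Omega> q (t n)) \<longlonglongrightarrow> vector_integral \<Omega> q F"
    unfolding vector_integral_def by (intro tendsto_sum tendsto_diff lim P N)
  moreover have "vector_integral \<Omega> q (t n) \<le> M" for n
  proof -
    let ?Y = "t n ` \<Omega>" and ?A = "\<lambda>y. t n -` {y} \<inter> \<Omega>"
    have sp: "space ?S = \<Omega>" by (simp add: space_restrict_space)
    have A: "?A y \<in> borel_sets_on \<Omega>" for y using simple_functionD(2)[OF ts[of n], of "{y}"] by (simp add: sp)
    have fin: "finite ?Y" using simple_functionD(1)[OF ts[of n]] by (simp add: sp)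
    have int: "(\<integral>x. t n x \<bullet> i \<partial>m) = (\<Sum>y\<in>?Y. (y \<bullet> i) * measure m (?A y))"
      if m: "finite_measure m" "sets m = sets ?S" "space m = space ?S" for m i
    proof -
      have "simple_function m (t n)"
        using ts[of n] simple_function_cong_algebra[OF m(2,3)[symmetric]] by blast
      from finite_measure_integral_simple[OF m(1) this, of "\<lambda>y. y \<bullet> i"] show ?thesis using m(3) sp by simp
    qed
    have "vector_integral \<Omega> q (t n) = (\<Sum>i\<in>Basis. \<Sum>y\<in>?Y. (y \<bullet> i) * (q (?A y) \<bullet> i))"
      unfolding vector_integral_def
    proof (rule sum.cong[OF refl])
      fix i :: 'a assume i: "i \<in> Basis"
      show "(\<integral>x. t n x \<bullet> i \<partial>?P i) - (\<integral>x. t n x \<bullet> i \<partial>?N i) = (\<Sum>y\<in>?Y. (y \<bullet> i) * (q (?A y) \<bullet> i))"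
        unfolding int[OF P[OF i]] int[OF N[OF i]] sum_subtractf[symmetric] right_diff_distrib[symmetric]
        by (simp only: jordan_decomposition[OF \<Omega> sm[OF i] A])
    qed
    also have "\<dots> = (\<Sum>y\<in>?Y. y \<bullet> q (?A y))"
      by (subst sum.swap) (simp add: euclidean_inner[symmetric])
    also have "\<dots> \<le> (\<Sum>y\<in>?Y. M * norm (q (?A y)))"
    proof (rule sum_mono)
      fix y assume "y \<in> ?Y"
      then have "norm y \<le> M" using cp by (auto simp: t_def)
      then show "y \<bullet> q (?A y) \<le> M * norm (q (?A y))"
        by (intro order_trans[OF norm_cauchy_schwarz mult_right_mono]) auto
    qed
    also have "\<dots> = M * (\<Sum>y\<in>?Y. norm (q (?A y)))" by (simp add: sum_distrib_left)
    also have "\<dots> \<le> M * 1"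
    proof (rule mult_left_mono[OF _ M])
      have "(\<Sum>y\<in>?Y. ennreal (norm (q (?A y)))) \<le> total_variation \<Omega> q \<Omega>"
        by (rule total_variation_finite_partition[OF fin A]) (auto simp: disjoint_family_on_def)
      from order_trans[OF this tv] have "ennreal (\<Sum>y\<in>?Y. norm (q (?A y))) \<le> ennreal 1"
        by (simp add: sum_ennreal)
      then show "(\<Sum>y\<in>?Y. norm (q (?A y))) \<le> 1" by (simp only: ennreal_le_iff zero_le_one)
    qed
    finally show ?thesis by simp
  qed
  ultimately show ?thesis by (intro LIMSEQ_le_const2) auto
qed

text \<open>The positive part of h dx. The image under the identity cuts the Lebesgue sigma-algebra
  down to the Borel sets on which vector measures are defined; the negative part is obtained from
  \<open>- h\<close>.\<close>

definition density_measure :: "'a::euclidean_space set \<Rightarrow> ('a \<Rightarrow> real) \<Rightarrow> 'a measure" where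
  "density_measure \<Omega> h = distr (density (lebesgue_on \<Omega>) (\<lambda>x. ennreal (max 0 (h x)))) (restrict_space borel \<Omega>) (\<lambda>x. x)"

lemma density_measure:
  assumes \<Omega>: "open \<Omega>" and h: "integrable (lebesgue_on \<Omega>) h"
  shows sets_density_measure: "sets (density_measure \<Omega> h) = borel_sets_on \<Omega>"
    and finite_density_measure: "finite_measure (density_measure \<Omega> h)"
    and integral_density_measure: "f \<in> borel_measurable borel \<Longrightarrow> (\<And>x. \<bar>f x\<bar> \<le> K) \<Longrightarrow>
      (\<integral>x. f x \<partial>density_measure \<Omega> h) - (\<integral>x. f x \<partial>density_measure \<Omega> (\<lambda>x. - h x)) = (\<integral>x. f x * h x \<partial>lebesgue_on \<Omega>)"
    and measure_density_measure: "A \<in> borel_sets_on \<Omega> \<Longrightarrow>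
      measure (density_measure \<Omega> h) A - measure (density_measure \<Omega> (\<lambda>x. - h x)) A = (\<integral>x. h x \<partial>lebesgue_on A)"
proof -
  have S: "\<Omega> \<in> sets lebesgue" using \<Omega> by (intro sets_completionI_sets) auto
  have idm: "(\<lambda>x. x) \<in> measurable (density (lebesgue_on \<Omega>) (\<lambda>x. ennreal (max 0 (k x)))) (restrict_space borel \<Omega>)" for k
  proof (rule measurable_restrict_space2)
    show "(\<lambda>x. x) \<in> measurable (density (lebesgue_on \<Omega>) (\<lambda>x. ennreal (max 0 (k x)))) borel"
      by (simp add: measurable_restrict_space1 measurable_completion)
  qed (simp add: space_restrict_space)
  have fin: "finite_measure (density_measure \<Omega> k)" if k: "integrable (lebesgue_on \<Omega>) k" for k
  proof -
    have "integrable (lebesgue_on \<Omega>) (\<lambda>x. max 0 (k x))" using k by (intro integrable_max) auto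
    then have "(\<integral>\<^sup>+x. ennreal (max 0 (k x)) \<partial>lebesgue_on \<Omega>) < \<infinity>" by (simp add: real_integrable_def less_top)
    moreover have "emeasure (density (lebesgue_on \<Omega>) (\<lambda>x. ennreal (max 0 (k x)))) (space (lebesgue_on \<Omega>))
      = (\<integral>\<^sup>+x. ennreal (max 0 (k x)) \<partial>lebesgue_on \<Omega>)"
    proof -
      have "(\<lambda>x. ennreal (max 0 (k x))) \<in> borel_measurable (lebesgue_on \<Omega>)" using k by auto
      then show ?thesis by (subst emeasure_density) (auto intro!: nn_integral_cong)
    qed
    ultimately have "finite_measure (density (lebesgue_on \<Omega>) (\<lambda>x. ennreal (max 0 (k x))))"
      by (intro finite_measureI) simp
    then show ?thesis unfolding density_measure_def by (rule finite_measure.finite_measure_distr[OF _ idm])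
  qed
  have hm: "integrable (lebesgue_on \<Omega>) (\<lambda>x. - h x)" using h by simp
  show se: "sets (density_measure \<Omega> h) = borel_sets_on \<Omega>" by (simp add: density_measure_def)
  show "finite_measure (density_measure \<Omega> h)" by (rule fin[OF h])
  have int: "(\<integral>x. f x \<partial>density_measure \<Omega> k) = (\<integral>x. max 0 (k x) * f x \<partial>lebesgue_on \<Omega>)"
    "integrable (lebesgue_on \<Omega>) (\<lambda>x. max 0 (k x) * f x)"
    if f: "f \<in> borel_measurable borel" "\<And>x. \<bar>f x\<bar> \<le> K" and k: "integrable (lebesgue_on \<Omega>) k" for f k K
  proof -
    have fS: "f \<in> borel_measurable (restrict_space borel \<Omega>)" by (rule measurable_restrict_space1[OF f(1)])
    have fL: "f \<in> borel_measurable (lebesgue_on \<Omega>)" using f(1) by (simp add: measurable_restrict_space1 measurable_completion)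
    have "(\<integral>x. f x \<partial>density_measure \<Omega> k) = (\<integral>x. f x \<partial>density (lebesgue_on \<Omega>) (\<lambda>x. ennreal (max 0 (k x))))"
      unfolding density_measure_def by (rule integral_distr[OF idm fS])
    also have "\<dots> = (\<integral>x. max 0 (k x) * f x \<partial>lebesgue_on \<Omega>)"
      using k fL by (subst integral_real_density) auto
    finally show "(\<integral>x. f x \<partial>density_measure \<Omega> k) = (\<integral>x. max 0 (k x) * f x \<partial>lebesgue_on \<Omega>)" .
    show "integrable (lebesgue_on \<Omega>) (\<lambda>x. max 0 (k x) * f x)"
    proof (rule Bochner_Integration.integrable_bound)
      show "integrable (lebesgue_on \<Omega>) (\<lambda>x. K * k x)" using k by simp
      show "(\<lambda>x. max 0 (k x) * f x) \<in> borel_measurable (lebesgue_on \<Omega>)" using k fL by (intro borel_measurable_times borel_measurable_max) auto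
      have "\<bar>max 0 (k x) * f x\<bar> \<le> \<bar>K * k x\<bar>" for x
        using mult_mono[of "\<bar>max 0 (k x)\<bar>" "\<bar>k x\<bar>" "\<bar>f x\<bar>" "\<bar>K\<bar>"] f(2)[of x]
        by (simp add: abs_mult mult.commute)
      then show "AE x in lebesgue_on \<Omega>. norm (max 0 (k x) * f x) \<le> norm (K * k x)" by simp
    qed
  qed
  show formula: "(\<integral>x. f x \<partial>density_measure \<Omega> h) - (\<integral>x. f x \<partial>density_measure \<Omega> (\<lambda>x. - h x)) = (\<integral>x. f x * h x \<partial>lebesgue_on \<Omega>)"
    if f: "f \<in> borel_measurable borel" "\<And>x. \<bar>f x\<bar> \<le> K" for f K
  proof -
    have "(\<integral>x. f x \<partial>density_measure \<Omega> h) - (\<integral>x. f x \<partial>density_measure \<Omega> (\<lambda>x. - h x))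
       = (\<integral>x. max 0 (h x) * f x - max 0 (- h x) * f x \<partial>lebesgue_on \<Omega>)"
      using int[OF f h] int[OF f hm] by simp
    also have "\<dots> = (\<integral>x. f x * h x \<partial>lebesgue_on \<Omega>)"
      by (intro Bochner_Integration.integral_cong refl) (auto simp: max_def)
    finally show ?thesis .
  qed
  show "measure (density_measure \<Omega> h) A - measure (density_measure \<Omega> (\<lambda>x. - h x)) A = (\<integral>x. h x \<partial>lebesgue_on A)"
    if A: "A \<in> borel_sets_on \<Omega>" for A
  proof -
    have A': "A \<subseteq> \<Omega>" "A \<in> sets borel" using A \<Omega> by (auto simp: borel_sets_on_iff)
    have m: "(\<integral>x. indicator A x \<partial>density_measure \<Omega> k) = measure (density_measure \<Omega> k) A" for k :: "'a \<Rightarrow> real"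
    proof -
      have "space (density_measure \<Omega> k) = \<Omega>" by (simp add: density_measure_def space_restrict_space)
      then show ?thesis using A' by (simp add: Int_absorb2)
    qed
    have "measure (density_measure \<Omega> h) A - measure (density_measure \<Omega> (\<lambda>x. - h x)) A = (\<integral>x. indicator A x * h x \<partial>lebesgue_on \<Omega>)"
      unfolding m[symmetric] by (rule formula[where K=1]) (use A'(2) in \<open>auto simp: indicator_def\<close>)
    also have "\<dots> = (\<integral>x. h x \<partial>lebesgue_on A)"
    proof -
      have "(\<integral>x. indicator A x * h x \<partial>lebesgue_on \<Omega>) = (\<integral>x. indicator \<Omega> x *\<^sub>R (indicator A x * h x) \<partial>lebesgue)"
        using S by (subst integral_restrict_space) auto
      also have "\<dots> = (\<integral>x. indicator A x *\<^sub>R h x \<partial>lebesgue)"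
        using A'(1) by (intro Bochner_Integration.integral_cong refl) (auto simp: indicator_def)
      also have "\<dots> = (\<integral>x. h x \<partial>lebesgue_on A)"
        using A'(2) by (subst integral_restrict_space) (auto intro: sets_completionI_sets)
      finally show ?thesis .
    qed
    finally show ?thesis .
  qed
qed

section \<open>The Poisson problem\<close>

lemma norm_diff_square_le: "(norm (a - b))\<^sup>2 \<le> 2 * (norm a)\<^sup>2 + 2 * (norm (b :: 'b::real_inner))\<^sup>2"
proof -
  have "(norm (a - b))\<^sup>2 + (norm (a + b))\<^sup>2 = 2 * (norm a)\<^sup>2 + 2 * (norm b)\<^sup>2"
    by (simp add: power2_norm_eq_inner inner_diff_left inner_diff_right inner_add_left inner_add_right inner_commute)
  then show ?thesis by (smt (verit) zero_le_power2)
qed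

lemma square_integrable_diff:
  fixes f g :: "'x \<Rightarrow> 'b::euclidean_space"
  assumes "f \<in> borel_measurable M" "g \<in> borel_measurable M"
    "integrable M (\<lambda>x. (norm (f x))\<^sup>2)" "integrable M (\<lambda>x. (norm (g x))\<^sup>2)"
  shows "integrable M (\<lambda>x. (norm (f x - g x))\<^sup>2)"
proof (rule Bochner_Integration.integrable_bound)
  show "integrable M (\<lambda>x. 2 * (norm (f x))\<^sup>2 + 2 * (norm (g x))\<^sup>2)" using assms by simp
  show "(\<lambda>x. (norm (f x - g x))\<^sup>2) \<in> borel_measurable M" using assms(1,2) by measurable
  show "AE x in M. norm ((norm (f x - g x))\<^sup>2) \<le> norm (2 * (norm (f x))\<^sup>2 + 2 * (norm (g x))\<^sup>2)"
    using norm_diff_square_le[of "f _" "g _"] by (intro AE_I2) simp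
qed

text \<open>The free weight s serves as a replacement for the Cauchy-Schwarz inequality for
  integrals: it is taken small to control limits, and equal to the Poincare constant in the energy
  estimate.\<close>

lemma abs_inner_le_young:
  fixes a b :: "'b::real_inner"
  assumes "s > 0" shows "\<bar>a \<bullet> b\<bar> \<le> (norm a)\<^sup>2 / (2 * s) + s * (norm b)\<^sup>2 / 2"
proof -
  have "0 \<le> (norm a - s * norm b)\<^sup>2" by simp
  then have "2 * s * (norm a * norm b) \<le> (norm a)\<^sup>2 + s\<^sup>2 * (norm b)\<^sup>2"
    by (simp add: power2_diff power_mult_distrib algebra_simps)
  then have "norm a * norm b \<le> (norm a)\<^sup>2 / (2 * s) + s * (norm b)\<^sup>2 / 2"
    using assms by (simp add: field_simps power2_eq_square)
  then show ?thesis using Cauchy_Schwarz_ineq2[of a b] by linarith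
qed

lemma integrable_inner_square:
  fixes f g :: "'x \<Rightarrow> 'b::euclidean_space"
  assumes "f \<in> borel_measurable M" "g \<in> borel_measurable M"
    "integrable M (\<lambda>x. (norm (f x))\<^sup>2)" "integrable M (\<lambda>x. (norm (g x))\<^sup>2)"
  shows "integrable M (\<lambda>x. f x \<bullet> g x)"
proof (rule Bochner_Integration.integrable_bound)
  show "integrable M (\<lambda>x. (norm (f x))\<^sup>2 / (2 * 1) + 1 * (norm (g x))\<^sup>2 / 2)" using assms by simp
  show "(\<lambda>x. f x \<bullet> g x) \<in> borel_measurable M" using assms(1,2) by measurable
  show "AE x in M. norm (f x \<bullet> g x) \<le> norm ((norm (f x))\<^sup>2 / (2 * 1) + 1 * (norm (g x))\<^sup>2 / 2)"
    using abs_inner_le_young[of 1 "f _" "g _"] by (intro AE_I2) simp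
qed

lemma L2_limit_inner:
  fixes f :: "nat \<Rightarrow> 'x \<Rightarrow> 'b::euclidean_space"
  assumes f: "\<And>n. f n \<in> borel_measurable M" "\<And>n. integrable M (\<lambda>x. (norm (f n x))\<^sup>2)"
    and g: "g \<in> borel_measurable M" "integrable M (\<lambda>x. (norm (g x))\<^sup>2)"
    and h: "h \<in> borel_measurable M" "integrable M (\<lambda>x. (norm (h x))\<^sup>2)"
    and lim: "(\<lambda>n. \<integral>x. (norm (f n x - g x))\<^sup>2 \<partial>M) \<longlonglongrightarrow> 0"
  shows "(\<lambda>n. \<integral>x. f n x \<bullet> h x \<partial>M) \<longlonglongrightarrow> (\<integral>x. g x \<bullet> h x \<partial>M)"
proof (rule LIMSEQ_I)
  fix e :: real assume e: "e > 0"
  define H where "H = (\<integral>x. (norm (h x))\<^sup>2 \<partial>M)"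
  have H: "H \<ge> 0" unfolding H_def by simp
  \<comment> \<open>With this weight the term containing h is at most e/2 whatever n is; the other
    term falls below e/2 once the squared distance is below s e.\<close>
  define s where "s = e / (H + 1)"
  have s: "s > 0" using e H by (simp add: s_def)
  have "s * e > 0" using s e by simp
  then obtain N where N: "\<And>n. n \<ge> N \<Longrightarrow> (\<integral>x. (norm (f n x - g x))\<^sup>2 \<partial>M) < s * e"
    using order_tendstoD(2)[OF lim] unfolding eventually_sequentially by blast
  show "\<exists>no. \<forall>n\<ge>no. norm ((\<integral>x. f n x \<bullet> h x \<partial>M) - (\<integral>x. g x \<bullet> h x \<partial>M)) < e"
  proof (intro exI allI impI)
    fix n assume n: "n \<ge> N"
    have d: "integrable M (\<lambda>x. (norm (f n x - g x))\<^sup>2)" by (rule square_integrable_diff[OF f(1) g(1) f(2) g(2)])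
    have m: "(\<lambda>x. f n x - g x) \<in> borel_measurable M" using f(1) g(1) by measurable
    have "(\<integral>x. f n x \<bullet> h x \<partial>M) - (\<integral>x. g x \<bullet> h x \<partial>M) = (\<integral>x. (f n x - g x) \<bullet> h x \<partial>M)"
      using integrable_inner_square[OF f(1) h(1) f(2) h(2), of n] integrable_inner_square[OF g(1) h(1) g(2) h(2)]
      by (simp add: inner_diff_left)
    also have "norm \<dots> \<le> (\<integral>x. \<bar>(f n x - g x) \<bullet> h x\<bar> \<partial>M)" by (simp add: integral_abs_bound)
    also have "\<dots> \<le> (\<integral>x. (norm (f n x - g x))\<^sup>2 / (2 * s) + s * (norm (h x))\<^sup>2 / 2 \<partial>M)"
      by (intro integral_mono integrable_abs integrable_inner_square m d h abs_inner_le_young s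
            Bochner_Integration.integrable_add integrable_divide integrable_mult_right impI)
    also have "\<dots> = (\<integral>x. (norm (f n x - g x))\<^sup>2 \<partial>M) / (2 * s) + s * H / 2"
      unfolding H_def using d h by simp
    also have "\<dots> < e / 2 + e / 2"
    proof (rule add_less_le_mono)
      have "(\<integral>x. (norm (f n x - g x))\<^sup>2 \<partial>M) / (2 * s) < (s * e) / (2 * s)"
        using N[OF n] s by (intro divide_strict_right_mono) auto
      then show "(\<integral>x. (norm (f n x - g x))\<^sup>2 \<partial>M) / (2 * s) < e / 2" using s by simp
      have "s * H \<le> e" unfolding s_def using e H by (simp add: field_simps)
      then show "s * H / 2 \<le> e / 2" by simp
    qed
    finally show "norm ((\<integral>x. f n x \<bullet> h x \<partial>M) - (\<integral>x. g x \<bullet> h x \<partial>M)) < e" by simp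
  qed
qed

text \<open>The Riesz-Fischer argument for representatives: a rapidly converging subsequence
  converges almost everywhere, and Fatou's lemma turns the pointwise limit into a limit in the mean
  square. Finiteness of the measure makes mean square smallness control the L^1 norms of the
  increments.\<close>

lemma L2_complete:
  fixes f :: "nat \<Rightarrow> 'x \<Rightarrow> 'b::euclidean_space"
  assumes M: "finite_measure M"
    and f: "\<And>n. f n \<in> borel_measurable M" "\<And>n. integrable M (\<lambda>x. (norm (f n x))\<^sup>2)"
    and cauchy: "\<And>e. e > 0 \<Longrightarrow> \<exists>N. \<forall>m\<ge>N. \<forall>n\<ge>N. (\<integral>x. (norm (f m x - f n x))\<^sup>2 \<partial>M) < e"
  shows "\<exists>g. g \<in> borel_measurable M \<and> integrable M (\<lambda>x. (norm (g x))\<^sup>2) \<and>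
    (\<lambda>n. \<integral>x. (norm (f n x - g x))\<^sup>2 \<partial>M) \<longlonglongrightarrow> 0"
proof -
  interpret finite_measure M by fact
  have d: "integrable M (\<lambda>x. (norm (f m x - f n x))\<^sup>2)" for m n
    by (rule square_integrable_diff[OF f(1) f(1) f(2) f(2)])
  have "\<forall>k. \<exists>N. \<forall>m\<ge>N. \<forall>n\<ge>N. (\<integral>x. (norm (f m x - f n x))\<^sup>2 \<partial>M) < (1/4)^k"
    using cauchy by simp
  then obtain N where N: "\<And>k m n. m \<ge> N k \<Longrightarrow> n \<ge> N k \<Longrightarrow> (\<integral>x. (norm (f m x - f n x))\<^sup>2 \<partial>M) < (1/4)^k"
    by metis
  \<comment> \<open>Any index beyond all \<open>N j\<close> with j \<le> k would do; the sum makes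
    \<open>r k\<close> and \<open>r (Suc k)\<close> both at least \<open>N k\<close>, and the
    summand k makes \<open>r\<close> tend to infinity.\<close>
  define r where "r k = k + (\<Sum>j\<le>k. N j)" for k
  have rN: "r k \<ge> N k" for k unfolding r_def using member_le_sum[of k "{..k}" N] by simp
  have rS: "r (Suc k) \<ge> N k" for k unfolding r_def using member_le_sum[of k "{..Suc k}" N] by simp
  have rk: "r k \<ge> k" for k by (simp add: r_def)
  define u where "u k x = norm (f (r (Suc k)) x - f (r k) x)" for k x
  have um: "u k \<in> borel_measurable M" for k unfolding u_def using f(1) by measurable
  define c where "c = measure M (space M)"
  have ub: "(\<integral>\<^sup>+x. ennreal (u k x) \<partial>M) \<le> ennreal ((1/2)^k * (1 + c))" for k
  proof -
    \<comment> \<open>This comes from (2^k u - 1)^2 \<ge> 0. Since the integral of u^2 is below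
      4^-k, the integral of u is at most 2^-k (1 + c), which is summable.\<close>
    have "u k x \<le> 2^k * (u k x)\<^sup>2 + (1/2)^k" for x
    proof -
      have "2 * z \<le> z * z + 1" for z :: real
        using zero_le_power2[of "z - 1"] by (simp add: power2_eq_square algebra_simps)
      from this[of "2^k * u k x"] have "2 * (2^k * u k x) \<le> 2^k * 2^k * (u k x)\<^sup>2 + 1"
        by (simp only: power2_eq_square mult_ac)
      moreover have "0 \<le> 2^k * u k x" by (simp add: u_def)
      ultimately have "2^k * u k x \<le> 2^k * (2^k * (u k x)\<^sup>2 + (1/2)^k)"
        by (simp add: distrib_left power_one_over mult.assoc)
      then show ?thesis by simp
    qed
    then have "(\<integral>\<^sup>+x. ennreal (u k x) \<partial>M) \<le> (\<integral>\<^sup>+x. ennreal (2^k * (u k x)\<^sup>2 + (1/2)^k) \<partial>M)"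
      by (intro nn_integral_mono ennreal_leI)
    also have "\<dots> = ennreal (\<integral>x. 2^k * (u k x)\<^sup>2 + (1/2)^k \<partial>M)"
      using d[of "r (Suc k)" "r k"] by (intro nn_integral_eq_integral AE_I2) (auto simp: u_def)
    also have "(\<integral>x. 2^k * (u k x)\<^sup>2 + (1/2)^k \<partial>M) = 2^k * (\<integral>x. (u k x)\<^sup>2 \<partial>M) + (1/2)^k * c"
      using d[of "r (Suc k)" "r k"] by (simp add: u_def c_def mult.commute)
    also have "ennreal \<dots> \<le> ennreal ((1/2)^k * (1 + c))"
    proof (rule ennreal_leI)
      have "2^k * (\<integral>x. (u k x)\<^sup>2 \<partial>M) \<le> 2^k * (1/4)^k"
        using N[OF rS rN, of k] by (intro mult_left_mono) (auto simp: u_def)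
      also have "2^k * (1/4)^k = (1/2 :: real)^k" by (simp add: power_mult_distrib[symmetric])
      finally show "2^k * (\<integral>x. (u k x)\<^sup>2 \<partial>M) + (1/2)^k * c \<le> (1/2)^k * (1 + c)" by (simp add: distrib_left)
    qed
    finally show ?thesis .
  qed
  have "(\<integral>\<^sup>+x. (\<Sum>k. ennreal (u k x)) \<partial>M) = (\<Sum>k. \<integral>\<^sup>+x. ennreal (u k x) \<partial>M)"
    using um by (intro nn_integral_suminf) auto
  also have "\<dots> \<le> (\<Sum>k. ennreal ((1/2)^k * (1 + c)))" by (intro suminf_le ub) auto
  also have "\<dots> < \<infinity>"
  proof -
    have "summable (\<lambda>k. (1/2 :: real)^k * (1 + c))" by (intro summable_mult2 summable_geometric) simp
    moreover have "0 \<le> (1/2 :: real)^k * (1 + c)" for k by (simp add: c_def)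
    ultimately show ?thesis by (subst suminf_ennreal2) auto
  qed
  finally have "AE x in M. (\<Sum>k. ennreal (u k x)) \<noteq> \<infinity>"
    using um by (intro nn_integral_PInf_AE) auto
  then have conv: "AE x in M. convergent (\<lambda>k. f (r k) x)"
  proof eventually_elim
    case (elim x)
    have "summable (\<lambda>k. norm (f (r (Suc k)) x - f (r k) x))"
      using elim by (intro summable_suminf_not_top) (auto simp: u_def)
    then have "summable (\<lambda>k. f (r (Suc k)) x - f (r k) x)" by (rule summable_norm_cancel)
    then have "convergent (\<lambda>n. \<Sum>k<n. f (r (Suc k)) x - f (r k) x)" by (simp add: summable_iff_convergent)
    then have "convergent (\<lambda>n. f (r n) x - f (r 0) x)" by (simp only: sum_lessThan_telescope[of "\<lambda>k. f (r k) x"])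
    then show ?case by (simp add: convergent_diff_const_right_iff)
  qed
  define g where "g x = lim (\<lambda>k. f (r k) x)" for x
  have gm: "g \<in> borel_measurable M" unfolding g_def using f(1) by measurable
  have glim: "AE x in M. (\<lambda>k. f (r k) x) \<longlonglongrightarrow> g x"
    using conv by eventually_elim (simp add: g_def convergent_LIMSEQ_iff)
  \<comment> \<open>The limit \<open>g\<close> is reached only along the subsequence, so the whole
    sequence is compared with it by letting the second index of the Cauchy condition run through
    \<open>r k\<close>.\<close>
  have fatou: "(\<integral>\<^sup>+x. ennreal ((norm (f n x - g x))\<^sup>2) \<partial>M) \<le> ennreal e"
    if "e > 0" "\<forall>m\<ge>K. (\<integral>x. (norm (f n x - f m x))\<^sup>2 \<partial>M) < e" for e n K
  proof -
    have "(\<integral>\<^sup>+x. ennreal ((norm (f n x - g x))\<^sup>2) \<partial>M) = (\<integral>\<^sup>+x. liminf (\<lambda>k. ennreal ((norm (f n x - f (r k) x))\<^sup>2)) \<partial>M)"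
    proof (rule nn_integral_cong_AE)
      show "AE x in M. ennreal ((norm (f n x - g x))\<^sup>2) = liminf (\<lambda>k. ennreal ((norm (f n x - f (r k) x))\<^sup>2))"
        using glim
      proof eventually_elim
        case (elim x)
        then have "(\<lambda>k. ennreal ((norm (f n x - f (r k) x))\<^sup>2)) \<longlonglongrightarrow> ennreal ((norm (f n x - g x))\<^sup>2)"
          by (intro tendsto_ennrealI tendsto_power tendsto_norm tendsto_diff tendsto_const)
        then show ?case by (intro lim_imp_Liminf[symmetric]) auto
      qed
    qed
    also have "\<dots> \<le> liminf (\<lambda>k. \<integral>\<^sup>+x. ennreal ((norm (f n x - f (r k) x))\<^sup>2) \<partial>M)"
      using f(1) by (intro nn_integral_liminf) measurable
    also have "\<dots> \<le> limsup (\<lambda>k. \<integral>\<^sup>+x. ennreal ((norm (f n x - f (r k) x))\<^sup>2) \<partial>M)" by (rule Liminf_le_Limsup) simp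
    also have "\<dots> \<le> ennreal e"
    proof (rule Limsup_bounded)
      show "\<forall>\<^sub>F k in sequentially. (\<integral>\<^sup>+x. ennreal ((norm (f n x - f (r k) x))\<^sup>2) \<partial>M) \<le> ennreal e"
        unfolding eventually_sequentially
      proof (intro exI allI impI)
        fix k assume "k \<ge> K"
        then have "r k \<ge> K" using rk[of k] by linarith
        then have "(\<integral>x. (norm (f n x - f (r k) x))\<^sup>2 \<partial>M) \<le> e" using that(2) less_imp_le by blast
        moreover have "(\<integral>\<^sup>+x. ennreal ((norm (f n x - f (r k) x))\<^sup>2) \<partial>M) = ennreal (\<integral>x. (norm (f n x - f (r k) x))\<^sup>2 \<partial>M)"
          by (intro nn_integral_eq_integral d AE_I2) simp
        ultimately show "(\<integral>\<^sup>+x. ennreal ((norm (f n x - f (r k) x))\<^sup>2) \<partial>M) \<le> ennreal e" by (simp add: ennreal_leI)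
      qed
    qed
    finally show ?thesis .
  qed
  have dm: "(\<lambda>x. (norm (f n x - g x))\<^sup>2) \<in> borel_measurable M" for n using f(1) gm by measurable
  have int_le: "integrable M (\<lambda>x. (norm (f n x - g x))\<^sup>2)" "(\<integral>x. (norm (f n x - g x))\<^sup>2 \<partial>M) \<le> e"
    if e: "e > 0" and K: "\<forall>m\<ge>K. (\<integral>x. (norm (f n x - f m x))\<^sup>2 \<partial>M) < e" for e n K
  proof -
    show i: "integrable M (\<lambda>x. (norm (f n x - g x))\<^sup>2)"
      using fatou[OF e K] dm by (intro integrableI_bounded) (auto intro: le_less_trans)
    have "ennreal (\<integral>x. (norm (f n x - g x))\<^sup>2 \<partial>M) \<le> ennreal e"
      using fatou[OF e K] nn_integral_eq_integral[OF i] by simp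
    then show "(\<integral>x. (norm (f n x - g x))\<^sup>2 \<partial>M) \<le> e" using e by (simp add: ennreal_le_iff)
  qed
  obtain K where K: "\<forall>m\<ge>K. \<forall>n\<ge>K. (\<integral>x. (norm (f m x - f n x))\<^sup>2 \<partial>M) < 1" using cauchy[of 1] by auto
  then have iK: "integrable M (\<lambda>x. (norm (f K x - g x))\<^sup>2)" by (intro int_le(1)[of 1 K K]) auto
  have "integrable M (\<lambda>x. (norm (f K x - (f K x - g x)))\<^sup>2)"
    using f(1) gm by (intro square_integrable_diff f iK) measurable
  then have "integrable M (\<lambda>x. (norm (g x))\<^sup>2)" by simp
  moreover have "(\<lambda>n. \<integral>x. (norm (f n x - g x))\<^sup>2 \<partial>M) \<longlonglongrightarrow> 0"
  proof (rule LIMSEQ_I)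
    fix e :: real assume e: "e > 0"
    then obtain N where N: "\<forall>m\<ge>N. \<forall>n\<ge>N. (\<integral>x. (norm (f m x - f n x))\<^sup>2 \<partial>M) < e / 2" using cauchy[of "e / 2"] by auto
    have "norm ((\<integral>x. (norm (f n x - g x))\<^sup>2 \<partial>M) - 0) < e" if "n \<ge> N" for n
    proof -
      have "(\<integral>x. (norm (f n x - g x))\<^sup>2 \<partial>M) \<le> e / 2" using e N that by (intro int_le(2)[of _ N]) auto
      moreover have "(\<integral>x. (norm (f n x - g x))\<^sup>2 \<partial>M) \<ge> 0" by simp
      ultimately show ?thesis using e by simp
    qed
    then show "\<exists>no. \<forall>n\<ge>no. norm ((\<integral>x. (norm (f n x - g x))\<^sup>2 \<partial>M) - 0) < e" by blast
  qed
  ultimately show ?thesis using gm by blast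
qed

text \<open>Measurability is pieced together from countably many closed boxes. It is needed for
  \<open>weak_grad\<close>, about which only local integrability is known.\<close>

lemma L1_loc_measurable:
  fixes f :: "'a::euclidean_space \<Rightarrow> 'b::euclidean_space"
  assumes f: "f \<in> L1_loc \<Omega>" and \<Omega>: "open \<Omega>"
  shows "f \<in> borel_measurable (lebesgue_on \<Omega>)"
proof -
  obtain \<D> where D: "countable \<D>" "\<D> \<subseteq> Pow \<Omega>" "\<And>X. X \<in> \<D> \<Longrightarrow> \<exists>a b. X = cbox a b" "\<Union>\<D> = \<Omega>"
    using open_countable_Union_open_cbox[OF \<Omega>] by metis
  show ?thesis
  proof (rule measurable_piecewise_restrict[OF D(1)])
    fix X assume X: "X \<in> \<D>"
    then obtain a b where ab: "X = cbox a b" "X \<subseteq> \<Omega>" using D(2,3) by blast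
    then have i: "integrable (lebesgue_on X) f" using f by (auto simp: L1_loc_def)
    have "X \<inter> space (lebesgue_on \<Omega>) = X \<inter> \<Omega>" by (simp add: space_restrict_space)
    then show "X \<inter> space (lebesgue_on \<Omega>) \<in> sets (lebesgue_on \<Omega>)"
      unfolding sets_restrict_space using ab(1) by (auto simp: Int_commute)
    have "restrict_space (lebesgue_on \<Omega>) X = lebesgue_on X"
      using ab \<Omega> by (subst restrict_restrict_space) (auto simp: Int_absorb1 intro: sets_completionI_sets)
    then show "f \<in> borel_measurable (restrict_space (lebesgue_on \<Omega>) X)" using i by auto
  qed (use D in \<open>auto simp: space_restrict_space\<close>)
qed

section \<open>Integrability classes on a bounded open set\<close>

lemma finite_lebesgue_on:
  assumes "open \<Omega>" "bounded (\<Omega> :: 'a::euclidean_space set)" shows "finite_measure (lebesgue_on \<Omega>)"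
proof (rule finite_measureI)
  have S: "\<Omega> \<in> sets borel" using assms by auto
  have "emeasure (lebesgue_on \<Omega>) (space (lebesgue_on \<Omega>)) = emeasure lborel \<Omega>"
    using S by (simp add: space_restrict_space emeasure_restrict_space sets_completionI_sets)
  then show "emeasure (lebesgue_on \<Omega>) (space (lebesgue_on \<Omega>)) \<noteq> \<infinity>"
    using emeasure_bounded_finite[OF assms(2)] by simp
qed

lemma L2_integrable:
  fixes f :: "'a::euclidean_space \<Rightarrow> 'b::euclidean_space"
  assumes "open \<Omega>" "bounded \<Omega>" "f \<in> L2 \<Omega>"
  shows "integrable (lebesgue_on \<Omega>) f"
proof (rule Bochner_Integration.integrable_bound)
  interpret finite_measure "lebesgue_on \<Omega>" by (rule finite_lebesgue_on[OF assms(1,2)])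
  show "integrable (lebesgue_on \<Omega>) (\<lambda>x. 1 + (norm (f x))\<^sup>2)" using assms(3) by (simp add: L2_def)
  show "f \<in> borel_measurable (lebesgue_on \<Omega>)" using assms(3) by (simp add: L2_def)
  have "norm y \<le> 1 + (norm y)\<^sup>2" for y :: 'b
  proof -
    have "0 \<le> (norm y - 1)\<^sup>2" by simp
    then have "2 * norm y \<le> 1 + (norm y)\<^sup>2" by (simp add: power2_diff)
    then show ?thesis using norm_ge_zero[of y] by linarith
  qed
  then show "AE x in lebesgue_on \<Omega>. norm (f x) \<le> norm (1 + (norm (f x))\<^sup>2)" by (intro AE_I2) simp
qed

lemma integrable_L1_loc:
  fixes f :: "'a::euclidean_space \<Rightarrow> 'b::euclidean_space"
  assumes \<Omega>: "open \<Omega>" and f: "integrable (lebesgue_on \<Omega>) f"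
  shows "f \<in> L1_loc \<Omega>"
  unfolding L1_loc_def
proof (intro CollectI allI impI)
  fix K :: "'a set" assume K: "compact K \<and> K \<subseteq> \<Omega>"
  have S: "\<Omega> \<in> sets lebesgue" "K \<in> sets lebesgue"
    using \<Omega> K by (auto intro!: sets_completionI_sets borel_compact)
  have "integrable lebesgue (\<lambda>x. indicator \<Omega> x *\<^sub>R f x)" using f S by (simp add: integrable_restrict_space)
  from integrable_mult_indicator[OF S(2) this]
  have "integrable lebesgue (\<lambda>x. indicator K x *\<^sub>R (indicator \<Omega> x *\<^sub>R f x))" .
  moreover have "(\<lambda>x. indicator K x *\<^sub>R (indicator \<Omega> x *\<^sub>R f x)) = (\<lambda>x. indicator K x *\<^sub>R f x)"
    using K by (auto simp: indicator_def fun_eq_iff)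
  ultimately show "integrable (lebesgue_on K) f" using S by (simp add: integrable_restrict_space)
qed

lemma test_L2:
  assumes \<Omega>: "open \<Omega>" and \<phi>: "\<phi> \<in> test_functions \<Omega>"
  shows "\<phi> \<in> borel_measurable (lebesgue_on \<Omega>)" "grad \<phi> \<in> borel_measurable (lebesgue_on \<Omega>)"
    "integrable (lebesgue_on \<Omega>) (\<lambda>x. (norm (\<phi> x))\<^sup>2)" "integrable (lebesgue_on \<Omega>) (\<lambda>x. (norm (grad \<phi> x))\<^sup>2)"
    "(\<integral>x. (\<phi> x)\<^sup>2 \<partial>lebesgue_on \<Omega>) = (\<integral>x. (\<phi> x)\<^sup>2 \<partial>lebesgue)"
    "(\<integral>x. (norm (grad \<phi> x))\<^sup>2 \<partial>lebesgue_on \<Omega>) = (\<integral>x. (norm (grad \<phi> x))\<^sup>2 \<partial>lebesgue)"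
proof -
  have S: "\<Omega> \<in> sets lebesgue" using \<Omega> by (auto intro!: sets_completionI_sets)
  show "\<phi> \<in> borel_measurable (lebesgue_on \<Omega>)" "grad \<phi> \<in> borel_measurable (lebesgue_on \<Omega>)"
    by (rule continuous_imp_measurable_on_sets_lebesgue[OF test_continuous(1)[OF \<phi>] S],
        rule continuous_imp_measurable_on_sets_lebesgue[OF test_continuous(2)[OF \<phi>] S])
  show "integrable (lebesgue_on \<Omega>) (\<lambda>x. (norm (\<phi> x))\<^sup>2)"
    using integrable_lebesgue_on_vanish[OF S, of "\<lambda>x. (norm (\<phi> x))\<^sup>2"] test_outside[OF \<phi>] test_square_integrable[OF \<phi>] by simp
  show "integrable (lebesgue_on \<Omega>) (\<lambda>x. (norm (grad \<phi> x))\<^sup>2)"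
    using integrable_lebesgue_on_vanish[OF S, of "\<lambda>x. (norm (grad \<phi> x))\<^sup>2"] test_outside[OF \<phi>] test_square_integrable[OF \<phi>] by simp
  show "(\<integral>x. (\<phi> x)\<^sup>2 \<partial>lebesgue_on \<Omega>) = (\<integral>x. (\<phi> x)\<^sup>2 \<partial>lebesgue)"
    "(\<integral>x. (norm (grad \<phi> x))\<^sup>2 \<partial>lebesgue_on \<Omega>) = (\<integral>x. (norm (grad \<phi> x))\<^sup>2 \<partial>lebesgue)"
    using test_outside[OF \<phi>] by (auto intro!: integral_lebesgue_on_vanish S)
qed


lemma test_in_L2:
  assumes "open \<Omega>" "\<phi> \<in> test_functions \<Omega>"
  shows "\<phi> \<in> L2 \<Omega>" "grad \<phi> \<in> L2 \<Omega>"
  using test_L2[OF assms] by (auto simp: L2_def)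

lemma test_has_weak_grad:
  assumes \<Omega>: "open \<Omega>" "bounded \<Omega>" and \<phi>: "\<phi> \<in> test_functions \<Omega>"
  shows "has_weak_grad \<Omega> \<phi> (grad \<phi>)"
  unfolding has_weak_grad_def
proof (intro conjI ballI)
  have S: "\<Omega> \<in> sets lebesgue" using \<Omega> by (auto intro!: sets_completionI_sets)
  show "\<phi> \<in> L1_loc \<Omega>" "grad \<phi> \<in> L1_loc \<Omega>"
    by (intro integrable_L1_loc[OF \<Omega>(1)] L2_integrable[OF \<Omega>] test_in_L2[OF \<Omega>(1) \<phi>])+
  fix \<eta> and i :: 'a assume \<eta>: "\<eta> \<in> test_functions \<Omega>" and i: "i \<in> Basis"
  have "(\<integral>x. \<phi> x * (grad \<eta> x \<bullet> i) \<partial>lebesgue_on \<Omega>) = (\<integral>x. \<phi> x * (grad \<eta> x \<bullet> i) \<partial>lebesgue)"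
    using test_outside[OF \<eta>] by (intro integral_lebesgue_on_vanish S) auto
  also have "\<dots> = - (\<integral>x. (grad \<phi> x \<bullet> i) * \<eta> x \<partial>lebesgue)"
    by (rule integration_by_parts_component[OF test_Ck[OF \<phi>] test_Ck[OF \<eta>] \<Omega>(2) _ i]) (use test_outside[OF \<eta>] in auto)
  also have "(\<integral>x. (grad \<phi> x \<bullet> i) * \<eta> x \<partial>lebesgue) = (\<integral>x. (grad \<phi> x \<bullet> i) * \<eta> x \<partial>lebesgue_on \<Omega>)"
    using test_outside[OF \<eta>] by (intro integral_lebesgue_on_vanish[symmetric] S) auto
  finally show "(\<integral>x. \<phi> x * (grad \<eta> x \<bullet> i) \<partial>lebesgue_on \<Omega>) = - (\<integral>x. (grad \<phi> x \<bullet> i) * \<eta> x \<partial>lebesgue_on \<Omega>)" .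
qed

lemma has_weak_grad_weak_grad: "has_weak_grad \<Omega> u p \<Longrightarrow> has_weak_grad \<Omega> u (weak_grad \<Omega> u)"
  unfolding weak_grad_def by (rule someI[of "has_weak_grad \<Omega> u"])

text \<open>The functional whose Euler-Lagrange equation is the weak form of - \<Delta> \<psi> =
  \<zeta>.\<close>

definition dirichlet_energy :: "'a::euclidean_space set \<Rightarrow> ('a \<Rightarrow> real) \<Rightarrow> ('a \<Rightarrow> real) \<Rightarrow> real" where
  "dirichlet_energy \<Omega> \<zeta> \<psi> =
     (\<integral>x. (norm (grad \<psi> x))\<^sup>2 \<partial>lebesgue_on \<Omega>) / 2 - (\<integral>x. \<zeta> x * \<psi> x \<partial>lebesgue_on \<Omega>)"

section \<open>Existence of a weak solution by the direct method\<close>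

context
  fixes \<Omega> :: "'a::euclidean_space set" and \<zeta> :: "'a \<Rightarrow> real"
  assumes \<Omega>: "open \<Omega>" "bounded \<Omega>" and \<zeta>: "\<zeta> \<in> L2 \<Omega>"
begin

lemma zeta_times_test: "\<psi> \<in> test_functions \<Omega> \<Longrightarrow> integrable (lebesgue_on \<Omega>) (\<lambda>x. \<zeta> x * \<psi> x)"
  using integrable_inner_square[of \<zeta> "lebesgue_on \<Omega>" \<psi>] test_L2[OF \<Omega>(1)] \<zeta> by (simp add: L2_def)

lemma grad_inner_test:
  "\<phi> \<in> test_functions \<Omega> \<Longrightarrow> \<psi> \<in> test_functions \<Omega> \<Longrightarrow> integrable (lebesgue_on \<Omega>) (\<lambda>x. grad \<phi> x \<bullet> grad \<psi> x)"
  by (intro integrable_inner_square test_L2[OF \<Omega>(1)])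

text \<open>The energy is quadratic along lines. The expansion is used twice: at t = 1 and t = 1/2
  to show that minimising sequences are Cauchy, and for arbitrary t to derive the Euler-Lagrange
  equation.\<close>

lemma dirichlet_energy_add:
  assumes \<psi>: "\<psi> \<in> test_functions \<Omega>" and \<eta>: "\<eta> \<in> test_functions \<Omega>"
  shows "dirichlet_energy \<Omega> \<zeta> (\<lambda>x. \<psi> x + t * \<eta> x) = dirichlet_energy \<Omega> \<zeta> \<psi>
    + t * ((\<integral>x. grad \<psi> x \<bullet> grad \<eta> x \<partial>lebesgue_on \<Omega>) - (\<integral>x. \<zeta> x * \<eta> x \<partial>lebesgue_on \<Omega>))
    + t\<^sup>2 / 2 * (\<integral>x. (norm (grad \<eta> x))\<^sup>2 \<partial>lebesgue_on \<Omega>)"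
proof -
  have g: "grad (\<lambda>x. \<psi> x + t * \<eta> x) x = grad \<psi> x + t *\<^sub>R grad \<eta> x" for x
    by (simp add: test_grad_add[OF \<psi> test_cmult[OF \<eta>]] test_grad_cmult[OF \<eta>])
  have "(\<integral>x. (norm (grad (\<lambda>x. \<psi> x + t * \<eta> x) x))\<^sup>2 \<partial>lebesgue_on \<Omega>)
    = (\<integral>x. (norm (grad \<psi> x))\<^sup>2 + 2 * t * (grad \<psi> x \<bullet> grad \<eta> x) + t\<^sup>2 * (norm (grad \<eta> x))\<^sup>2 \<partial>lebesgue_on \<Omega>)"
    unfolding g power2_norm_eq_inner
    by (intro Bochner_Integration.integral_cong refl) (simp add: inner_add_left inner_add_right inner_commute power2_eq_square)
  also have "\<dots> = (\<integral>x. (norm (grad \<psi> x))\<^sup>2 \<partial>lebesgue_on \<Omega>) + 2 * t * (\<integral>x. grad \<psi> x \<bullet> grad \<eta> x \<partial>lebesgue_on \<Omega>)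
     + t\<^sup>2 * (\<integral>x. (norm (grad \<eta> x))\<^sup>2 \<partial>lebesgue_on \<Omega>)"
    using test_L2(4)[OF \<Omega>(1) \<psi>] test_L2(4)[OF \<Omega>(1) \<eta>] grad_inner_test[OF \<psi> \<eta>] by simp
  moreover have "(\<integral>x. \<zeta> x * (\<psi> x + t * \<eta> x) \<partial>lebesgue_on \<Omega>) = (\<integral>x. \<zeta> x * \<psi> x \<partial>lebesgue_on \<Omega>) + t * (\<integral>x. \<zeta> x * \<eta> x \<partial>lebesgue_on \<Omega>)"
  proof -
    have "(\<integral>x. \<zeta> x * (\<psi> x + t * \<eta> x) \<partial>lebesgue_on \<Omega>) = (\<integral>x. \<zeta> x * \<psi> x + t * (\<zeta> x * \<eta> x) \<partial>lebesgue_on \<Omega>)"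
      by (intro Bochner_Integration.integral_cong refl) (simp add: algebra_simps)
    then show ?thesis using zeta_times_test[OF \<psi>] zeta_times_test[OF \<eta>] by simp
  qed
  ultimately show ?thesis unfolding dirichlet_energy_def by (simp add: algebra_simps add_divide_distrib)
qed

text \<open>Young's inequality with the Poincare constant C as weight bounds the linear term by the
  integral of \<psi>^2 over 2 C, which the Poincare inequality absorbs into the quadratic term, plus
  a quantity depending on \<zeta> alone.\<close>

lemma dirichlet_energy_bounded_below: "\<exists>m. \<forall>\<psi>\<in>test_functions \<Omega>. m \<le> dirichlet_energy \<Omega> \<zeta> \<psi>"
proof -
  obtain C where C: "C > 0" "\<And>\<phi>. \<phi> \<in> test_functions \<Omega> \<Longrightarrow>
    (\<integral>x. (\<phi> x)\<^sup>2 \<partial>lebesgue) \<le> C * (\<integral>x. (norm (grad \<phi> x))\<^sup>2 \<partial>lebesgue)"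
    using poincare_inequality[OF \<Omega>(2)] by blast
  have "- (C * (\<integral>x. (\<zeta> x)\<^sup>2 \<partial>lebesgue_on \<Omega>)) / 2 \<le> dirichlet_energy \<Omega> \<zeta> \<psi>" if \<psi>: "\<psi> \<in> test_functions \<Omega>" for \<psi>
  proof -
    have \<zeta>2: "integrable (lebesgue_on \<Omega>) (\<lambda>x. (\<zeta> x)\<^sup>2)" using \<zeta> by (simp add: L2_def)
    have \<psi>2: "integrable (lebesgue_on \<Omega>) (\<lambda>x. (\<psi> x)\<^sup>2)" using test_L2(3)[OF \<Omega>(1) \<psi>] by simp
    have "(\<integral>x. \<zeta> x * \<psi> x \<partial>lebesgue_on \<Omega>) \<le> (\<integral>x. (\<psi> x)\<^sup>2 / (2 * C) + C * (\<zeta> x)\<^sup>2 / 2 \<partial>lebesgue_on \<Omega>)"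
    proof (rule integral_mono[OF zeta_times_test[OF \<psi>]])
      show "integrable (lebesgue_on \<Omega>) (\<lambda>x. (\<psi> x)\<^sup>2 / (2 * C) + C * (\<zeta> x)\<^sup>2 / 2)" using \<zeta>2 \<psi>2 by simp
      show "\<zeta> x * \<psi> x \<le> (\<psi> x)\<^sup>2 / (2 * C) + C * (\<zeta> x)\<^sup>2 / 2" for x
        using abs_inner_le_young[OF C(1), of "\<psi> x" "\<zeta> x"] by (simp add: mult.commute)
    qed
    also have "\<dots> = (\<integral>x. (\<psi> x)\<^sup>2 \<partial>lebesgue_on \<Omega>) / (2 * C) + C * (\<integral>x. (\<zeta> x)\<^sup>2 \<partial>lebesgue_on \<Omega>) / 2" using \<zeta>2 \<psi>2 by simp
    also have "(\<integral>x. (\<psi> x)\<^sup>2 \<partial>lebesgue_on \<Omega>) / (2 * C) \<le> (\<integral>x. (norm (grad \<psi> x))\<^sup>2 \<partial>lebesgue_on \<Omega>) / 2"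
      using C(2)[OF \<psi>] C(1) test_L2(5,6)[OF \<Omega>(1) \<psi>] by (simp add: field_simps)
    finally show ?thesis unfolding dirichlet_energy_def by simp
  qed
  then show ?thesis by blast
qed

text \<open>The energy is minimised over test functions only, so membership of the limit in
  \<open>H1_0\<close> is witnessed by the minimising sequence itself. Convexity makes its gradients
  Cauchy, and the Poincare inequality transfers this to the functions.\<close>

lemma poisson_weak_solution:
  "\<exists>\<phi> g. \<phi> \<in> H1_0 \<Omega> \<and> g \<in> L2 \<Omega> \<and> has_weak_grad \<Omega> \<phi> g \<and> has_weak_div \<Omega> g (\<lambda>x. - \<zeta> x)"
proof -
  let ?M = "lebesgue_on \<Omega>" and ?E = "dirichlet_energy \<Omega> \<zeta>"
  have fm: "finite_measure ?M" by (rule finite_lebesgue_on[OF \<Omega>])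
  obtain C where C: "C > 0" "\<And>\<phi>. \<phi> \<in> test_functions \<Omega> \<Longrightarrow>
    (\<integral>x. (\<phi> x)\<^sup>2 \<partial>lebesgue) \<le> C * (\<integral>x. (norm (grad \<phi> x))\<^sup>2 \<partial>lebesgue)"
    using poincare_inequality[OF \<Omega>(2)] by blast
  define m where "m = (INF \<psi>\<in>test_functions \<Omega>. ?E \<psi>)"
  have ne: "test_functions \<Omega> \<noteq> {}" using test_zero by blast
  have bdd: "bdd_below (?E ` test_functions \<Omega>)" using dirichlet_energy_bounded_below by (auto simp: bdd_below_def)
  have m_le: "m \<le> ?E \<psi>" if "\<psi> \<in> test_functions \<Omega>" for \<psi> unfolding m_def by (rule cINF_lower[OF bdd that])
  have "\<exists>\<psi>\<in>test_functions \<Omega>. ?E \<psi> < m + 1 / Suc k" for k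
    using cINF_less_iff[OF ne bdd, of "m + 1 / Suc k"] by (simp add: m_def[symmetric])
  then obtain \<psi> where \<psi>: "\<And>k. \<psi> k \<in> test_functions \<Omega>" "\<And>k. ?E (\<psi> k) < m + 1 / Suc k" by metis
  note T = test_L2[OF \<Omega>(1) \<psi>(1)]
  have diff: "(\<lambda>x. \<psi> j x - \<psi> k x) \<in> test_functions \<Omega>" "grad (\<lambda>x. \<psi> j x - \<psi> k x) x = grad (\<psi> j) x - grad (\<psi> k) x" for j k x
    using test_add[OF \<psi>(1)[of j] test_cmult[OF \<psi>(1)[of k], of "-1"]]
      test_grad_add[OF \<psi>(1)[of j] test_cmult[OF \<psi>(1)[of k], of "-1"], of x] test_grad_cmult[OF \<psi>(1)[of k], of "-1" x]
    by simp_all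
  \<comment> \<open>The midpoint of two members of the sequence has energy at least m. Eliminating
    the linear term D between the expansions at t = 1 and t = 1/2 leaves A \<le> 4 (E_j + E_k - 2
    m).\<close>
  have para: "(\<integral>x. (norm (grad (\<psi> j) x - grad (\<psi> k) x))\<^sup>2 \<partial>?M) \<le> 4 * (1 / Suc j + 1 / Suc k)" for j k
  proof -
    let ?\<eta> = "\<lambda>x. \<psi> j x - \<psi> k x"
    define D where "D = (\<integral>x. grad (\<psi> k) x \<bullet> grad ?\<eta> x \<partial>?M) - (\<integral>x. \<zeta> x * ?\<eta> x \<partial>?M)"
    define A where "A = (\<integral>x. (norm (grad ?\<eta> x))\<^sup>2 \<partial>?M)"
    have e: "?E (\<lambda>x. \<psi> k x + t * ?\<eta> x) = ?E (\<psi> k) + t * D + t\<^sup>2 / 2 * A" for t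
      unfolding D_def A_def by (rule dirichlet_energy_add[OF \<psi>(1) diff(1)])
    have "?E (\<psi> j) = ?E (\<psi> k) + D + A / 2" using e[of 1] by simp
    moreover have "m \<le> ?E (\<psi> k) + D / 2 + A / 8"
      using m_le[OF test_add[OF \<psi>(1)[of k] test_cmult[OF diff(1)[of j k], of "1/2"]]] e[of "1/2"]
      by (simp add: power2_eq_square)
    ultimately have "A \<le> 4 * (?E (\<psi> j) + ?E (\<psi> k) - 2 * m)" by argo
    also have "\<dots> \<le> 4 * (1 / Suc j + 1 / Suc k)" using \<psi>(2)[of j] \<psi>(2)[of k] by argo
    finally show ?thesis unfolding A_def diff(2) .
  qed
  have small: "\<exists>N. \<forall>j\<ge>N. \<forall>k\<ge>N. B * (4 * (1 / Suc j + 1 / Suc k)) < e" if "e > 0" "B > 0" for e B :: real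
  proof -
    have "0 < e / (8 * B)" using that by simp
    then obtain N where N: "inverse (real (Suc N)) < e / (8 * B)" using reals_Archimedean by blast
    have NB: "B * (8 * (1 / Suc N)) < e" using N that by (simp add: field_simps)
    have "B * (4 * (1 / Suc j + 1 / Suc k)) < e" if jk: "j \<ge> N" "k \<ge> N" for j k
    proof (rule le_less_trans[OF _ NB])
      have "1 / real (Suc j) \<le> 1 / Suc N" "1 / real (Suc k) \<le> 1 / Suc N" using jk by (simp_all add: frac_le)
      then have "4 * (1 / real (Suc j) + 1 / Suc k) \<le> 8 * (1 / Suc N)" by argo
      then show "B * (4 * (1 / real (Suc j) + 1 / Suc k)) \<le> B * (8 * (1 / Suc N))"
        using \<open>B > 0\<close> by (intro mult_left_mono) auto
    qed
    then show ?thesis by blast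
  qed
  obtain g where g: "g \<in> borel_measurable ?M" "integrable ?M (\<lambda>x. (norm (g x))\<^sup>2)"
    "(\<lambda>n. \<integral>x. (norm (grad (\<psi> n) x - g x))\<^sup>2 \<partial>?M) \<longlonglongrightarrow> 0"
  proof (atomize_elim, rule L2_complete[OF fm T(2,4)])
    fix e :: real assume "e > 0"
    then obtain N where "\<forall>j\<ge>N. \<forall>k\<ge>N. 1 * (4 * (1 / Suc j + 1 / Suc k)) < e" using small[of e 1] by auto
    then have "(\<integral>x. (norm (grad (\<psi> j) x - grad (\<psi> k) x))\<^sup>2 \<partial>?M) < e" if "j \<ge> N" "k \<ge> N" for j k
      using that by (intro le_less_trans[OF para]) simp
    then show "\<exists>N. \<forall>j\<ge>N. \<forall>k\<ge>N. (\<integral>x. (norm (grad (\<psi> j) x - grad (\<psi> k) x))\<^sup>2 \<partial>?M) < e" by blast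
  qed
  obtain \<phi> :: "'a \<Rightarrow> real" where \<phi>: "\<phi> \<in> borel_measurable ?M" "integrable ?M (\<lambda>x. (norm (\<phi> x))\<^sup>2)"
    "(\<lambda>n. \<integral>x. (norm (\<psi> n x - \<phi> x))\<^sup>2 \<partial>?M) \<longlonglongrightarrow> 0"
  proof (atomize_elim, rule L2_complete[OF fm T(1,3)])
    fix e :: real assume "e > 0"
    have *: "(\<integral>x. (norm (\<psi> j x - \<psi> k x))\<^sup>2 \<partial>?M) \<le> C * (4 * (1 / Suc j + 1 / Suc k))" for j k
    proof -
      have "(\<integral>x. (norm (\<psi> j x - \<psi> k x))\<^sup>2 \<partial>?M) \<le> C * (\<integral>x. (norm (grad (\<psi> j) x - grad (\<psi> k) x))\<^sup>2 \<partial>?M)"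
        using C(2)[OF diff(1)[of j k]] test_L2(5,6)[OF \<Omega>(1) diff(1)[of j k]] by (simp add: diff(2))
      also have "\<dots> \<le> C * (4 * (1 / Suc j + 1 / Suc k))" using C(1) para by (intro mult_left_mono) auto
      finally show ?thesis .
    qed
    obtain N where "\<forall>j\<ge>N. \<forall>k\<ge>N. C * (4 * (1 / Suc j + 1 / Suc k)) < e" using small[OF \<open>e > 0\<close> C(1)] by auto
    then have "(\<integral>x. (norm (\<psi> j x - \<psi> k x))\<^sup>2 \<partial>?M) < e" if "j \<ge> N" "k \<ge> N" for j k
      using that by (intro le_less_trans[OF *]) simp
    then show "\<exists>N. \<forall>j\<ge>N. \<forall>k\<ge>N. (\<integral>x. (norm (\<psi> j x - \<psi> k x))\<^sup>2 \<partial>?M) < e" by blast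
  qed
  have gL2: "g \<in> L2 \<Omega>" and \<phi>L2: "\<phi> \<in> L2 \<Omega>" using g \<phi> by (auto simp: L2_def)
  have loc: "g \<in> L1_loc \<Omega>" "\<phi> \<in> L1_loc \<Omega>" "(\<lambda>x. - \<zeta> x) \<in> L1_loc \<Omega>"
    using L2_integrable[OF \<Omega> gL2] L2_integrable[OF \<Omega> \<phi>L2] L2_integrable[OF \<Omega> \<zeta>]
    by (auto intro: integrable_L1_loc[OF \<Omega>(1)])
  have wg: "has_weak_grad \<Omega> \<phi> g"
    unfolding has_weak_grad_def
  proof (intro conjI loc ballI)
    fix \<eta> and i :: 'a assume \<eta>: "\<eta> \<in> test_functions \<Omega>" and i: "i \<in> Basis"
    note H = test_L2[OF \<Omega>(1) \<eta>]
    have gi: "(\<lambda>x. grad \<eta> x \<bullet> i) \<in> borel_measurable ?M" using H(2) by measurable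
    have gi2: "integrable ?M (\<lambda>x. (norm (grad \<eta> x \<bullet> i))\<^sup>2)"
    proof (rule Bochner_Integration.integrable_bound[OF H(4)])
      show "(\<lambda>x. (norm (grad \<eta> x \<bullet> i))\<^sup>2) \<in> borel_measurable ?M" using gi by measurable
      show "AE x in ?M. norm ((norm (grad \<eta> x \<bullet> i))\<^sup>2) \<le> norm ((norm (grad \<eta> x))\<^sup>2)"
      proof (intro AE_I2)
        fix x
        have "(norm (grad \<eta> x \<bullet> i))\<^sup>2 \<le> (norm (grad \<eta> x))\<^sup>2"
          using Basis_le_norm[OF i, of "grad \<eta> x"] by (intro power_mono) auto
        then show "norm ((norm (grad \<eta> x \<bullet> i))\<^sup>2) \<le> norm ((norm (grad \<eta> x))\<^sup>2)" by simp
      qed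
    qed
    have "(\<lambda>n. \<integral>x. \<psi> n x \<bullet> (grad \<eta> x \<bullet> i) \<partial>?M) \<longlonglongrightarrow> (\<integral>x. \<phi> x \<bullet> (grad \<eta> x \<bullet> i) \<partial>?M)"
      by (rule L2_limit_inner[OF T(1,3) \<phi>(1,2) gi gi2 \<phi>(3)])
    moreover have "(\<lambda>n. \<integral>x. grad (\<psi> n) x \<bullet> (\<eta> x *\<^sub>R i) \<partial>?M) \<longlonglongrightarrow> (\<integral>x. g x \<bullet> (\<eta> x *\<^sub>R i) \<partial>?M)"
    proof (rule L2_limit_inner[OF T(2,4) g(1,2) _ _ g(3)])
      show "(\<lambda>x. \<eta> x *\<^sub>R i) \<in> borel_measurable ?M" using H(1) by measurable
      show "integrable ?M (\<lambda>x. (norm (\<eta> x *\<^sub>R i))\<^sup>2)" using H(3) i by simp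
    qed
    moreover have "(\<integral>x. \<psi> n x \<bullet> (grad \<eta> x \<bullet> i) \<partial>?M) = - (\<integral>x. grad (\<psi> n) x \<bullet> (\<eta> x *\<^sub>R i) \<partial>?M)" for n
      using test_has_weak_grad[OF \<Omega> \<psi>(1), of n] \<eta> i unfolding has_weak_grad_def by (simp add: mult.commute)
    ultimately have "(\<integral>x. \<phi> x \<bullet> (grad \<eta> x \<bullet> i) \<partial>?M) = - (\<integral>x. g x \<bullet> (\<eta> x *\<^sub>R i) \<partial>?M)"
      using LIMSEQ_unique[OF _ tendsto_minus] by simp
    then show "(\<integral>x. \<phi> x * (grad \<eta> x \<bullet> i) \<partial>?M) = - (\<integral>x. (g x \<bullet> i) * \<eta> x \<partial>?M)" by (simp add: mult.commute)
  qed
  have euler: "(\<integral>x. g x \<bullet> grad \<eta> x \<partial>?M) = (\<integral>x. \<zeta> x * \<eta> x \<partial>?M)" if \<eta>: "\<eta> \<in> test_functions \<Omega>" for \<eta>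
  proof -
    note H = test_L2[OF \<Omega>(1) \<eta>]
    define D where "D = (\<integral>x. g x \<bullet> grad \<eta> x \<partial>?M) - (\<integral>x. \<zeta> x * \<eta> x \<partial>?M)"
    define A where "A = (\<integral>x. (norm (grad \<eta> x))\<^sup>2 \<partial>?M)"
    have A: "A \<ge> 0" unfolding A_def by simp
    have lim: "(\<lambda>n. \<integral>x. grad (\<psi> n) x \<bullet> grad \<eta> x \<partial>?M) \<longlonglongrightarrow> (\<integral>x. g x \<bullet> grad \<eta> x \<partial>?M)"
      by (rule L2_limit_inner[OF T(2,4) g(1,2) H(2,4) g(3)])
    \<comment> \<open>Perturbing the n-th minimiser by t \<eta> cannot lower its energy by more than
      1/(n+1); the limit in n gives the inequality for \<open>g\<close>, without evaluating the
      energy at the limit function.\<close>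
    have nonneg: "t * D + t\<^sup>2 / 2 * A \<ge> 0" for t
    proof (rule LIMSEQ_le_const)
      show "(\<lambda>n. t * ((\<integral>x. grad (\<psi> n) x \<bullet> grad \<eta> x \<partial>?M) - (\<integral>x. \<zeta> x * \<eta> x \<partial>?M)) + t\<^sup>2 / 2 * A + 1 / Suc n)
         \<longlonglongrightarrow> t * D + t\<^sup>2 / 2 * A"
      proof -
        have "(\<lambda>n. t * ((\<integral>x. grad (\<psi> n) x \<bullet> grad \<eta> x \<partial>?M) - (\<integral>x. \<zeta> x * \<eta> x \<partial>?M)) + t\<^sup>2 / 2 * A + 1 / Suc n)
         \<longlonglongrightarrow> t * D + t\<^sup>2 / 2 * A + 0"
          unfolding D_def by (intro tendsto_add tendsto_mult tendsto_diff tendsto_const lim LIMSEQ_Suc[OF lim_1_over_n])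
        then show ?thesis by simp
      qed
      have "0 \<le> t * ((\<integral>x. grad (\<psi> n) x \<bullet> grad \<eta> x \<partial>?M) - (\<integral>x. \<zeta> x * \<eta> x \<partial>?M)) + t\<^sup>2 / 2 * A + 1 / Suc n" for n
        using m_le[OF test_add[OF \<psi>(1)[of n] test_cmult[OF \<eta>, of t]]] \<psi>(2)[of n] dirichlet_energy_add[OF \<psi>(1)[of n] \<eta>, of t]
        unfolding A_def by linarith
      then show "\<exists>N. \<forall>n\<ge>N. 0 \<le> t * ((\<integral>x. grad (\<psi> n) x \<bullet> grad \<eta> x \<partial>?M) - (\<integral>x. \<zeta> x * \<eta> x \<partial>?M)) + t\<^sup>2 / 2 * A + 1 / Suc n"
        by blast
    qed
    have "D\<^sup>2 \<le> 0"
    proof -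
      \<comment> \<open>Inserting t = - D/(A + 1) makes the quadratic expression negative unless D =
        0; the summand 1 covers A = 0.\<close>
      have "0 \<le> (- D / (A + 1)) * D + (- D / (A + 1))\<^sup>2 / 2 * A" by (rule nonneg)
      also have "\<dots> = - (D\<^sup>2) * (A + 2) / (2 * (A + 1)\<^sup>2)"
      proof -
        have "(- D / B) * D + (- D / B)\<^sup>2 / 2 * (B - 1) = - (D\<^sup>2) * (B + 1) / (2 * B\<^sup>2)" if "B \<noteq> 0" for B
          using that by (simp add: field_simps power2_eq_square)
        from this[of "A + 1"] show ?thesis using A by (simp add: add.commute)
      qed
      finally have "0 \<le> - (D\<^sup>2) * (A + 2) / (2 * (A + 1)\<^sup>2)" .
      moreover have "0 < 2 * (A + 1)\<^sup>2" using A by simp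
      ultimately have "0 \<le> - (D\<^sup>2) * (A + 2)" by (simp only: pos_le_divide_eq mult_zero_left)
      then have "D\<^sup>2 * (A + 2) \<le> 0" by simp
      then show ?thesis using A by (simp add: mult_le_0_iff)
    qed
    then show ?thesis by (simp add: D_def)
  qed
  have "has_weak_div \<Omega> g (\<lambda>x. - \<zeta> x)"
    unfolding has_weak_div_def by (intro conjI loc ballI) (simp add: euler)
  moreover have "\<phi> \<in> H1_0 \<Omega>"
    unfolding H1_0_def H1_def
  proof (intro CollectI conjI \<phi>L2 exI[of _ \<psi>] allI \<psi>(1))
    show "\<exists>p\<in>L2 \<Omega>. has_weak_grad \<Omega> \<phi> p" using wg gL2 by blast
    show "(\<lambda>k. \<integral>x. (\<psi> k x - \<phi> x)\<^sup>2 \<partial>?M) \<longlonglongrightarrow> 0" using \<phi>(3) by simp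
    \<comment> \<open>\<open>H1_0\<close> refers to the chosen \<open>weak_grad\<close>, which
      agrees with \<open>g\<close> almost everywhere by uniqueness.\<close>
    have wg': "has_weak_grad \<Omega> \<phi> (weak_grad \<Omega> \<phi>)" by (rule has_weak_grad_weak_grad[OF wg])
    then have "weak_grad \<Omega> \<phi> \<in> borel_measurable ?M"
      by (intro L1_loc_measurable[OF _ \<Omega>(1)]) (simp add: has_weak_grad_def)
    then have "(\<integral>x. (norm (grad (\<psi> k) x - weak_grad \<Omega> \<phi> x))\<^sup>2 \<partial>?M) = (\<integral>x. (norm (grad (\<psi> k) x - g x))\<^sup>2 \<partial>?M)" for k
      using T(2)[of k] g(1) weak_grad_unique[OF \<Omega>(1) wg' wg]
      by (intro integral_cong_AE) (auto intro!: borel_measurable_power borel_measurable_norm borel_measurable_diff)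
    then show "(\<lambda>k. \<integral>x. (norm (grad (\<psi> k) x - weak_grad \<Omega> \<phi> x))\<^sup>2 \<partial>?M) \<longlonglongrightarrow> 0" using g(3) by simp
  qed
  ultimately show ?thesis using gL2 wg by blast
qed

end

section \<open>The subdifferential\<close>

lemma L2_inner_integrable:
  assumes "\<zeta> \<in> L2 \<Omega>" "\<xi> \<in> L2 \<Omega>" shows "integrable (lebesgue_on \<Omega>) (\<lambda>x. \<zeta> x * \<xi> x :: real)"
  using integrable_inner_square[of \<zeta> "lebesgue_on \<Omega>" \<xi>] assms by (simp add: L2_def)

text \<open>A test function is its own Lipschitz representative, and its chosen weak gradient is the
  classical one almost everywhere. A bound of \<zeta> by \<open>Jfun\<close> thereby becomes a bound
  by the supremum norm of the gradient field.\<close>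

lemma Jfun_test_le:
  fixes \<phi> :: "'a::euclidean_space \<Rightarrow> real"
  assumes \<Omega>: "open \<Omega>" "bounded \<Omega>" and \<phi>: "\<phi> \<in> test_functions \<Omega>" and B: "\<And>x. norm (grad \<phi> x) \<le> B"
  shows "Jfun \<Omega> \<phi> \<le> ereal B"
proof -
  note wg = test_has_weak_grad[OF \<Omega> \<phi>] and T = test_L2[OF \<Omega>(1) \<phi>]
  obtain M where M: "\<And>x. \<bar>\<phi> x\<bar> \<le> M" using test_bounded[OF \<phi>] by metis
  have B0: "B \<ge> 0" using B[of 0] norm_ge_zero[of "grad \<phi> 0"] by linarith
  have "\<phi> \<in> Linf \<Omega>" using T(1) M unfolding Linf_def by (auto intro!: exI[of _ M])
  moreover have "grad \<phi> \<in> Linf \<Omega>" using T(2) B unfolding Linf_def by (auto intro!: exI[of _ B])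
  ultimately have "\<phi> \<in> W1inf \<Omega>" using wg unfolding W1inf_def by blast
  moreover have "B-lipschitz_on (closure \<Omega>) \<phi>"
  proof (rule lipschitz_onI[OF _ B0])
    fix x y
    have "\<bar>\<phi> x - \<phi> y\<bar> \<le> B * norm (x - y)"
      by (rule norm_diff_le_grad_bound[of _ _ \<phi> "grad \<phi>"]) (auto intro: Ck_GDERIV[OF test_Ck[OF \<phi>]] B)
    then show "dist (\<phi> x) (\<phi> y) \<le> B * dist x y" by (simp add: dist_norm)
  qed
  moreover have "\<phi> x = 0" if "x \<in> frontier \<Omega>" for x
    using that \<Omega>(1) by (intro test_outside(1)[OF \<phi>]) (simp add: frontier_def interior_open)
  ultimately have W: "\<phi> \<in> W1inf_0 \<Omega>" unfolding W1inf_0_def by blast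
  note wg' = has_weak_grad_weak_grad[OF wg]
  have "weak_grad \<Omega> \<phi> \<in> borel_measurable (lebesgue_on \<Omega>)"
    using wg' by (intro L1_loc_measurable[OF _ \<Omega>(1)]) (simp add: has_weak_grad_def)
  then have "(\<lambda>x. ereal (norm (weak_grad \<Omega> \<phi> x))) \<in> borel_measurable (lebesgue_on \<Omega>)" by measurable
  moreover have "AE x in lebesgue_on \<Omega>. ereal (norm (weak_grad \<Omega> \<phi> x)) \<le> ereal B"
    using weak_grad_unique[OF \<Omega>(1) wg' wg] by eventually_elim (simp add: B)
  ultimately have "esssup (lebesgue_on \<Omega>) (\<lambda>x. ereal (norm (weak_grad \<Omega> \<phi> x))) \<le> ereal B" by (rule esssup_I)
  then show ?thesis using W by (simp add: Jfun_def)
qed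

text \<open>\<open>q\<close> can be tested only with gradients of test functions, so v is replaced
  by test functions that are uniformly close and have the same gradient bound. Uniform closeness
  suffices because \<zeta> is integrable on the bounded set.\<close>

lemma L2_inner_le_Jfun:
  fixes q :: "'a::euclidean_space set \<Rightarrow> 'a"
  assumes \<Omega>: "open \<Omega>" "bounded \<Omega>" "\<Omega> \<noteq> {}" and q: "q \<in> vector_measures \<Omega>" and tv: "total_variation \<Omega> q \<Omega> \<le> 1"
    and \<zeta>: "\<zeta> \<in> L2 \<Omega>" "\<And>\<phi>. \<phi> \<in> test_functions \<Omega> \<Longrightarrow> vector_integral \<Omega> q (grad \<phi>) = L2_inner \<Omega> \<zeta> \<phi>"
    and v: "v \<in> L2 \<Omega>"
  shows "ereal (L2_inner \<Omega> \<zeta> v) \<le> Jfun \<Omega> v"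
proof (cases "v \<in> W1inf_0 \<Omega>")
  case False
  then show ?thesis by (simp add: Jfun_def)
next
  case True
  let ?M = "lebesgue_on \<Omega>"
  have S: "\<Omega> \<in> sets lebesgue" using \<Omega>(1) by (auto intro!: sets_completionI_sets)
  obtain w C p where w: "C-lipschitz_on (closure \<Omega>) w" "AE x in ?M. w x = v x" "\<And>x. x \<in> frontier \<Omega> \<Longrightarrow> w x = 0"
    and p: "has_weak_grad \<Omega> v p"
    using True unfolding W1inf_0_def W1inf_def by blast
  note wg = has_weak_grad_weak_grad[OF p]
  show ?thesis
  proof (rule ereal_le_real)
    \<comment> \<open>Every real upper bound of the extended real value is treated, so that all
      later estimates are between real numbers.\<close>
    fix L :: real assume L: "Jfun \<Omega> v \<le> ereal L"
    have AE: "AE x in ?M. norm (weak_grad \<Omega> v x) \<le> L"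
      using esssup_AE[of "\<lambda>x. ereal (norm (weak_grad \<Omega> v x))" ?M]
    proof eventually_elim
      case (elim x)
      then have "ereal (norm (weak_grad \<Omega> v x)) \<le> Jfun \<Omega> v" using True by (simp add: Jfun_def)
      then have "ereal (norm (weak_grad \<Omega> v x)) \<le> ereal L" using L by (rule order_trans)
      then show ?case by simp
    qed
    \<comment> \<open>A negative L would make the bound on the norm false almost everywhere, and a
      nonempty open set would be negligible.\<close>
    have L0: "L \<ge> 0"
    proof (rule ccontr)
      assume "\<not> L \<ge> 0"
      have "AE x in ?M. False" using AE
      proof eventually_elim
        case (elim x)
        then show ?case using norm_ge_zero[of "weak_grad \<Omega> v x"] \<open>\<not> L \<ge> 0\<close> by linarith
      qed
      then have "AE x in lebesgue. x \<notin> \<Omega>" using S by (simp add: AE_restrict_space_iff)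
      then have "negligible \<Omega>" by (simp add: negligible_iff_null_sets AE_iff_null_sets[OF S])
      then show False using open_not_negligible \<Omega> by blast
    qed
    define W where "W x = (if x \<in> \<Omega> then w x else 0)" for x
    have Wlip: "\<bar>W x - W y\<bar> \<le> L * norm (x - y)" for x y
      unfolding W_def by (rule zero_extension_lipschitz[OF \<Omega>(1,2) w(1,3,2) wg AE L0])
    have W0: "W x = 0" if "x \<notin> \<Omega>" for x using that by (simp add: W_def)
    have "AE x in ?M. x \<in> \<Omega>" by (intro AE_I2) (simp add: space_restrict_space)
    with w(2) have WV: "AE x in ?M. W x = v x" by eventually_elim (simp add: W_def)
    define Z where "Z = (\<integral>x. \<bar>\<zeta> x\<bar> \<partial>?M)"
    have Z: "Z \<ge> 0" unfolding Z_def by simp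
    have \<zeta>i: "integrable ?M \<zeta>" by (rule L2_integrable[OF \<Omega>(1,2) \<zeta>(1)])
    have "L2_inner \<Omega> \<zeta> v \<le> L + e * Z" if e: "e > 0" for e
    proof -
      obtain \<eta> where \<eta>: "\<eta> \<in> test_functions \<Omega>" "\<And>x. \<bar>\<eta> x - W x\<bar> \<le> e" "\<And>x. norm (grad \<eta> x) \<le> L"
      proof (rule test_function_approximation[OF \<Omega>(1,2) L0 Wlip])
        show "W x = 0" if "x \<notin> \<Omega>" for x by (rule W0[OF that])
        show "e > 0" by (rule e)
      qed (rule that)
      note i1 = L2_inner_integrable[OF \<zeta>(1) v] and i2 = L2_inner_integrable[OF \<zeta>(1) test_in_L2(1)[OF \<Omega>(1) \<eta>(1)]]
      have "L2_inner \<Omega> \<zeta> v - L2_inner \<Omega> \<zeta> \<eta> = (\<integral>x. \<zeta> x * v x - \<zeta> x * \<eta> x \<partial>?M)"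
        unfolding L2_inner_def using i1 i2 by simp
      also have "\<dots> \<le> (\<integral>x. e * \<bar>\<zeta> x\<bar> \<partial>?M)"
      proof (rule integral_mono_AE)
        show "AE x in ?M. \<zeta> x * v x - \<zeta> x * \<eta> x \<le> e * \<bar>\<zeta> x\<bar>"
          using WV
        proof eventually_elim
          case (elim x)
          have "\<zeta> x * v x - \<zeta> x * \<eta> x \<le> \<bar>\<zeta> x * (v x - \<eta> x)\<bar>" by (simp add: right_diff_distrib)
          also have "\<dots> = \<bar>\<eta> x - W x\<bar> * \<bar>\<zeta> x\<bar>" by (simp add: elim abs_mult abs_minus_commute mult.commute)
          also have "\<dots> \<le> e * \<bar>\<zeta> x\<bar>" by (intro mult_right_mono \<eta>(2)) simp
          finally show ?case .
        qed
      qed (use i1 i2 \<zeta>i in auto)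
      also have "\<dots> = e * Z" by (simp add: Z_def)
      finally have "L2_inner \<Omega> \<zeta> v \<le> L2_inner \<Omega> \<zeta> \<eta> + e * Z" by simp
      moreover have "L2_inner \<Omega> \<zeta> \<eta> \<le> L"
        unfolding \<zeta>(2)[OF \<eta>(1), symmetric]
        by (rule vector_integral_le[OF \<Omega>(1) q tv continuous_borel_measurable[OF test_continuous(2)[OF \<eta>(1)]] \<eta>(3)])
      ultimately show ?thesis by linarith
    qed
    note le = this
    have "L2_inner \<Omega> \<zeta> v \<le> L"
    proof (rule field_le_epsilon)
      fix e :: real assume e: "e > 0"
      have "L2_inner \<Omega> \<zeta> v \<le> L + e / (Z + 1) * Z" using e Z by (intro le) simp
      also have "e / (Z + 1) * Z \<le> e" using e Z by (simp add: field_simps)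
      finally show "L2_inner \<Omega> \<zeta> v \<le> L + e" by simp
    qed
    then show "ereal (L2_inner \<Omega> \<zeta> v) \<le> ereal L" by simp
  qed
qed

section \<open>From the dual bound to the vector measure and its decomposition\<close>

lemma field_measure_component:
  fixes g :: "'a::euclidean_space \<Rightarrow> 'a"
  assumes \<Omega>: "open \<Omega>" and g: "integrable (lebesgue_on \<Omega>) g" and A: "A \<in> borel_sets_on \<Omega>"
  shows "field_measure g A \<bullet> i = measure (density_measure \<Omega> (\<lambda>x. g x \<bullet> i)) A - measure (density_measure \<Omega> (\<lambda>x. - (g x \<bullet> i))) A"
proof -
  have S: "\<Omega> \<in> sets lebesgue" and A': "A \<subseteq> \<Omega>" "A \<in> sets lebesgue"
    using \<Omega> A by (auto simp: borel_sets_on_iff intro!: sets_completionI_sets)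
  have "integrable lebesgue (\<lambda>x. indicator \<Omega> x *\<^sub>R g x)" using g S by (simp add: integrable_restrict_space)
  from integrable_mult_indicator[OF A'(2) this]
  have "integrable lebesgue (\<lambda>x. indicator A x *\<^sub>R (indicator \<Omega> x *\<^sub>R g x))" .
  moreover have "(\<lambda>x. indicator A x *\<^sub>R (indicator \<Omega> x *\<^sub>R g x)) = (\<lambda>x. indicator A x *\<^sub>R g x)"
    using A'(1) by (auto simp: indicator_def fun_eq_iff)
  ultimately have "integrable (lebesgue_on A) g" using A'(2) by (simp add: integrable_restrict_space)
  then have "field_measure g A \<bullet> i = (\<integral>x. g x \<bullet> i \<partial>lebesgue_on A)" by (simp add: field_measure_def)
  also have "\<dots> = measure (density_measure \<Omega> (\<lambda>x. g x \<bullet> i)) A - measure (density_measure \<Omega> (\<lambda>x. - (g x \<bullet> i))) A"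
    using g by (intro measure_density_measure[OF \<Omega> _ A, symmetric]) simp
  finally show ?thesis .
qed

lemma vector_measures_componentI:
  fixes q :: "'a::euclidean_space set \<Rightarrow> 'a"
  assumes "\<And>i. i \<in> Basis \<Longrightarrow> signed_measure_on \<Omega> (\<lambda>A. q A \<bullet> i)"
  shows "q \<in> vector_measures \<Omega>"
  unfolding vector_measures_def
proof (intro CollectI allI impI)
  fix A :: "nat \<Rightarrow> 'a set" assume A: "range A \<subseteq> borel_sets_on \<Omega> \<and> disjoint_family A"
  have "(\<lambda>n. (q (A n) \<bullet> i) *\<^sub>R i) sums ((q (\<Union>n. A n) \<bullet> i) *\<^sub>R i)" if "i \<in> Basis" for i
    using assms[OF that] A unfolding signed_measure_on_def
    by (intro bounded_linear.sums[OF bounded_linear_scaleR_left]) blast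
  then have "(\<lambda>n. \<Sum>i\<in>Basis. (q (A n) \<bullet> i) *\<^sub>R i) sums (\<Sum>i\<in>Basis. (q (\<Union>n. A n) \<bullet> i) *\<^sub>R i)" by (rule sums_sum)
  then show "(\<lambda>n. q (A n)) sums q (\<Union>n. A n)" by (simp add: euclidean_representation)
qed

lemma vector_measures_add:
  "q \<in> vector_measures \<Omega> \<Longrightarrow> r \<in> vector_measures \<Omega> \<Longrightarrow> (\<lambda>A. q A + r A) \<in> vector_measures \<Omega>"
  unfolding vector_measures_def by (auto intro: sums_add)

lemma field_measure_vector_measure:
  fixes g :: "'a::euclidean_space \<Rightarrow> 'a"
  assumes \<Omega>: "open \<Omega>" and g: "integrable (lebesgue_on \<Omega>) g"
  shows "field_measure g \<in> vector_measures \<Omega>"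
proof (rule vector_measures_componentI)
  fix i :: 'a
  let ?N = "\<lambda>b. density_measure \<Omega> (\<lambda>x. if b then g x \<bullet> i else - (g x \<bullet> i))"
  have gi: "integrable (lebesgue_on \<Omega>) (\<lambda>x. if b then g x \<bullet> i else - (g x \<bullet> i))" for b using g by (cases b) auto
  show "signed_measure_on \<Omega> (\<lambda>A. field_measure g A \<bullet> i)"
  proof (rule signed_measure_on_combination[OF \<Omega>, where I=UNIV and N="?N" and c="\<lambda>b. if b then 1 else -1"])
    show "finite_measure (?N b)" "sets (?N b) = borel_sets_on \<Omega>" for b
      by (rule finite_density_measure[OF \<Omega> gi], rule sets_density_measure[OF \<Omega> gi])
    show "field_measure g A \<bullet> i = (\<Sum>b\<in>UNIV. (if b then 1 else -1) * measure (?N b) A)" if "A \<in> borel_sets_on \<Omega>" for A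
      using field_measure_component[OF \<Omega> g that] by (simp add: UNIV_bool)
  qed simp
qed

text \<open>The representation is applied to the graph of \<open>grad \<phi>\<close> against the
  integral of \<zeta> \<phi>, whose norm bound is the hypothesis restricted to test functions. As q
  and g dx have the same integrals against gradients, their difference is divergence free.\<close>

lemma dual_bound_imp_measure:
  fixes \<Omega> :: "'a::euclidean_space set"
  assumes \<Omega>: "open \<Omega>" "bounded \<Omega>" and \<zeta>: "\<zeta> \<in> L2 \<Omega>"
    and le: "\<And>v. v \<in> L2 \<Omega> \<Longrightarrow> ereal (L2_inner \<Omega> \<zeta> v) \<le> Jfun \<Omega> v"
    and g: "g \<in> L2 \<Omega>" "has_weak_div \<Omega> g (\<lambda>x. - \<zeta> x)"
  obtains q where "total_variation \<Omega> q \<Omega> \<le> 1"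
    "\<And>\<phi>. \<phi> \<in> test_functions \<Omega> \<Longrightarrow> vector_integral \<Omega> q (grad \<phi>) = L2_inner \<Omega> \<zeta> \<phi>"
    "(\<lambda>A. q A - field_measure g A) \<in> N_div \<Omega>"
proof -
  have S: "\<Omega> \<in> sets borel" using \<Omega>(1) by simp
  have gi: "integrable (lebesgue_on \<Omega>) g" by (rule L2_integrable[OF \<Omega> g(1)])
  define G where "G = (\<lambda>\<phi>. (grad \<phi>, L2_inner \<Omega> \<zeta> \<phi>)) ` test_functions \<Omega>"
  have GI: "(F, a) \<in> G" if "\<phi> \<in> test_functions \<Omega>" "\<And>x. F x = grad \<phi> x" "a = L2_inner \<Omega> \<zeta> \<phi>" for F a \<phi>
  proof -
    have "F = grad \<phi>" using that(2) by auto
    then show ?thesis using that by (auto simp: G_def)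
  qed
  have GE: "\<exists>\<phi>\<in>test_functions \<Omega>. F = grad \<phi> \<and> a = L2_inner \<Omega> \<zeta> \<phi>" if "(F, a) \<in> G" for F a
    using that by (auto simp: G_def)
  have int: "integrable (lebesgue_on \<Omega>) (\<lambda>x. \<zeta> x * \<phi> x)" if "\<phi> \<in> test_functions \<Omega>" for \<phi>
    by (rule L2_inner_integrable[OF \<zeta> test_in_L2(1)[OF \<Omega>(1) that]])
  have "\<exists>(\<nu> :: 'a measure) (\<mu> :: 'a \<Rightarrow> 'a measure). sets \<nu> = sets borel \<and> (\<forall>i\<in>Basis. sets (\<mu> i) = sets borel) \<and>
    finite_measure \<nu> \<and> (\<forall>i\<in>Basis. finite_measure (\<mu> i)) \<and> measure \<nu> UNIV \<le> 1 \<and>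
    (\<forall>A\<in>sets borel. norm (\<Sum>i\<in>Basis. (measure (\<mu> i) A - measure \<nu> A) *\<^sub>R i) \<le> measure \<nu> A) \<and>
    (\<forall>F a. (F, a) \<in> G \<longrightarrow> a = (\<Sum>i\<in>Basis. (\<integral>x. F x \<bullet> i \<partial>\<mu> i) - (\<integral>x. F x \<bullet> i \<partial>\<nu>)))"
  proof (rule vector_riesz_representation[OF \<Omega>(2), of G])
    show "continuous_on UNIV F" if "(F, a) \<in> G" for F a using GE[OF that] test_continuous(2) by blast
    show "F x = 0" if "(F, a) \<in> G" "x \<notin> \<Omega>" for F a x using GE[OF that(1)] test_outside(2) that(2) by blast
    show "((\<lambda>x. 0), 0) \<in> G" by (rule GI[OF test_zero]) (simp_all add: grad_const L2_inner_def)
    show "((\<lambda>x. F x + F' x), a + a') \<in> G" if FG: "(F, a) \<in> G" "(F', a') \<in> G" for F a F' a'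
    proof -
      obtain \<phi> \<phi>' where *: "\<phi> \<in> test_functions \<Omega>" "F = grad \<phi>" "a = L2_inner \<Omega> \<zeta> \<phi>"
        "\<phi>' \<in> test_functions \<Omega>" "F' = grad \<phi>'" "a' = L2_inner \<Omega> \<zeta> \<phi>'" using GE[OF FG(1)] GE[OF FG(2)] by blast
      show ?thesis
        by (rule GI[OF test_add[OF *(1,4)]])
          (use * int[OF *(1)] int[OF *(4)] in \<open>simp_all add: test_grad_add L2_inner_def distrib_left\<close>)
    qed
    show "((\<lambda>x. c *\<^sub>R F x), c * a) \<in> G" if FG: "(F, a) \<in> G" for F a c
    proof -
      obtain \<phi> where *: "\<phi> \<in> test_functions \<Omega>" "F = grad \<phi>" "a = L2_inner \<Omega> \<zeta> \<phi>" using GE[OF FG] by blast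
      have "L2_inner \<Omega> \<zeta> (\<lambda>x. c * \<phi> x) = c * L2_inner \<Omega> \<zeta> \<phi>"
        unfolding L2_inner_def by (simp add: mult.left_commute)
      then show ?thesis by (intro GI[OF test_cmult[OF *(1), of c]]) (simp_all add: *(2,3) test_grad_cmult[OF *(1)])
    qed
    show "a \<le> B" if FG: "(F, a) \<in> G" and B: "\<And>x. norm (F x) \<le> B" for F a B
    proof -
      obtain \<phi> where *: "\<phi> \<in> test_functions \<Omega>" "F = grad \<phi>" "a = L2_inner \<Omega> \<zeta> \<phi>" using GE[OF FG] by blast
      have "ereal a \<le> Jfun \<Omega> \<phi>" unfolding *(3) by (rule le[OF test_in_L2(1)[OF \<Omega>(1) *(1)]])
      also have "\<dots> \<le> ereal B" by (rule Jfun_test_le[OF \<Omega> *(1)]) (use B *(2) in simp)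
      finally show ?thesis by simp
    qed
  qed
  then obtain \<nu> :: "'a measure" and \<mu> :: "'a \<Rightarrow> 'a measure"
    where "sets \<nu> = sets borel" "\<forall>i\<in>Basis. sets (\<mu> i) = sets borel"
      "finite_measure \<nu>" "\<forall>i\<in>Basis. finite_measure (\<mu> i)" and \<nu>1: "measure \<nu> UNIV \<le> 1"
      and "\<forall>A\<in>sets borel. norm (\<Sum>i\<in>Basis. (measure (\<mu> i) A - measure \<nu> A) *\<^sub>R i) \<le> measure \<nu> A"
      and "\<forall>F a. (F, a) \<in> G \<longrightarrow> a = (\<Sum>i\<in>Basis. (\<integral>x. F x \<bullet> i \<partial>\<mu> i) - (\<integral>x. F x \<bullet> i \<partial>\<nu>))"
    by (elim exE conjE)
  then have sets: "sets \<nu> = sets borel" "\<And>i. i \<in> Basis \<Longrightarrow> sets (\<mu> i) = sets borel"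
    and fin: "finite_measure \<nu>" "\<And>i. i \<in> Basis \<Longrightarrow> finite_measure (\<mu> i)"
    and bound: "\<And>A. A \<in> sets borel \<Longrightarrow> norm (\<Sum>i\<in>Basis. (measure (\<mu> i) A - measure \<nu> A) *\<^sub>R i) \<le> measure \<nu> A"
    and rep: "\<And>F a. (F, a) \<in> G \<Longrightarrow> a = (\<Sum>i\<in>Basis. (\<integral>x. F x \<bullet> i \<partial>\<mu> i) - (\<integral>x. F x \<bullet> i \<partial>\<nu>))"
    by blast+
  define q where "q A = (\<Sum>i\<in>Basis. (measure (\<mu> i) A - measure \<nu> A) *\<^sub>R i)" for A
  \<comment> \<open>Four nonnegative measures for each coordinate: two for q, with signs 1 and -1,
    and the two halves of g dx, with signs -1 and 1 since it is subtracted. The signs are recorded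
    in \<open>c\<close>.\<close>
  define N where "N i k = (if k = (0::nat) then restrict_space (\<mu> i) \<Omega> else if k = 1 then restrict_space \<nu> \<Omega>
     else if k = 2 then density_measure \<Omega> (\<lambda>x. g x \<bullet> i) else density_measure \<Omega> (\<lambda>x. - (g x \<bullet> i)))" for i k
  define c :: "nat \<Rightarrow> real" where "c k = (if k = 0 \<or> k = 3 then 1 else -1)" for k
  have gci: "integrable (lebesgue_on \<Omega>) (\<lambda>x. g x \<bullet> i)" "integrable (lebesgue_on \<Omega>) (\<lambda>x. - (g x \<bullet> i))" for i
    using gi by auto
  have restr_fin: "finite_measure (restrict_space m \<Omega>)" and restr_sets: "sets (restrict_space m \<Omega>) = borel_sets_on \<Omega>"
    and restr_measure: "A \<in> borel_sets_on \<Omega> \<Longrightarrow> measure (restrict_space m \<Omega>) A = measure m A"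
    if m: "finite_measure m" "sets m = sets borel" for m A
  proof -
    show "finite_measure (restrict_space m \<Omega>)"
      using m S by (intro finite_measure_restrict_space) simp_all
    show "sets (restrict_space m \<Omega>) = borel_sets_on \<Omega>" by (rule sets_restrict_space_cong[OF m(2)])
    assume "A \<in> borel_sets_on \<Omega>"
    then have "A \<subseteq> \<Omega>" "A \<in> sets m" using \<Omega>(1) m(2) by (simp_all add: borel_sets_on_iff)
    moreover have "\<Omega> \<inter> space m \<in> sets m" using S m(2) by (simp add: sets_eq_imp_space_eq[OF m(2)])
    ultimately show "measure (restrict_space m \<Omega>) A = measure m A" by (intro measure_restrict_space)
  qed
  have N_fin: "finite_measure (N i k)" if i: "i \<in> Basis" for i k
    unfolding N_def
    by (simp add: restr_fin fin sets i finite_density_measure[OF \<Omega>(1) gci(1)] finite_density_measure[OF \<Omega>(1) gci(2)])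
  have N_sets: "sets (N i k) = borel_sets_on \<Omega>" if i: "i \<in> Basis" for i k
    unfolding N_def
    by (simp add: restr_sets fin sets i sets_density_measure[OF \<Omega>(1) gci(1)] sets_density_measure[OF \<Omega>(1) gci(2)])
  have N_measure: "measure (N i 0) A = measure (\<mu> i) A" "measure (N i (Suc 0)) A = measure \<nu> A"
    if i: "i \<in> Basis" and A: "A \<in> borel_sets_on \<Omega>" for i A
    using restr_measure[OF fin(2)[OF i] sets(2)[OF i] A] restr_measure[OF fin(1) sets(1) A] unfolding N_def by simp_all
  have q_component: "q A \<bullet> i = (\<Sum>k\<in>{0, 1}. c k * measure (N i k) A)" if "i \<in> Basis" "A \<in> borel_sets_on \<Omega>" for i A
    using that N_measure[OF that] by (simp add: q_def c_def)
  have r_component: "(q A - field_measure g A) \<bullet> i = (\<Sum>k\<in>{0, 1, 2, 3}. c k * measure (N i k) A)"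
    if "i \<in> Basis" "A \<in> borel_sets_on \<Omega>" for i A
    using q_component[OF that] field_measure_component[OF \<Omega>(1) gi that(2), of i]
    by (simp add: inner_diff_left c_def) (simp add: N_def)
  have bnd: "\<exists>M. \<forall>x. \<bar>grad \<phi> x \<bullet> i\<bar> \<le> M" if "\<phi> \<in> test_functions \<Omega>" "i \<in> Basis" for \<phi> i
    using test_bounded[OF that(1)] Basis_le_norm[OF that(2)] by (metis order_trans)
  have bm: "(\<lambda>x. grad \<phi> x \<bullet> i) \<in> borel_measurable borel" if "\<phi> \<in> test_functions \<Omega>" for \<phi> i
    using continuous_borel_measurable[OF test_continuous(2)[OF that]] by measurable
  have q_integral: "vector_integral \<Omega> q (grad \<phi>) = (\<Sum>i\<in>Basis. \<Sum>k\<in>{0, 1}. c k * (\<integral>x. grad \<phi> x \<bullet> i \<partial>N i k))"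
    if \<phi>: "\<phi> \<in> test_functions \<Omega>" for \<phi>
    unfolding vector_integral_def
  proof (rule sum.cong[OF refl])
    fix i :: 'a assume i: "i \<in> Basis"
    obtain M where M: "\<And>x. \<bar>grad \<phi> x \<bullet> i\<bar> \<le> M" using bnd[OF \<phi> i] by blast
    show "(\<integral>x. grad \<phi> x \<bullet> i \<partial>jordan_pos \<Omega> (\<lambda>A. q A \<bullet> i)) - (\<integral>x. grad \<phi> x \<bullet> i \<partial>jordan_pos \<Omega> (\<lambda>A. - (q A \<bullet> i)))
      = (\<Sum>k\<in>{0, 1}. c k * (\<integral>x. grad \<phi> x \<bullet> i \<partial>N i k))"
      by (rule jordan_integral_combination[OF \<Omega>(1) _ N_fin[OF i] N_sets[OF i] q_component[OF i] bm[OF \<phi>] M]) simp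
  qed
  have r_integral: "vector_integral \<Omega> (\<lambda>A. q A - field_measure g A) (grad \<phi>)
     = (\<Sum>i\<in>Basis. \<Sum>k\<in>{0, 1, 2, 3}. c k * (\<integral>x. grad \<phi> x \<bullet> i \<partial>N i k))"
    if \<phi>: "\<phi> \<in> test_functions \<Omega>" for \<phi>
    unfolding vector_integral_def
  proof (rule sum.cong[OF refl])
    fix i :: 'a assume i: "i \<in> Basis"
    obtain M where M: "\<And>x. \<bar>grad \<phi> x \<bullet> i\<bar> \<le> M" using bnd[OF \<phi> i] by blast
    show "(\<integral>x. grad \<phi> x \<bullet> i \<partial>jordan_pos \<Omega> (\<lambda>A. (q A - field_measure g A) \<bullet> i)) - (\<integral>x. grad \<phi> x \<bullet> i \<partial>jordan_pos \<Omega> (\<lambda>A. - ((q A - field_measure g A) \<bullet> i)))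
      = (\<Sum>k\<in>{0, 1, 2, 3}. c k * (\<integral>x. grad \<phi> x \<bullet> i \<partial>N i k))"
      by (rule jordan_integral_combination[OF \<Omega>(1) _ N_fin[OF i] N_sets[OF i] r_component[OF i] bm[OF \<phi>] M]) simp
  qed
  \<comment> \<open>The representing measures live on the whole space; gradients of test functions
    vanish off \<Omega>, so discarding the mass there changes no integral.\<close>
  have restr: "(\<integral>x. grad \<phi> x \<bullet> i \<partial>restrict_space m \<Omega>) = (\<integral>x. grad \<phi> x \<bullet> i \<partial>m)"
    if "\<phi> \<in> test_functions \<Omega>" "sets m = sets borel" for \<phi> m i
  proof -
    have "(\<integral>x. grad \<phi> x \<bullet> i \<partial>restrict_space m \<Omega>) = (\<integral>x. indicator \<Omega> x *\<^sub>R (grad \<phi> x \<bullet> i) \<partial>m)"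
      using that(2) S by (intro integral_restrict_space) (simp add: sets_eq_imp_space_eq)
    also have "\<dots> = (\<integral>x. grad \<phi> x \<bullet> i \<partial>m)"
      by (intro Bochner_Integration.integral_cong refl) (auto simp: indicator_def test_outside(2)[OF that(1)])
    finally show ?thesis .
  qed
  have q_eq: "vector_integral \<Omega> q (grad \<phi>) = L2_inner \<Omega> \<zeta> \<phi>" if \<phi>: "\<phi> \<in> test_functions \<Omega>" for \<phi>
  proof -
    have "vector_integral \<Omega> q (grad \<phi>) = (\<Sum>i\<in>Basis. (\<integral>x. grad \<phi> x \<bullet> i \<partial>\<mu> i) - (\<integral>x. grad \<phi> x \<bullet> i \<partial>\<nu>))"
      unfolding q_integral[OF \<phi>] by (intro sum.cong refl) (simp add: c_def N_def restr[OF \<phi>] sets)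
    also have "\<dots> = L2_inner \<Omega> \<zeta> \<phi>" by (rule rep[symmetric, OF GI[OF \<phi>]]) auto
    finally show ?thesis .
  qed
  show ?thesis
  proof (rule that[of q])
    show "vector_integral \<Omega> q (grad \<phi>) = L2_inner \<Omega> \<zeta> \<phi>" if "\<phi> \<in> test_functions \<Omega>" for \<phi> by (rule q_eq[OF that])
    show "total_variation \<Omega> q \<Omega> \<le> 1"
      unfolding total_variation_def
    proof (rule SUP_least)
      interpret finite_measure \<nu> by (rule fin)
      fix A :: "nat \<Rightarrow> 'a set"
      assume "A \<in> {A. range A \<subseteq> borel_sets_on \<Omega> \<and> disjoint_family A \<and> (\<Union>i. A i) = \<Omega>}"
      then have A: "range A \<subseteq> borel_sets_on \<Omega>" "disjoint_family A" "(\<Union>i. A i) = \<Omega>" by blast+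
      have Ab: "A i \<in> sets borel" for i
      proof -
        have "A i \<in> borel_sets_on \<Omega>" using A(1) by blast
        then show ?thesis by (simp add: borel_sets_on_iff[OF \<Omega>(1)])
      qed
      \<comment> \<open>Domination by the single measure \<open>\<nu>\<close> turns the sum over any
        partition into its mass on \<Omega>, which is at most 1.\<close>
      have "(\<Sum>i. ennreal (norm (q (A i)))) \<le> (\<Sum>i. emeasure \<nu> (A i))"
      proof (intro suminf_le summableI)
        show "ennreal (norm (q (A i))) \<le> emeasure \<nu> (A i)" for i
          unfolding emeasure_eq_measure q_def by (rule ennreal_leI[OF bound[OF Ab]])
      qed
      also have "\<dots> = emeasure \<nu> (\<Union>i. A i)" using Ab A(2) sets(1) by (intro suminf_emeasure) auto
      also have "\<dots> \<le> emeasure \<nu> UNIV" using sets(1) by (intro emeasure_mono) auto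
      also have "\<dots> \<le> 1" using \<nu>1 by (simp add: emeasure_eq_measure)
      finally show "(\<Sum>i. ennreal (norm (q (A i)))) \<le> 1" .
    qed
    show "(\<lambda>A. q A - field_measure g A) \<in> N_div \<Omega>"
      unfolding N_div_def
    proof (intro CollectI conjI ballI)
      show "(\<lambda>A. q A - field_measure g A) \<in> vector_measures \<Omega>"
      proof (rule vector_measures_componentI)
        fix i :: 'a assume i: "i \<in> Basis"
        show "signed_measure_on \<Omega> (\<lambda>A. (q A - field_measure g A) \<bullet> i)"
          by (rule signed_measure_on_combination[OF \<Omega>(1) _ N_fin[OF i] N_sets[OF i] r_component[OF i]]) simp
      qed
      fix \<phi> assume \<phi>: "\<phi> \<in> test_functions \<Omega>"
      \<comment> \<open>Subtracting the coordinate integrals of g dx leaves the integral of \<zeta>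
        \<phi> minus that of g \<bullet> grad \<phi>, and these coincide because g has divergence -
        \<zeta>.\<close>
      have "vector_integral \<Omega> (\<lambda>A. q A - field_measure g A) (grad \<phi>)
        = vector_integral \<Omega> q (grad \<phi>) - (\<Sum>i\<in>Basis. \<integral>x. (grad \<phi> x \<bullet> i) * (g x \<bullet> i) \<partial>lebesgue_on \<Omega>)"
        unfolding q_integral[OF \<phi>] r_integral[OF \<phi>] sum_subtractf[symmetric]
      proof (rule sum.cong[OF refl])
        fix i :: 'a assume i: "i \<in> Basis"
        obtain M where M: "\<And>x. \<bar>grad \<phi> x \<bullet> i\<bar> \<le> M" using bnd[OF \<phi> i] by blast
        show "(\<Sum>k\<in>{0, 1, 2, 3}. c k * (\<integral>x. grad \<phi> x \<bullet> i \<partial>N i k))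
          = (\<Sum>k\<in>{0, 1}. c k * (\<integral>x. grad \<phi> x \<bullet> i \<partial>N i k)) - (\<integral>x. (grad \<phi> x \<bullet> i) * (g x \<bullet> i) \<partial>lebesgue_on \<Omega>)"
          using integral_density_measure[OF \<Omega>(1) gci(1)[of i] bm[OF \<phi>] M] by (simp add: c_def) (simp add: N_def)
      qed
      also have "(\<Sum>i\<in>Basis. \<integral>x. (grad \<phi> x \<bullet> i) * (g x \<bullet> i) \<partial>lebesgue_on \<Omega>) = (\<integral>x. g x \<bullet> grad \<phi> x \<partial>lebesgue_on \<Omega>)"
      proof -
        have "integrable (lebesgue_on \<Omega>) (\<lambda>x. (grad \<phi> x \<bullet> i) * (g x \<bullet> i))" if i: "i \<in> Basis" for i
        proof -
          obtain M where M: "\<And>x. \<bar>grad \<phi> x \<bullet> i\<bar> \<le> M" using bnd[OF \<phi> i] by blast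
          show ?thesis
          proof (rule Bochner_Integration.integrable_bound)
            show "integrable (lebesgue_on \<Omega>) (\<lambda>x. M * (g x \<bullet> i))" using gci(1) by simp
            show "(\<lambda>x. (grad \<phi> x \<bullet> i) * (g x \<bullet> i)) \<in> borel_measurable (lebesgue_on \<Omega>)"
              using test_L2(2)[OF \<Omega>(1) \<phi>] gi by (intro borel_measurable_times borel_measurable_inner) auto
            have "\<bar>(grad \<phi> x \<bullet> i) * (g x \<bullet> i)\<bar> \<le> \<bar>M * (g x \<bullet> i)\<bar>" for x
              unfolding abs_mult by (intro mult_right_mono order_trans[OF M abs_ge_self]) simp
            then show "AE x in lebesgue_on \<Omega>. norm ((grad \<phi> x \<bullet> i) * (g x \<bullet> i)) \<le> norm (M * (g x \<bullet> i))" by simp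
          qed
        qed
        then have "(\<Sum>i\<in>Basis. \<integral>x. (grad \<phi> x \<bullet> i) * (g x \<bullet> i) \<partial>lebesgue_on \<Omega>) = (\<integral>x. (\<Sum>i\<in>Basis. (grad \<phi> x \<bullet> i) * (g x \<bullet> i)) \<partial>lebesgue_on \<Omega>)"
          by (intro Bochner_Integration.integral_sum[symmetric])
        moreover have "(\<Sum>i\<in>Basis. (grad \<phi> x \<bullet> i) * (g x \<bullet> i)) = g x \<bullet> grad \<phi> x" for x
          by (subst inner_commute) (rule euclidean_inner[symmetric])
        ultimately show ?thesis by (simp only:)
      qed
      also have "\<dots> = L2_inner \<Omega> \<zeta> \<phi>" using g(2) \<phi> by (simp add: has_weak_div_def L2_inner_def)
      finally show "vector_integral \<Omega> (\<lambda>A. q A - field_measure g A) (grad \<phi>) = 0" using q_eq[OF \<phi>] by simp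
    qed
  qed
qed

text \<open>The distributional divergence is determined only up to null sets, so \<open>d\<close>
  ranges over all of its square integrable representatives; the subdifferential likewise contains
  every representative of its elements, and the two sides agree as sets of functions.\<close>

theorem proposition2p4:
  fixes \<Omega> :: "(real ^ 'n) set" and u :: "real ^ 'n \<Rightarrow> real"
  assumes "open \<Omega>" and "connected \<Omega>" and "bounded \<Omega>" and "\<Omega> \<noteq> {}"
    and "u \<in> L2 \<Omega>"
  shows "subdiff_J \<Omega> u =
    {\<zeta>. \<exists>q g r d. q = (\<lambda>A. field_measure g A + r A) \<and> g \<in> G1_0 \<Omega> \<and> r \<in> N_div \<Omega> \<and>
       d \<in> L2 \<Omega> \<and> has_measure_div \<Omega> q d \<and> \<zeta> = (\<lambda>x. - d x) \<and>
       ereal (\<integral>x. - d x * u x \<partial>lebesgue_on \<Omega>) = Jfun \<Omega> u \<and>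
       total_variation \<Omega> q \<Omega> \<le> 1}"
proof (intro set_eqI iffI)
  fix \<zeta> assume "\<zeta> \<in> subdiff_J \<Omega> u"
  then have \<zeta>: "\<zeta> \<in> L2 \<Omega>" "\<And>v. v \<in> L2 \<Omega> \<Longrightarrow> ereal (L2_inner \<Omega> \<zeta> v) \<le> Jfun \<Omega> v"
    "ereal (L2_inner \<Omega> \<zeta> u) = Jfun \<Omega> u" by (auto simp: subdiff_J_def)
  obtain \<phi> g where g: "\<phi> \<in> H1_0 \<Omega>" "g \<in> L2 \<Omega>" "has_weak_grad \<Omega> \<phi> g" "has_weak_div \<Omega> g (\<lambda>x. - \<zeta> x)"
    using poisson_weak_solution[OF assms(1,3) \<zeta>(1)] by blast
  have d: "(\<lambda>x. - \<zeta> x) \<in> L2 \<Omega>" using \<zeta>(1) by (simp add: L2_def)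
  have gG: "g \<in> G1_0 \<Omega>" using g d by (auto simp: G1_0_def)
  obtain q where q: "total_variation \<Omega> q \<Omega> \<le> 1"
    "\<And>\<phi>. \<phi> \<in> test_functions \<Omega> \<Longrightarrow> vector_integral \<Omega> q (grad \<phi>) = L2_inner \<Omega> \<zeta> \<phi>"
    "(\<lambda>A. q A - field_measure g A) \<in> N_div \<Omega>"
    using dual_bound_imp_measure[OF assms(1,3) \<zeta>(1,2) g(2,4)] by blast
  \<comment> \<open>The sign conventions cancel: integrating grad \<phi> against q gives minus the
    integral of the divergence times \<phi>, so the representing identity for \<zeta> says that q
    has divergence - \<zeta>.\<close>
  have "has_measure_div \<Omega> q (\<lambda>x. - \<zeta> x)"
    unfolding has_measure_div_def
    using q(2) integrable_L1_loc[OF assms(1) L2_integrable[OF assms(1,3) d]] by (simp add: L2_inner_def)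
  then show "\<zeta> \<in> {\<zeta>. \<exists>q g r d. q = (\<lambda>A. field_measure g A + r A) \<and> g \<in> G1_0 \<Omega> \<and> r \<in> N_div \<Omega> \<and>
       d \<in> L2 \<Omega> \<and> has_measure_div \<Omega> q d \<and> \<zeta> = (\<lambda>x. - d x) \<and>
       ereal (\<integral>x. - d x * u x \<partial>lebesgue_on \<Omega>) = Jfun \<Omega> u \<and>
       total_variation \<Omega> q \<Omega> \<le> 1}"
    by (intro CollectI exI[of _ q] exI[of _ g] exI[of _ "\<lambda>A. q A - field_measure g A"] exI[of _ "\<lambda>x. - \<zeta> x"] conjI gG q d)
      (use \<zeta>(3) in \<open>simp_all add: L2_inner_def\<close>)
next
  fix \<zeta> assume "\<zeta> \<in> {\<zeta>. \<exists>q g r d. q = (\<lambda>A. field_measure g A + r A) \<and> g \<in> G1_0 \<Omega> \<and> r \<in> N_div \<Omega> \<and>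
       d \<in> L2 \<Omega> \<and> has_measure_div \<Omega> q d \<and> \<zeta> = (\<lambda>x. - d x) \<and>
       ereal (\<integral>x. - d x * u x \<partial>lebesgue_on \<Omega>) = Jfun \<Omega> u \<and>
       total_variation \<Omega> q \<Omega> \<le> 1}"
  then obtain q g r d where q: "q = (\<lambda>A. field_measure g A + r A)" and g: "g \<in> G1_0 \<Omega>" and r: "r \<in> N_div \<Omega>"
    and d: "d \<in> L2 \<Omega>" "has_measure_div \<Omega> q d" and \<zeta>: "\<zeta> = (\<lambda>x. - d x)"
    and eq: "ereal (\<integral>x. - d x * u x \<partial>lebesgue_on \<Omega>) = Jfun \<Omega> u" and tv: "total_variation \<Omega> q \<Omega> \<le> 1"
    by (elim CollectE exE conjE)
  have gi: "integrable (lebesgue_on \<Omega>) g" using g by (intro L2_integrable assms) (simp add: G1_0_def)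
  have qm: "q \<in> vector_measures \<Omega>"
    unfolding q using r by (intro vector_measures_add field_measure_vector_measure[OF assms(1) gi]) (simp add: N_div_def)
  have \<zeta>L2: "\<zeta> \<in> L2 \<Omega>" unfolding \<zeta> using d(1) by (simp add: L2_def)
  have "vector_integral \<Omega> q (grad \<phi>) = L2_inner \<Omega> \<zeta> \<phi>" if "\<phi> \<in> test_functions \<Omega>" for \<phi>
    using d(2) that by (simp add: has_measure_div_def L2_inner_def \<zeta>)
  then have "ereal (L2_inner \<Omega> \<zeta> v) \<le> Jfun \<Omega> v" if "v \<in> L2 \<Omega>" for v
    using L2_inner_le_Jfun[OF assms(1,3,4) qm tv \<zeta>L2 _ that] by blast
  moreover have "ereal (L2_inner \<Omega> \<zeta> u) = Jfun \<Omega> u" using eq by (simp add: L2_inner_def \<zeta>)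
  ultimately show "\<zeta> \<in> subdiff_J \<Omega> u" using \<zeta>L2 by (simp add: subdiff_J_def)
qed

end
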